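(* Let $m\ge4$, let $(M,g)$ be an $m$-dimensional Riemannian manifold and let $\Omega$ be an end of $M$ satisfying (1) $(M,g)$ is Ricci-flat on $\Omega$; (2) $\mathrm{Vol}(B(o,r)\cap\Omega)\ge Cr^m$ for some fixed $o\in M$ and $C>0$ and any large $r>0$; (3) $\int_\Omega|Rm|^{m/2}dV_g<\infty$. Assume that there are two coordinate systems $(x_k)$ and $(y_k)$ defined on (the universal cover of) $\Omega\setminus K$, with $K\subset M$ compact, such that in each of these coordinate systems we have Weyl tensors $W$ and $\tilde W$ respectively satisfying $$g=\Big(\delta_{ij}+W_{iabj}\frac{x_ax_b}{|x|^{m+2}}+O(|x|^{-(m+1)})\Big)dx_i\otimes dx_j$$ and $$g=\Big(\delta_{ij}+\tilde W_{iabj}\frac{y_ay_b}{|y|^{m+2}}+O(|y|^{-(m+1)})\Big)dy_i\otimes dy_j .$$ Then there exists an $A\in O(m)$ such that $$W_{ijkl}=\tilde W_{abcd}A_{ai}A_{bj}A_{ck}A_{dl}.$$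
   Context: Repeated indices are summed. $Rm$ is the Riemann curvature tensor and $B(o,r)$ is the geodesic ball of radius $r$ centered at $o$. The metric lifted to the universal cover is still denoted $g$. For a function $f$ defined on $\mathbb{R}^m\setminus B(0,R)$, $f\in O(|x|^{-\tau})$ means that there are constants $C(k)$ with $|\partial^{(k)}f|(x)\le C(k)|x|^{-\tau-k}$ on $\mathbb{R}^m\setminus B(0,R)$ for every $k=0,1,2,\dots$. A Weyl tensor on $\mathbb{R}^m$ is a 4-tensor $W$ with $W_{ijkl}=-W_{jikl}=-W_{ijlk}$, $W_{ijkl}+W_{iklj}+W_{iljk}=0$, and all traces (over any pair of indices) zero. *)

theory Defs
  imports "HOL-Analysis.Analysis"
begin

section \<open>Smooth functions and the order symbol\<close>

definition partial :: "'n \<Rightarrow> (real^'n \<Rightarrow> real) \<Rightarrow> real^'n::finite \<Rightarrow> real" where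
  "partial i f u = frechet_derivative f (at u) (axis i 1)"

fun iter_partial :: "'n list \<Rightarrow> (real^'n \<Rightarrow> real) \<Rightarrow> real^'n::finite \<Rightarrow> real" where
  "iter_partial [] f = f"
| "iter_partial (i # is) f = partial i (iter_partial is f)"

text \<open>\<open>C\<close>-infinity on an open set: all iterated partial derivatives exist and are
  (totally) differentiable.\<close>
definition smooth_real_on :: "(real^'n::finite) set \<Rightarrow> (real^'n \<Rightarrow> real) \<Rightarrow> bool" where
  "smooth_real_on S f \<longleftrightarrow> (\<forall>is. \<forall>u\<in>S. iter_partial is f differentiable (at u))"

definition smooth_map_on :: "(real^'n::finite) set \<Rightarrow> (real^'n \<Rightarrow> real^'k) \<Rightarrow> bool" where
  "smooth_map_on S F \<longleftrightarrow> (\<forall>a. smooth_real_on S (\<lambda>u. F u $ a))"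

text \<open>Euclidean norm of the tensor of all \<open>k\<close>-th order partial derivatives.\<close>
definition deriv_norm :: "nat \<Rightarrow> (real^'n::finite \<Rightarrow> real) \<Rightarrow> real^'n \<Rightarrow> real" where
  "deriv_norm k f u = sqrt (\<Sum>is | length is = k. (iter_partial is f u)\<^sup>2)"

text \<open>\<open>f \<in> O(|x|\<^sup>-\<^sup>\<tau>)\<close> in the sense that includes all derivatives; \<open>S\<close> is the open domain of
  \<open>f\<close>, a neighbourhood of infinity that stays away from the origin.\<close>
definition bigo_all_derivs :: "(real^'n::finite) set \<Rightarrow> real \<Rightarrow> (real^'n \<Rightarrow> real) set" where
  "bigo_all_derivs S \<tau> = {f. smooth_real_on S f \<and>
     (\<exists>C::nat \<Rightarrow> real. \<forall>k. \<forall>x\<in>S. deriv_norm k f x \<le> C k * norm x powr (- \<tau> - real k))}"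

section \<open>Smooth manifolds and Riemannian metrics\<close>

text \<open>A manifold is a subset \<open>M\<close> of a Hausdorff second countable type, with the subspace topology
  and a smooth atlas.  A chart is its domain together with its coordinate map.\<close>

type_synonym ('a, 'n) chart = "'a set \<times> ('a \<Rightarrow> real^'n)"

definition chart_inv :: "('a, 'n) chart \<Rightarrow> real^'n \<Rightarrow> 'a" where
  "chart_inv c = inv_into (fst c) (snd c)"

definition topological_chart :: "'a::topological_space set \<Rightarrow> ('a, 'n::finite) chart \<Rightarrow> bool" where
  "topological_chart M c \<longleftrightarrow> openin (top_of_set M) (fst c) \<and> open (snd c ` fst c) \<and>
     homeomorphism (fst c) (snd c ` fst c) (snd c) (chart_inv c)"

definition smoothly_compatible :: "('a, 'n::finite) chart \<Rightarrow> ('a, 'n) chart \<Rightarrow> bool" where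
  "smoothly_compatible c d \<longleftrightarrow>
     smooth_map_on (snd c ` (fst c \<inter> fst d)) (snd d \<circ> chart_inv c) \<and>
     smooth_map_on (snd d ` (fst c \<inter> fst d)) (snd c \<circ> chart_inv d)"

definition smooth_atlas :: "'a::topological_space set \<Rightarrow> ('a, 'n::finite) chart set \<Rightarrow> bool" where
  "smooth_atlas M \<A> \<longleftrightarrow> (\<Union>c\<in>\<A>. fst c) = M \<and> (\<forall>c\<in>\<A>. topological_chart M c) \<and>
     (\<forall>c\<in>\<A>. \<forall>d\<in>\<A>. smoothly_compatible c d)"

text \<open>Tangent vectors and tensors at a point are handled through their components in charts.  A
  Riemannian metric assigns to a chart \<open>c\<close> and a point \<open>q\<close> of its domain the component matrix
  \<open>g c q\<close>; the last conjunct is the transformation law of a covariant 2-tensor.\<close>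

type_synonym ('a, 'n) metric_comps = "('a, 'n) chart \<Rightarrow> 'a \<Rightarrow> real^'n^'n"

definition riemannian_metric :: "('a, 'n::finite) chart set \<Rightarrow> ('a, 'n) metric_comps \<Rightarrow> bool" where
  "riemannian_metric \<A> g \<longleftrightarrow>
     (\<forall>c\<in>\<A>. \<forall>q\<in>fst c. transpose (g c q) = g c q \<and> (\<forall>v. v \<noteq> 0 \<longrightarrow> v \<bullet> (g c q *v v) > 0)) \<and>
     (\<forall>c\<in>\<A>. \<forall>i j. smooth_real_on (snd c ` fst c) (\<lambda>u. g c (chart_inv c u) $ i $ j)) \<and>
     (\<forall>c\<in>\<A>. \<forall>d\<in>\<A>. \<forall>q\<in>fst c \<inter> fst d.
        let J = jacobian (snd d \<circ> chart_inv c) (at (snd c q))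
        in g c q = transpose J ** g d q ** J)"

text \<open>An arbitrary chart around \<open>q\<close>, used only to evaluate quantities that do not depend on the
  choice of chart.\<close>
definition chart_at :: "('a, 'n) chart set \<Rightarrow> 'a \<Rightarrow> ('a, 'n) chart" where
  "chart_at \<A> q = (SOME c. c \<in> \<A> \<and> q \<in> fst c)"

definition in_coords :: "('a, 'n) metric_comps \<Rightarrow> ('a, 'n) chart \<Rightarrow> real^'n \<Rightarrow> real^'n^'n" where
  "in_coords g c u = g c (chart_inv c u)"

section \<open>Distance and volume\<close>

text \<open>The exceptional finite set of parameters also absorbs the end points 0 and 1.\<close>
definition admissible_curve ::
  "'a::topological_space set \<Rightarrow> ('a, 'n::finite) chart set \<Rightarrow> (real \<Rightarrow> 'a) \<Rightarrow> bool" where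
  "admissible_curve M \<A> \<gamma> \<longleftrightarrow> path \<gamma> \<and> path_image \<gamma> \<subseteq> M \<and>
     (\<exists>S. finite S \<and> (\<forall>c\<in>\<A>. (snd c \<circ> \<gamma>) C1_differentiable_on {t\<in>{0..1} - S. \<gamma> t \<in> fst c}))"

definition speed ::
  "('a, 'n::finite) chart set \<Rightarrow> ('a, 'n) metric_comps \<Rightarrow> (real \<Rightarrow> 'a) \<Rightarrow> real \<Rightarrow> real" where
  "speed \<A> g \<gamma> t = (let c = chart_at \<A> (\<gamma> t); v = vector_derivative (snd c \<circ> \<gamma>) (at t)
                       in sqrt (v \<bullet> (g c (\<gamma> t) *v v)))"

definition curve_length ::
  "('a, 'n::finite) chart set \<Rightarrow> ('a, 'n) metric_comps \<Rightarrow> (real \<Rightarrow> 'a) \<Rightarrow> ennreal" where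
  "curve_length \<A> g \<gamma> = (\<integral>\<^sup>+t\<in>{0..1}. ennreal (speed \<A> g \<gamma> t) \<partial>lborel)"

definition riem_dist :: "'a::topological_space set \<Rightarrow> ('a, 'n::finite) chart set \<Rightarrow>
    ('a, 'n) metric_comps \<Rightarrow> 'a \<Rightarrow> 'a \<Rightarrow> ennreal" where
  "riem_dist M \<A> g p q =
     (INF \<gamma>\<in>{\<gamma>. admissible_curve M \<A> \<gamma> \<and> pathstart \<gamma> = p \<and> pathfinish \<gamma> = q}.
        curve_length \<A> g \<gamma>)"

definition geodesic_ball :: "'a::topological_space set \<Rightarrow> ('a, 'n::finite) chart set \<Rightarrow>
    ('a, 'n) metric_comps \<Rightarrow> 'a \<Rightarrow> real \<Rightarrow> 'a set" where
  "geodesic_ball M \<A> g p r = {q\<in>M. riem_dist M \<A> g p q < ennreal r}"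

text \<open>The Riemannian measure \<open>dV\<^sub>g\<close> is the (unique) Borel measure on \<open>M\<close> that is
  \<open>\<surd>(det g\<^sub>i\<^sub>j) du\<close> in every chart.\<close>
definition riemannian_volume :: "'a::topological_space set \<Rightarrow> ('a, 'n::finite) chart set \<Rightarrow>
    ('a, 'n) metric_comps \<Rightarrow> 'a measure \<Rightarrow> bool" where
  "riemannian_volume M \<A> g \<mu> \<longleftrightarrow> space \<mu> = M \<and> sets \<mu> = sets (restrict_space borel M) \<and>
     (\<forall>c\<in>\<A>. \<forall>E\<in>sets \<mu>. E \<subseteq> fst c \<longrightarrow>
        emeasure \<mu> E = (\<integral>\<^sup>+u\<in>snd c ` E. ennreal (sqrt (det (in_coords g c u))) \<partial>lborel))"

section \<open>Curvature\<close>

text \<open>Here \<open>h\<close> is the component matrix of a metric as a function of the coordinates.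
  \<open>christoffel h k i j\<close> is \<open>\<Gamma>\<^sup>k\<^sub>i\<^sub>j\<close>, and
  \<open>R(\<partial>\<^sub>i, \<partial>\<^sub>j) \<partial>\<^sub>k = \<Sum>l. riemann_13 h l i j k \<partial>\<^sub>l\<close>.\<close>

definition christoffel ::
  "(real^'n \<Rightarrow> real^'n^'n) \<Rightarrow> 'n \<Rightarrow> 'n \<Rightarrow> 'n \<Rightarrow> real^'n::finite \<Rightarrow> real" where
  "christoffel h k i j u = (1/2) * (\<Sum>l\<in>UNIV. matrix_inv (h u) $ k $ l *
     (partial i (\<lambda>v. h v $ j $ l) u + partial j (\<lambda>v. h v $ i $ l) u - partial l (\<lambda>v. h v $ i $ j) u))"

definition riemann_13 ::
  "(real^'n \<Rightarrow> real^'n^'n) \<Rightarrow> 'n \<Rightarrow> 'n \<Rightarrow> 'n \<Rightarrow> 'n \<Rightarrow> real^'n::finite \<Rightarrow> real" where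
  "riemann_13 h l i j k u =
     partial i (christoffel h l j k) u - partial j (christoffel h l i k) u +
     (\<Sum>p\<in>UNIV. christoffel h l i p u * christoffel h p j k u -
                christoffel h l j p u * christoffel h p i k u)"

definition riemann_04 ::
  "(real^'n \<Rightarrow> real^'n^'n) \<Rightarrow> 'n \<Rightarrow> 'n \<Rightarrow> 'n \<Rightarrow> 'n \<Rightarrow> real^'n::finite \<Rightarrow> real" where
  "riemann_04 h i j k l u = (\<Sum>p\<in>UNIV. h u $ l $ p * riemann_13 h p i j k u)"

definition ricci :: "(real^'n \<Rightarrow> real^'n^'n) \<Rightarrow> 'n \<Rightarrow> 'n \<Rightarrow> real^'n::finite \<Rightarrow> real" where
  "ricci h j k u = (\<Sum>i\<in>UNIV. riemann_13 h i i j k u)"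

definition curvature_norm :: "(real^'n \<Rightarrow> real^'n^'n) \<Rightarrow> real^'n::finite \<Rightarrow> real" where
  "curvature_norm h u = (let H = matrix_inv (h u) in
     sqrt (\<Sum>i\<in>UNIV. \<Sum>j\<in>UNIV. \<Sum>k\<in>UNIV. \<Sum>l\<in>UNIV. \<Sum>a\<in>UNIV. \<Sum>b\<in>UNIV. \<Sum>c\<in>UNIV. \<Sum>d\<in>UNIV.
       H $ i $ a * H $ j $ b * H $ k $ c * H $ l $ d *
       riemann_04 h i j k l u * riemann_04 h a b c d u))"

definition Rm_norm ::
  "('a, 'n::finite) chart set \<Rightarrow> ('a, 'n) metric_comps \<Rightarrow> 'a \<Rightarrow> real" where
  "Rm_norm \<A> g q = (let c = chart_at \<A> q in curvature_norm (in_coords g c) (snd c q))"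

definition ricci_flat_on ::
  "('a, 'n::finite) chart set \<Rightarrow> ('a, 'n) metric_comps \<Rightarrow> 'a set \<Rightarrow> bool" where
  "ricci_flat_on \<A> g \<Omega> \<longleftrightarrow>
     (\<forall>c\<in>\<A>. \<forall>q\<in>fst c \<inter> \<Omega>. \<forall>j k. ricci (in_coords g c) j k (snd c q) = 0)"

section \<open>Ends, universal covers and asymptotic coordinates\<close>

text \<open>An end: a component, not relatively compact, of the complement of a compact set.\<close>
definition end_of :: "'a::topological_space set \<Rightarrow> 'a set \<Rightarrow> bool" where
  "end_of M \<Omega> \<longleftrightarrow> (\<exists>K. compact K \<and> K \<subseteq> M \<and> \<Omega> \<in> components (M - K)) \<and>
     \<not> (\<exists>L. compact L \<and> L \<subseteq> M \<and> \<Omega> \<subseteq> L)"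

text \<open>\<open>covering_space\<close> is the library notion; \<open>simply_connected\<close> includes path connectedness.\<close>
definition universal_cover ::
  "'b::topological_space set \<Rightarrow> ('b \<Rightarrow> 'a::topological_space) \<Rightarrow> 'a set \<Rightarrow> bool" where
  "universal_cover X p S \<longleftrightarrow> covering_space X p S \<and> simply_connected X"

text \<open>The smooth structure lifted along a covering projection \<open>p\<close> from \<open>X\<close>.\<close>
definition lifted_atlas :: "'b::topological_space set \<Rightarrow> ('b \<Rightarrow> 'a) \<Rightarrow> ('a, 'n) chart set \<Rightarrow>
    ('b, 'n) chart set" where
  "lifted_atlas X p \<A> = {(V, snd c \<circ> p) |V c.
     c \<in> \<A> \<and> openin (top_of_set X) V \<and> inj_on p V \<and> p ` V \<subseteq> fst c}"

definition lifted_coordinates :: "'b::topological_space set \<Rightarrow> ('b \<Rightarrow> 'a) \<Rightarrow>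
    ('a, 'n::finite) chart set \<Rightarrow> ('b \<Rightarrow> real^'n) \<Rightarrow> bool" where
  "lifted_coordinates X p \<A> x \<longleftrightarrow>
     topological_chart X (X, x) \<and> (\<forall>d\<in>lifted_atlas X p \<A>. smoothly_compatible (X, x) d)"

text \<open>Components of the lifted metric \<open>p\<^sup>* g\<close> in the coordinates \<open>x\<close>, at the point with
  coordinates \<open>u\<close>.\<close>
definition lifted_metric :: "('a, 'n::finite) chart set \<Rightarrow> ('a, 'n) metric_comps \<Rightarrow>
    'b set \<Rightarrow> ('b \<Rightarrow> 'a) \<Rightarrow> ('b \<Rightarrow> real^'n) \<Rightarrow> real^'n \<Rightarrow> real^'n^'n" where
  "lifted_metric \<A> g X p x u =
     (let q = p (chart_inv (X, x) u); c = chart_at \<A> q;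
          J = jacobian (snd c \<circ> p \<circ> chart_inv (X, x)) (at u)
      in transpose J ** g c q ** J)"

definition weyl_tensor :: "('n::finite \<Rightarrow> 'n \<Rightarrow> 'n \<Rightarrow> 'n \<Rightarrow> real) \<Rightarrow> bool" where
  "weyl_tensor W \<longleftrightarrow>
     (\<forall>i j k l. W i j k l = - W j i k l \<and> W i j k l = - W i j l k) \<and>
     (\<forall>i j k l. W i j k l + W i k l j + W i l j k = 0) \<and>
     (\<forall>k l. (\<Sum>a\<in>UNIV. W a a k l) = 0 \<and> (\<Sum>a\<in>UNIV. W a k a l) = 0 \<and>
            (\<Sum>a\<in>UNIV. W a k l a) = 0 \<and> (\<Sum>a\<in>UNIV. W k a a l) = 0 \<and>
            (\<Sum>a\<in>UNIV. W k a l a) = 0 \<and> (\<Sum>a\<in>UNIV. W k l a a) = 0)"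

text \<open>The range of the coordinates is an open neighbourhood of infinity inside the exterior of some
  ball \<open>B(0,R)\<close>, \<open>R > 0\<close>.  It need not be the whole exterior, because two coordinate systems on
  the same region \<open>\<Omega> - K\<close> cannot in general both be made to fill exteriors of round balls.\<close>
definition exterior_domain :: "(real^'n::finite) set \<Rightarrow> bool" where
  "exterior_domain U \<longleftrightarrow> open U \<and> (\<exists>R>0. U \<subseteq> {u. norm u > R}) \<and> (\<exists>R. {u. norm u > R} \<subseteq> U)"

definition has_weyl_expansion ::
  "(real^'n::finite) set \<Rightarrow> (real^'n \<Rightarrow> real^'n^'n) \<Rightarrow> ('n \<Rightarrow> 'n \<Rightarrow> 'n \<Rightarrow> 'n \<Rightarrow> real) \<Rightarrow> bool" where
  "has_weyl_expansion U h W \<longleftrightarrow> (\<forall>i j.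
     (\<lambda>u. h u $ i $ j - (if i = j then 1 else 0)
        - (\<Sum>a\<in>UNIV. \<Sum>b\<in>UNIV. W i a b j * (u $ a * u $ b) / norm u ^ (CARD('n) + 2)))
     \<in> bigo_all_derivs U (real (CARD('n) + 1)))"

end

theory Submission
  imports Defs "HOL-Library.Landau_Symbols"
begin

text \<open>Write \<open>x\<close>, \<open>y\<close> for the two coordinate systems, \<open>h\<close>, \<open>k\<close> for the components of the lifted metric in
them, \<open>m\<close> for the dimension and \<open>\<phi> = y \<circ> x\<^sup>-\<^sup>1\<close> for the change of coordinates, with Jacobian \<open>J\<close>.  The
two expansions are compared through the identity \<open>h = J\<^sup>T (k \<circ> \<phi>) J\<close>, in three stages.

First, \<open>\<phi>\<close> maps infinity to infinity (\<open>tends_to_infinity\<close>).  The image of a neighbourhood of infinity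
cannot be bounded: \<open>h\<close> is bounded below far out and \<open>k\<close> is bounded above everywhere, so the image of a far
out unit ball contains a ball of a fixed radius, and infinitely many disjoint such balls do not fit
into a bounded region.  Being connected and disjoint from a given sphere, the image of a small
neighbourhood of infinity therefore lies outside this sphere.

Second, \<open>\<phi>\<close> is asymptotically a Euclidean motion (\<open>asymptotically_affine\<close>).  Differentiating the
isometry identity and permuting indices, as for the Christoffel symbols, expresses the second
derivatives of \<open>\<phi>\<close> by first derivatives of the metrics, so they are \<open>O(|u|\<^sup>-\<^sup>m\<^sup>-\<^sup>1)\<close>.  Two integrations
from infinity give an orthogonal matrix \<open>A\<close> and a vector \<open>b\<close> such that the displacement
\<open>\<eta>(u) = \<phi>(u) - A u - b\<close> is \<open>O(|u|\<^sup>1\<^sup>-\<^sup>m)\<close> and its derivative is \<open>O(|u|\<^sup>-\<^sup>m)\<close>.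

Third, let \<open>T\<close> be the difference of \<open>W\<close> and the tensor \<open>W'\<close> rotated by \<open>A\<close>.  Up to terms of order
\<open>|u|\<^sup>-\<^sup>m\<^sup>-\<^sup>1\<close>, the isometry identity says that the symmetrised gradient of \<open>A\<^sup>T \<eta>\<close>, evaluated twice on
\<open>v\<close>, is \<open>T(v,u,u,v) / |u|\<^sup>m\<^sup>+\<^sup>2\<close> (\<open>displacement_equation\<close>).  Integrate this along the line
\<open>u = r p + s v\<close> with \<open>p\<close>, \<open>v\<close> orthonormal.  The left-hand side is a derivative in \<open>s\<close> of a function that
vanishes at both ends, so it contributes nothing.  On the right, \<open>T(v,u,u,v) = r\<^sup>2 T(v,p,p,v)\<close> because
\<open>T\<close> is antisymmetric, and the integral is a positive multiple of \<open>T(v,p,p,v) r\<^sup>1\<^sup>-\<^sup>m\<close>, whereas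
the error integrates to \<open>O(r\<^sup>-\<^sup>m)\<close>.  Letting \<open>r\<close> tend to infinity, \<open>T(v,p,p,v) = 0\<close>
(\<open>line_integral_zero\<close>).  An algebraic curvature tensor whose sectional curvatures all vanish is zero
(\<open>curvature_like_eq_zero\<close>), hence \<open>W\<close> is \<open>W'\<close> rotated by \<open>A\<close>.
\<close>

section \<open>Algebraic curvature tensors\<close>

definition curvature_like :: "('n \<Rightarrow> 'n \<Rightarrow> 'n \<Rightarrow> 'n \<Rightarrow> real) \<Rightarrow> bool" where
  "curvature_like T \<longleftrightarrow>
     (\<forall>i j k l. T i j k l = - T j i k l \<and> T i j k l = - T i j l k) \<and>
     (\<forall>i j k l. T i j k l + T i k l j + T i l j k = 0)"

definition form4 :: "('n::finite \<Rightarrow> 'n \<Rightarrow> 'n \<Rightarrow> 'n \<Rightarrow> real) \<Rightarrow> real^'n \<Rightarrow> real^'n \<Rightarrow> real^'n \<Rightarrow> real^'n \<Rightarrow> real"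
  where "form4 T a b c d = (\<Sum>i\<in>UNIV. \<Sum>j\<in>UNIV. \<Sum>k\<in>UNIV. \<Sum>l\<in>UNIV. T i j k l * a$i * b$j * c$k * d$l)"

definition pullback4 :: "real^'n^'n \<Rightarrow> ('n::finite \<Rightarrow> 'n \<Rightarrow> 'n \<Rightarrow> 'n \<Rightarrow> real) \<Rightarrow> 'n \<Rightarrow> 'n \<Rightarrow> 'n \<Rightarrow> 'n \<Rightarrow> real"
  where "pullback4 A T i j k l = form4 T (column i A) (column j A) (column k A) (column l A)"

text \<open>The octahedron argument: four instances of the Bianchi identity, one for each choice of the leading
index, combine with the antisymmetries so that only the two sides survive.\<close>
lemma curvature_like_pair_symmetric:
  assumes "curvature_like T"
  shows "T i j k l = T k l i j"
proof -
  have a: "T i j k l = - T j i k l" "T i j k l = - T i j l k" for i j k l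
    using assms unfolding curvature_like_def by blast+
  have b: "T i j k l + T i k l j + T i l j k = 0" for i j k l
    using assms unfolding curvature_like_def by blast+
  have "T i j k l - T i k j l + T i l j k = 0"
    using b[of i j k l] a(2)[of i k l j] by simp
  moreover have "T j l i k - T j k i l - T i j k l = 0"
    using b[of j k l i] a(2)[of j k l i] a(1)[of j i k l] by simp
  moreover have "T k l i j - T i k j l + T j k i l = 0"
    using b[of k l i j] a(1)[of k i j l] a(1)[of k j l i] a(2)[of j k l i] by simp
  moreover have "T j l i k - T i l j k - T k l i j = 0"
    using b[of l i j k] a(1)[of l i j k] a(1)[of l j k i] a(2)[of j l k i] a(1)[of l k i j] by simp
  ultimately show ?thesis by linarith
qed

lemma form4_linear:
  "linear (\<lambda>x. form4 T x b c d)" "linear (\<lambda>x. form4 T a x c d)"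
  "linear (\<lambda>x. form4 T a b x d)" "linear (\<lambda>x. form4 T a b c x)"
  by (auto intro!: linearI simp: form4_def sum.distrib[symmetric] sum_distrib_left algebra_simps intro!: sum.cong)

lemma form4_antisymmetric:
  assumes "curvature_like T"
  shows "form4 T a b c d = - form4 T b a c d" "form4 T a b c d = - form4 T a b d c"
proof -
  have s: "T i j k l = - T j i k l" "T i j k l = - T i j l k" for i j k l
    using assms unfolding curvature_like_def by blast+
  have "form4 T a b c d = (\<Sum>i\<in>UNIV. \<Sum>j\<in>UNIV. \<Sum>k\<in>UNIV. \<Sum>l\<in>UNIV. - (T j i k l * b$j * a$i * c$k * d$l))"
    unfolding form4_def by (subst s(1)) (simp add: mult_ac)
  also have "\<dots> = (\<Sum>j\<in>UNIV. \<Sum>i\<in>UNIV. \<Sum>k\<in>UNIV. \<Sum>l\<in>UNIV. - (T j i k l * b$j * a$i * c$k * d$l))"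
    by (rule sum.swap)
  also have "\<dots> = - form4 T b a c d"
    by (simp add: form4_def sum_negf)
  finally show "form4 T a b c d = - form4 T b a c d" .
  have "(\<Sum>k\<in>UNIV. \<Sum>l\<in>UNIV. T i j k l * a$i * b$j * c$k * d$l) =
      (\<Sum>l\<in>UNIV. \<Sum>k\<in>UNIV. - (T i j l k * a$i * b$j * d$l * c$k))" for i j
    by (subst s(2), subst sum.swap) (simp add: mult_ac)
  then show "form4 T a b c d = - form4 T a b d c"
    by (simp add: form4_def sum_negf)
qed

lemma form4_repeat:
  assumes "curvature_like T"
  shows "form4 T a a c d = 0" "form4 T a b c c = 0"
  using form4_antisymmetric(1)[OF assms, of a a c d] form4_antisymmetric(2)[OF assms, of a b c c] by auto

text \<open>Shearing \<open>p\<close> along \<open>v\<close> does not change the sectional curvature of the plane that they span.  This is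
why \<open>T(v,u,u,v)\<close> is constant along the lines in direction \<open>v\<close>.\<close>
lemma form4_sectional_shear:
  assumes "curvature_like T"
  shows "form4 T v (r *\<^sub>R p + s *\<^sub>R v) (r *\<^sub>R p + s *\<^sub>R v) v = r\<^sup>2 * form4 T v p p v"
  using form4_repeat[OF assms]
  by (simp add: form4_linear[THEN linear_add] form4_linear[THEN linear_scale] power2_eq_square)

lemma form4_Bianchi:
  fixes T :: "'n::finite \<Rightarrow> 'n \<Rightarrow> 'n \<Rightarrow> 'n \<Rightarrow> real"
  assumes "curvature_like T"
  shows "form4 T a b c d + form4 T a c d b + form4 T a d b c = 0"
proof -
  have z: "T i j k l + T i k l j + T i l j k = 0" for i j k l
    using assms unfolding curvature_like_def by blast+
  have rotate: "(\<Sum>j\<in>UNIV. \<Sum>k\<in>UNIV. \<Sum>l\<in>UNIV. f j k l) = (\<Sum>j\<in>UNIV. \<Sum>k\<in>UNIV. \<Sum>l\<in>UNIV. f k l j)"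
    for f :: "'n \<Rightarrow> 'n \<Rightarrow> 'n \<Rightarrow> real"
    by (rule trans[OF sum.cong[OF refl sum.swap] sum.swap])
  have 1: "(\<Sum>j\<in>UNIV. \<Sum>k\<in>UNIV. \<Sum>l\<in>UNIV. T i j k l * a$i * c$j * d$k * b$l) =
     (\<Sum>j\<in>UNIV. \<Sum>k\<in>UNIV. \<Sum>l\<in>UNIV. T i k l j * a$i * c$k * d$l * b$j)" for i
    by (rule rotate)
  have 2: "(\<Sum>j\<in>UNIV. \<Sum>k\<in>UNIV. \<Sum>l\<in>UNIV. T i j k l * a$i * d$j * b$k * c$l) =
     (\<Sum>j\<in>UNIV. \<Sum>k\<in>UNIV. \<Sum>l\<in>UNIV. T i l j k * a$i * d$l * b$j * c$k)" for i
    by (subst rotate, subst rotate) (rule refl)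
  have "form4 T a b c d + form4 T a c d b + form4 T a d b c =
    (\<Sum>i\<in>UNIV. \<Sum>j\<in>UNIV. \<Sum>k\<in>UNIV. \<Sum>l\<in>UNIV. (T i j k l + T i k l j + T i l j k) * (a$i * b$j * c$k * d$l))"
    unfolding form4_def 1 2 by (simp add: sum.distrib[symmetric] algebra_simps)
  then show ?thesis by (simp add: z)
qed

lemma curvature_like_pullback4:
  assumes "curvature_like T"
  shows "curvature_like (pullback4 A T)"
  unfolding curvature_like_def pullback4_def
  using form4_antisymmetric[OF assms] form4_Bianchi[OF assms] by blast

lemma curvature_like_diff:
  assumes "curvature_like S" "curvature_like T"
  shows "curvature_like (\<lambda>i j k l. S i j k l - T i j k l)"
  using assms unfolding curvature_like_def by (smt (verit))

lemma form4_diff: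
  "form4 (\<lambda>i j k l. S i j k l - T i j k l) a b c d = form4 S a b c d - form4 T a b c d"
  by (simp add: form4_def sum_subtractf algebra_simps)

lemma form4_pullback4:
  "form4 (pullback4 A T) a b c d = form4 T (A *v a) (A *v b) (A *v c) (A *v d)"
proof -
  have mv: "A *v x = (\<Sum>i\<in>UNIV. x$i *\<^sub>R column i A)" for x
    by (simp add: matrix_mult_sum scalar_mult_eq_scaleR)
  have expand:
    "form4 T (A *v x) b c d = (\<Sum>i\<in>UNIV. x$i * form4 T (column i A) b c d)"
    "form4 T a (A *v x) c d = (\<Sum>i\<in>UNIV. x$i * form4 T a (column i A) c d)"
    "form4 T a b (A *v x) d = (\<Sum>i\<in>UNIV. x$i * form4 T a b (column i A) d)"
    "form4 T a b c (A *v x) = (\<Sum>i\<in>UNIV. x$i * form4 T a b c (column i A))" for x a b c d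
    unfolding mv by (simp_all add: form4_linear[THEN linear_sum] form4_linear[THEN linear_scale])
  show ?thesis
    by (simp only: expand(1), simp only: expand(2), simp only: expand(3), simp only: expand(4),
        simp add: sum_distrib_left form4_def[of "pullback4 A T"] pullback4_def mult_ac)
qed

text \<open>Polarisation, applied to sums of two basis vectors.\<close>
lemma quadratic_form_zero:
  fixes S :: "'n::finite \<Rightarrow> 'n \<Rightarrow> real"
  assumes "\<And>v::real^'n. (\<Sum>i\<in>UNIV. \<Sum>j\<in>UNIV. S i j * v$i * v$j) = 0"
  shows "S i j + S j i = 0"
proof -
  define q where "q v w = (\<Sum>i\<in>UNIV. \<Sum>j\<in>UNIV. S i j * v$i * w$j)" for v w :: "real^'n"
  have e: "q (axis a 1) (axis b 1) = S a b" for a b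
    
    by (simp add: q_def axis_def mult_delta_left mult_delta_right)
  have "q (v + w) (v + w) = q v v + q v w + q w v + q w w" for v w
    by (simp add: q_def sum.distrib algebra_simps)
  moreover have "q v v = 0" for v using assms by (simp add: q_def)
  ultimately have "q v w + q w v = 0" for v w by (metis add.right_neutral add_0)
  from this[of "axis i 1" "axis j 1"] show ?thesis by (simp add: e)
qed

text \<open>Sectional curvatures determine the tensor.  By scaling and shearing, \<open>T(v,p,p,v)\<close> vanishes for
arbitrary \<open>v\<close> and \<open>p\<close>.  Polarising first in \<open>v\<close> and then in \<open>p\<close> makes \<open>T\<close> antisymmetric in the two middle
indices too; the three terms of the Bianchi identity then coincide.\<close>
lemma curvature_like_eq_zero:
  fixes T :: "'n::finite \<Rightarrow> 'n \<Rightarrow> 'n \<Rightarrow> 'n \<Rightarrow> real"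
  assumes T: "curvature_like T"
    and sec: "\<And>p v :: real^'n. norm p = 1 \<Longrightarrow> norm v = 1 \<Longrightarrow> p \<bullet> v = 0 \<Longrightarrow> form4 T v p p v = 0"
  shows "T i j k l = 0"
proof -
  have all: "form4 T v p p v = 0" for v p :: "real^'n"
  proof (cases "v = 0")
    case True
    then show ?thesis by (simp add: form4_def)
  next
    case v: False
    define e where "e = v /\<^sub>R norm v"
    define s where "s = p \<bullet> e"
    define q where "q = p - s *\<^sub>R e"
    have e: "norm e = 1" "v = norm v *\<^sub>R e" using v by (auto simp: e_def)
    have qe: "q \<bullet> e = 0" using e by (simp add: q_def s_def inner_diff_left dot_square_norm)
    have "form4 T e q q e = 0"
    proof (cases "q = 0")
      case True
      then show ?thesis by (simp add: form4_def)
    next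
      case q0: False
      define d where "d = q /\<^sub>R norm q"
      have d: "norm d = 1" "q = norm q *\<^sub>R d" "d \<bullet> e = 0" using q0 qe by (auto simp: d_def)
      have "form4 T e (norm q *\<^sub>R d) (norm q *\<^sub>R d) e = 0"
        using sec[OF d(1) e(1) d(3)] by (simp add: form4_linear[THEN linear_scale])
      then show ?thesis using d(2) by simp
    qed
    then have "form4 T e (1 *\<^sub>R q + s *\<^sub>R e) (1 *\<^sub>R q + s *\<^sub>R e) e = 0"
      by (simp only: form4_sectional_shear[OF T])
    then have "form4 T (norm v *\<^sub>R e) p p (norm v *\<^sub>R e) = 0"
      by (simp add: form4_linear[THEN linear_scale] q_def)
    then show ?thesis using e(2) by simp
  qed
  \<comment> \<open>polarisation in the outer pair of arguments\<close>
  have inner: "(\<Sum>j\<in>UNIV. \<Sum>k\<in>UNIV. T i j k l * p$j * p$k) = 0" for p :: "real^'n" and i l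
  proof -
    define S where "S i l = (\<Sum>j\<in>UNIV. \<Sum>k\<in>UNIV. T i j k l * p$j * p$k)" for i l
    have "(\<Sum>i\<in>UNIV. \<Sum>l\<in>UNIV. S i l * v$i * v$l) = form4 T v p p v" for v
    proof -
      have "(\<Sum>l\<in>UNIV. S i l * v$i * v$l) =
        (\<Sum>j\<in>UNIV. \<Sum>k\<in>UNIV. \<Sum>l\<in>UNIV. T i j k l * v$i * p$j * p$k * v$l)" for i
        unfolding S_def sum_distrib_right
        by (subst sum.swap, subst (2) sum.swap) (simp add: mult_ac)
      then show ?thesis by (simp add: form4_def)
    qed
    then have "S i l + S l i = 0" by (intro quadratic_form_zero) (simp add: all)
    moreover have "S l i = S i l"
    proof -
      have "T l j k i = T i k j l" for j k
        using curvature_like_pair_symmetric[OF T, of l j k i] T unfolding curvature_like_def by (metis minus_minus)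
      then show ?thesis unfolding S_def by (subst sum.swap) (simp add: mult_ac)
    qed
    ultimately show ?thesis by (simp add: S_def)
  qed
  have "T i j k l + T i k j l = 0" for i j k l
    using quadratic_form_zero[of "\<lambda>j k. T i j k l"] inner by blast
  from this[of i j k l] this[of i j l k] T show ?thesis
    unfolding curvature_like_def by (smt (verit))
qed

lemma curvature_like_weyl_tensor: "weyl_tensor W \<Longrightarrow> curvature_like W"
  unfolding weyl_tensor_def curvature_like_def by blast

section \<open>Functions decaying at infinity\<close>

abbreviation decay :: "nat \<Rightarrow> ('a::real_normed_vector \<Rightarrow> real) set" where
  "decay k \<equiv> O[at_infinity](\<lambda>u. 1 / norm u ^ k)"

text \<open>Turns the filter-based order symbol into explicit constants, the form in which the pointwise
estimates below are proved.\<close>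
lemma decay_iff:
  "f \<in> decay k \<longleftrightarrow> (\<exists>C R. \<forall>u. norm u \<ge> R \<longrightarrow> \<bar>f u\<bar> \<le> C / norm u ^ k)"
proof
  assume "f \<in> decay k"
  then obtain C where "\<forall>\<^sub>F u in at_infinity. norm (f u) \<le> C * norm (1 / norm u ^ k)"
    by (elim landau_o.bigE)
  then show "\<exists>C R. \<forall>u. norm u \<ge> R \<longrightarrow> \<bar>f u\<bar> \<le> C / norm u ^ k"
    by (auto simp: eventually_at_infinity)
next
  assume "\<exists>C R. \<forall>u. norm u \<ge> R \<longrightarrow> \<bar>f u\<bar> \<le> C / norm u ^ k"
  then obtain C R where C: "\<And>u. norm u \<ge> R \<Longrightarrow> \<bar>f u\<bar> \<le> C / norm u ^ k" by blast
  show "f \<in> decay k"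
    by (rule bigoI[where c = C]) (use C in \<open>auto simp: eventually_at_infinity intro!: exI[of _ R]\<close>)
qed

lemma decay_mult:
  assumes "f \<in> decay i" "g \<in> decay j"
  shows "(\<lambda>u. f u * g u) \<in> decay (i + j)"
  using landau_o.big.mult[OF assms] by (simp add: power_add)

lemma decay_mono:
  assumes "f \<in> decay j" "i \<le> j"
  shows "f \<in> decay i"
proof -
  have "(\<lambda>u::'a. 1 / norm u ^ j) \<in> decay i"
    unfolding decay_iff
  proof (intro exI allI impI)
    fix u :: 'a assume u: "norm u \<ge> 1"
    then have "1 / norm u ^ j \<le> 1 / norm u ^ i"
      using assms(2) by (intro divide_left_mono power_increasing mult_pos_pos zero_less_power)
        (auto intro: less_le_trans[OF zero_less_one])
    then show "\<bar>1 / norm u ^ j\<bar> \<le> 1 / norm u ^ i" by simp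
  qed
  then show ?thesis using assms(1) landau_o.big_trans by blast
qed

lemma decay_const: "(\<lambda>_. c) \<in> decay 0"
  by simp

lemma decay_mult_bounded:
  assumes "f \<in> decay i" "g \<in> decay 0"
  shows "(\<lambda>u. f u * g u) \<in> decay i" "(\<lambda>u. g u * f u) \<in> decay i"
  using decay_mult[OF assms] decay_mult[OF assms(2,1)] by simp_all

lemma decay_cmult:
  assumes "f \<in> decay i"
  shows "(\<lambda>u. f u * c) \<in> decay i" "(\<lambda>u. c * f u) \<in> decay i"
  using decay_mult_bounded[OF assms decay_const] by blast+

lemma decay_sum:
  assumes "\<And>a. a \<in> A \<Longrightarrow> f a \<in> decay i"
  shows "(\<lambda>u. \<Sum>a\<in>A. f a u) \<in> decay i"
  using assms by (rule big_sum_in_bigo)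

lemma decay_tendsto_zero:
  assumes "f \<in> decay k" "k \<ge> 1"
  shows "(f \<longlongrightarrow> 0) at_infinity"
proof -
  have "f \<in> decay 1" using decay_mono assms by blast
  then obtain C R where "\<And>u. norm u \<ge> R \<Longrightarrow> \<bar>f u\<bar> \<le> C / norm u ^ 1"
    unfolding decay_iff by blast
  then have "\<forall>\<^sub>F u in at_infinity. norm (f u) \<le> C / norm u"
    by (auto simp: eventually_at_infinity)
  moreover have "((\<lambda>u::'a. C / norm u) \<longlongrightarrow> 0) at_infinity"
    by (rule tendsto_divide_0[OF tendsto_const filterlim_at_top_imp_at_infinity[OF filterlim_norm_at_top]])
  ultimately show ?thesis by (rule Lim_null_comparison)
qed

lemma decay_eventually_cong:
  assumes "f \<in> decay k" "\<forall>\<^sub>F u in at_infinity. f u = g u"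
  shows "g \<in> decay k"
  using assms landau_o.big.in_cong by blast

section \<open>Second derivatives and limits at infinity\<close>

text \<open>The second difference is symmetric in \<open>a\<close> and \<open>b\<close>, so this limit yields the symmetry of second
derivatives.  The mean value theorem in direction \<open>a\<close> turns the second difference into a first
difference of the derivative along \<open>a\<close>, which is differentiable at \<open>u\<close>.\<close>
lemma second_difference_tendsto:
  fixes f :: "'a::real_normed_vector \<Rightarrow> real"
  assumes S: "open S" "u \<in> S"
    and f: "\<And>v. v \<in> S \<Longrightarrow> (f has_derivative F v) (at v)"
    and D: "((\<lambda>v. F v a) has_derivative D) (at u)"
  shows "((\<lambda>t. (f (u + t *\<^sub>R a + t *\<^sub>R b) - f (u + t *\<^sub>R a) - f (u + t *\<^sub>R b) + f u) / t\<^sup>2)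
    \<longlongrightarrow> D b) (at_right 0)"
proof (rule tendstoI)
  fix \<epsilon> :: real assume "\<epsilon> > 0"
  \<comment> \<open>two applications of the differentiability estimate, at distances at most \<open>t (|a| + |b|)\<close> and \<open>t |a|\<close>\<close>
  define N where "N = 2 * norm a + norm b + 1"
  have N: "N > 0" by (simp add: N_def add_nonneg_pos)
  obtain r where r: "r > 0" "ball u r \<subseteq> S" using S openE by blast
  have eN: "\<epsilon> / (2 * N) > 0" using \<open>\<epsilon> > 0\<close> N by simp
  obtain d where d: "d > 0" and dD: "\<And>v. norm (v - u) < d \<Longrightarrow>
      \<bar>F v a - F u a - D (v - u)\<bar> \<le> \<epsilon> / (2 * N) * norm (v - u)"
    using D eN unfolding has_derivative_at_alt real_norm_def by blast
  have lin: "linear D" using D has_derivative_linear by blast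
  have est: "dist ((f (u + t *\<^sub>R a + t *\<^sub>R b) - f (u + t *\<^sub>R a) - f (u + t *\<^sub>R b) + f u) / t\<^sup>2) (D b) < \<epsilon>"
    if t: "0 < t" "t < min d r / N" for t
  proof -
    have tN: "t * N < d" "t * N < r" using t N by (auto simp: field_simps)
    have small: "norm (s *\<^sub>R a + s' *\<^sub>R b) \<le> t * (norm a + norm b)" if "0 \<le> s" "s \<le> t" "0 \<le> s'" "s' \<le> t" for s s'
    proof -
      have "norm (s *\<^sub>R a + s' *\<^sub>R b) \<le> s * norm a + s' * norm b"
        using that by (metis abs_of_nonneg norm_scaleR norm_triangle_ineq)
      also have "\<dots> \<le> t * norm a + t * norm b" using that by (intro add_mono mult_right_mono) auto
      finally show ?thesis by (simp add: algebra_simps)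
    qed
    have "t * (norm a + norm b) \<le> t * N" using t by (simp add: N_def)
    then have small': "norm (s *\<^sub>R a + s' *\<^sub>R b) < min d r" if "0 \<le> s" "s \<le> t" "0 \<le> s'" "s' \<le> t" for s s'
      using small[OF that] tN by linarith
    have inS: "u + s *\<^sub>R a + s' *\<^sub>R b \<in> S" if "0 \<le> s" "s \<le> t" "0 \<le> s'" "s' \<le> t" for s s'
      using small'[OF that] r(2) by (auto simp: subset_iff dist_norm add.assoc norm_minus_commute)
    define g where "g s = f (u + s *\<^sub>R a + t *\<^sub>R b) - f (u + s *\<^sub>R a)" for s
    have "\<exists>x\<in>{0..t}. g t - g 0 = (\<lambda>h. F (u + x *\<^sub>R a + t *\<^sub>R b) (h *\<^sub>R a) - F (u + x *\<^sub>R a) (h *\<^sub>R a)) (t - 0)"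
    proof (rule mvt_very_simple)
      fix x assume x: "0 \<le> x" "x \<le> t"
      show "(g has_derivative (\<lambda>h. F (u + x *\<^sub>R a + t *\<^sub>R b) (h *\<^sub>R a) - F (u + x *\<^sub>R a) (h *\<^sub>R a))) (at x within {0..t})"
        unfolding g_def
      proof (intro has_derivative_diff)
        have l: "((\<lambda>s. u + s *\<^sub>R a + c) has_derivative (\<lambda>h. h *\<^sub>R a)) (at x within {0..t})" for c
          by (auto intro!: derivative_eq_intros)
        show "((\<lambda>s. f (u + s *\<^sub>R a + t *\<^sub>R b)) has_derivative (\<lambda>h. F (u + x *\<^sub>R a + t *\<^sub>R b) (h *\<^sub>R a))) (at x within {0..t})"
          using has_derivative_compose[OF l f[OF inS]] x t by auto
        show "((\<lambda>s. f (u + s *\<^sub>R a)) has_derivative (\<lambda>h. F (u + x *\<^sub>R a) (h *\<^sub>R a))) (at x within {0..t})"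
          using has_derivative_compose[OF l[of 0] f] inS[of x 0] x t by auto
      qed
    qed (use t in auto)
    then obtain x where x: "0 \<le> x" "x \<le> t"
      and g: "g t - g 0 = F (u + x *\<^sub>R a + t *\<^sub>R b) (t *\<^sub>R a) - F (u + x *\<^sub>R a) (t *\<^sub>R a)" by auto
    define p where "p = u + x *\<^sub>R a + t *\<^sub>R b"
    define q where "q = u + x *\<^sub>R a"
    have pS: "p \<in> S" "q \<in> S" using inS[of x t] inS[of x 0] x t by (auto simp: p_def q_def)
    have Fsc: "F v (t *\<^sub>R a) = t * F v a" if "v \<in> S" for v
      using has_derivative_linear[OF f[OF that]] by (simp add: linear_scale)
    have pu: "p - u = x *\<^sub>R a + t *\<^sub>R b" "q - u = x *\<^sub>R a + 0 *\<^sub>R b" by (auto simp: p_def q_def)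
    have np: "norm (p - u) < d" "norm (q - u) < d" using small'[of x t] small'[of x 0] x t unfolding pu by auto
    have nn: "norm (p - u) + norm (q - u) \<le> t * N"
    proof -
      have "norm (q - u) \<le> t * norm a" using x by (simp add: pu mult_right_mono)
      moreover have "norm (p - u) \<le> t * (norm a + norm b)" using small[of x t] x t unfolding pu by auto
      ultimately show ?thesis using t by (simp add: N_def algebra_simps)
    qed
    have Db: "D (p - u) - D (q - u) = t * D b"
      unfolding pu by (simp add: linear_add[OF lin] linear_scale[OF lin])
    have "\<bar>F p a - F q a - t * D b\<bar> \<le> \<epsilon> / (2 * N) * norm (p - u) + \<epsilon> / (2 * N) * norm (q - u)"
      using dD[OF np(1)] dD[OF np(2)] Db by linarith
    also have "\<dots> = \<epsilon> / (2 * N) * (norm (p - u) + norm (q - u))" by (simp add: distrib_left)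
    also have "\<dots> \<le> \<epsilon> / (2 * N) * (t * N)"
      by (rule mult_left_mono[OF nn]) (use \<open>\<epsilon> > 0\<close> N in auto)
    also have "\<dots> = \<epsilon> / 2 * t" using N by (simp add: field_simps)
    finally have "\<bar>F p a - F q a - t * D b\<bar> \<le> \<epsilon> / 2 * t" .
    then have e1: "\<bar>(F p a - F q a - t * D b) / t\<bar> \<le> \<epsilon> / 2" using t by (simp add: field_simps)
    have e2: "(f (u + t *\<^sub>R a + t *\<^sub>R b) - f (u + t *\<^sub>R a) - f (u + t *\<^sub>R b) + f u) / t\<^sup>2 - D b
        = (F p a - F q a - t * D b) / t"
    proof -
      have "f (u + t *\<^sub>R a + t *\<^sub>R b) - f (u + t *\<^sub>R a) - f (u + t *\<^sub>R b) + f u = t * (F p a - F q a)"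
        using g Fsc[OF pS(1)] Fsc[OF pS(2)] by (simp add: g_def p_def q_def algebra_simps)
      then show ?thesis using t by (simp add: diff_divide_distrib power2_eq_square)
    qed
    show ?thesis unfolding dist_real_def e2
      by (rule le_less_trans[OF e1]) (use \<open>\<epsilon> > 0\<close> in simp)
  qed
  have "min d r / N > 0" using d r N by auto
  then show "\<forall>\<^sub>F t in at_right 0. dist ((f (u + t *\<^sub>R a + t *\<^sub>R b) - f (u + t *\<^sub>R a) - f (u + t *\<^sub>R b) + f u) / t\<^sup>2) (D b) < \<epsilon>"
    unfolding eventually_at_right_field using est by blast
qed

lemma partial_has_derivative:
  fixes f :: "real^'n::finite \<Rightarrow> real"
  assumes "f differentiable (at u)"
  shows "(f has_derivative (\<lambda>w. \<Sum>i\<in>UNIV. w $ i * partial i f u)) (at u)"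
proof -
  let ?D = "frechet_derivative f (at u)"
  have D: "(f has_derivative ?D) (at u)" using assms frechet_derivative_works by blast
  then have lin: "linear ?D" by (rule has_derivative_linear)
  have "?D w = (\<Sum>i\<in>UNIV. w $ i * partial i f u)" for w
  proof -
    have "?D w = ?D (\<Sum>i\<in>UNIV. w $ i *\<^sub>R axis i 1)"
      by (simp add: basis_expansion flip: scalar_mult_eq_scaleR)
    then show ?thesis by (simp add: linear_sum[OF lin] linear_scale[OF lin] partial_def)
  qed
  then show ?thesis using D by (metis (no_types, lifting) ext)
qed

lemma partial_eqI:
  fixes f :: "real^'n::finite \<Rightarrow> real"
  assumes "(f has_derivative D) (at u)"
  shows "partial i f u = D (axis i 1)"
  using frechet_derivative_at[OF assms] by (simp add: partial_def)

lemma mixed_partials_commute: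
  fixes f :: "real^'n::finite \<Rightarrow> real"
  assumes S: "open S" "u \<in> S"
    and f: "\<And>v. v \<in> S \<Longrightarrow> f differentiable (at v)"
    and f2: "\<And>i. partial i f differentiable (at u)"
  shows "partial i (partial j f) u = partial j (partial i f) u"
proof -
  have D: "(f has_derivative frechet_derivative f (at v)) (at v)" if "v \<in> S" for v
    using f[OF that] frechet_derivative_works by blast
  have D2: "((\<lambda>v. frechet_derivative f (at v) (axis i 1)) has_derivative frechet_derivative (partial i f) (at u)) (at u)" for i
    using f2[of i] frechet_derivative_works unfolding partial_def[abs_def] by blast
  let ?q = "\<lambda>a b t. (f (u + t *\<^sub>R a + t *\<^sub>R b) - f (u + t *\<^sub>R a) - f (u + t *\<^sub>R b) + f u) / t\<^sup>2"
  have l: "(?q (axis j 1) (axis i 1) \<longlongrightarrow> partial i (partial j f) u) (at_right 0)" for i j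
    unfolding partial_def[of i "partial j f"]
    by (rule second_difference_tendsto[OF S D D2])
  have "?q (axis j 1) (axis i 1) t = ?q (axis i 1) (axis j 1) t" for t
  proof -
    have "u + t *\<^sub>R axis j 1 + t *\<^sub>R axis i 1 = u + t *\<^sub>R axis i 1 + t *\<^sub>R axis j 1"
      by (rule add.assoc[THEN trans, OF add.commute[THEN arg_cong, of "(+) u"], THEN trans, OF add.assoc[symmetric]])
    then have ff: "f (u + t *\<^sub>R axis j 1 + t *\<^sub>R axis i 1) = f (u + t *\<^sub>R axis i 1 + t *\<^sub>R axis j 1)"
      by (rule arg_cong)
    show ?thesis unfolding ff by (rule arg_cong[where f = "\<lambda>x. (x + f u) / t\<^sup>2"]) simp
  qed
  then have "(?q (axis j 1) (axis i 1) \<longlongrightarrow> partial j (partial i f) u) (at_right 0)"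
    using l[where i = j and j = i] by presburger
  with l[where i = i and j = j] show ?thesis by (rule tendsto_unique[OF trivial_limit_at_right_real])
qed

text \<open>A derivative of order \<open>|u|\<^sup>-\<^sup>k\<^sup>-\<^sup>1\<close> is integrable along rays, which gives a limit on each ray with the
rate \<open>|u|\<^sup>-\<^sup>k\<close>.  The limits on different rays agree, because on a sphere of radius \<open>r\<close> two points are
joined by two chords of length at most \<open>2 r\<close> that stay at distance \<open>r/2\<close> from the origin; the dimension
must be at least two for such a detour.\<close>
lemma limit_at_infinity_of_derivative_decay:
  fixes F :: "'a::euclidean_space \<Rightarrow> real"
  assumes dim: "DIM('a) \<ge> 2" and k: "k \<ge> 1"
    and F: "\<And>u. norm u \<ge> R \<Longrightarrow> (F has_derivative F' u) (at u)"
    and bound: "\<And>u w. norm u \<ge> R \<Longrightarrow> \<bar>F' u w\<bar> \<le> C * norm w / norm u ^ (k + 1)"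
  obtains L where "(\<lambda>u. F u - L) \<in> decay k"
proof -
  obtain e0 :: 'a where e0: "norm e0 = 1" using norm_Basis SOME_Basis by blast
  define R1 where "R1 = max R 1"
  have R1: "R1 \<ge> R" "R1 \<ge> 1" by (auto simp: R1_def)
  have C0: "C \<ge> 0"
  proof -
    have "norm (R1 *\<^sub>R e0) = R1" using e0 R1 by simp
    then have "0 \<le> C * 1 / R1 ^ (k+1)" using abs_ge_zero[of "F' (R1 *\<^sub>R e0) e0"] bound[of "R1 *\<^sub>R e0" e0] R1 e0 by simp
    moreover have "R1 ^ (k+1) > 0" using R1 by simp
    ultimately show ?thesis by (simp add: zero_le_divide_iff)
  qed
  have chord: "\<bar>F u - F u'\<bar> \<le> C * 2 ^ (k+2) / r ^ k"
    if u: "norm u = r" "norm u' = r" "u \<bullet> u' \<ge> 0" "r \<ge> 2 * R1" for u u' r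
  proof -
    have uu: "u \<bullet> u = r\<^sup>2" "u' \<bullet> u' = r\<^sup>2" using u(1,2) by (auto simp flip: power2_norm_eq_inner)
    have far: "norm z \<ge> r / 2" if z: "z \<in> closed_segment u u'" for z
    proof -
      obtain t where t: "0 \<le> t" "t \<le> 1" "z = (1 - t) *\<^sub>R u + t *\<^sub>R u'"
        using z by (auto simp: in_segment)
      have "(norm z)\<^sup>2 = (1-t)\<^sup>2 * r\<^sup>2 + t\<^sup>2 * r\<^sup>2 + 2 * (1-t) * t * (u \<bullet> u')"
        unfolding t(3) power2_norm_eq_inner
        by (simp add: inner_add_left inner_add_right inner_commute[of u' u] uu)
           (simp add: power2_eq_square algebra_simps)
      moreover have "2 * (1-t) * t * (u \<bullet> u') \<ge> 0" using t u by auto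
      ultimately have "(norm z)\<^sup>2 \<ge> ((1-t)\<^sup>2 + t\<^sup>2) * r\<^sup>2" by (simp add: algebra_simps)
      moreover have "((1-t)\<^sup>2 + t\<^sup>2) * r\<^sup>2 \<ge> (1/4) * r\<^sup>2"
      proof (rule mult_right_mono)
        have "(1-t)\<^sup>2 + t\<^sup>2 - 1/4 = 2 * (t - 1/2)\<^sup>2 + 1/4" by (simp add: power2_eq_square algebra_simps)
        then show "1/4 \<le> (1-t)\<^sup>2 + t\<^sup>2" by (smt (verit) zero_le_power2)
      qed auto
      ultimately have "(r/2)\<^sup>2 \<le> (norm z)\<^sup>2" by (simp add: power_divide)
      then show ?thesis by (rule power2_le_imp_le) auto
    qed
    have r: "r > 0" "r / 2 \<ge> R" using u R1 by auto
    have "norm (F u - F u') \<le> (C / (r/2) ^ (k+1)) * norm (u - u')"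
    proof (rule differentiable_bound)
      show "(F has_derivative F' z) (at z within closed_segment u u')" if "z \<in> closed_segment u u'" for z
        using F[of z] far[OF that] r has_derivative_at_withinI by fastforce
      show "onorm (F' z) \<le> C / (r/2) ^ (k+1)" if "z \<in> closed_segment u u'" for z
      proof (rule onorm_le)
        fix w
        have nz: "norm z \<ge> r / 2" by (rule far[OF that])
        have "\<bar>F' z w\<bar> \<le> C * norm w / norm z ^ (k+1)" using bound nz r by auto
        also have "\<dots> \<le> C * norm w / (r/2) ^ (k+1)"
          using nz r C0 by (intro divide_left_mono power_mono mult_nonneg_nonneg mult_pos_pos zero_less_power) auto
        finally show "norm (F' z w) \<le> C / (r/2) ^ (k+1) * norm w" by (simp add: mult_ac)
      qed
    qed auto
    also have "\<dots> \<le> (C / (r/2) ^ (k+1)) * (2 * r)"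
      using norm_triangle_ineq4[of u u'] u r C0 by (intro mult_left_mono) auto
    also have "\<dots> = C * 2 ^ (k+2) / r ^ k" using r by (simp add: field_simps)
    finally show ?thesis by simp
  qed
  have sphere: "\<bar>F u - F u'\<bar> \<le> 2 * (C * 2 ^ (k+2) / r ^ k)"
    if u: "norm u = r" "norm u' = r" "r \<ge> 2 * R1" for u u' r
  proof -
    obtain z0 where z0: "z0 \<noteq> 0" "orthogonal u z0"
      using orthogonal_to_vector_exists[OF dim, of u] by blast
    define z1 where "z1 = (r / norm z0) *\<^sub>R z0"
    define z where "z = (if z1 \<bullet> u' \<ge> 0 then z1 else - z1)"
    have r0: "r \<ge> 0" using u R1 by simp
    have "norm z = r" "u \<bullet> z = 0" "z \<bullet> u' \<ge> 0"
      using z0 r0 by (auto simp: z_def z1_def orthogonal_def)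
    then show ?thesis using chord[of u r z] chord[of z r u'] u by auto
  qed
  have radial: "\<bar>F (s *\<^sub>R u) - F u\<bar> \<le> C / r ^ k" if u: "norm u = r" "r \<ge> 2 * R1" and s: "s \<ge> 1" for u r s
  proof (cases "s = 1")
    case True
    then show ?thesis using C0 u R1 by simp
  next
    case False
    have r: "r > 0" "r \<ge> R" using u R1 by auto
    \<comment> \<open>majorant: its derivative \<open>C r\<^sup>-\<^sup>k \<sigma>\<^sup>-\<^sup>2\<close> dominates \<open>C r\<^sup>-\<^sup>k \<sigma>\<^sup>-\<^sup>k\<^sup>-\<^sup>1\<close> since \<open>k \<ge> 1\<close>\<close>
    let ?\<phi> = "\<lambda>\<sigma>. - (C / r ^ k) / \<sigma>"
    have dF: "((\<lambda>\<sigma>. F (\<sigma> *\<^sub>R u)) has_vector_derivative F' (\<sigma> *\<^sub>R u) u) (at \<sigma>)" if "\<sigma> \<ge> 1" for \<sigma>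
    proof -
      have "1 * r \<le> \<sigma> * r" using that r by (intro mult_right_mono) auto
      then have FF: "(F has_derivative F' (\<sigma> *\<^sub>R u)) (at (\<sigma> *\<^sub>R u))"
      proof (intro F)
        have "norm (\<sigma> *\<^sub>R u) = \<sigma> * r" using that u(1) by simp
        then show "R \<le> norm (\<sigma> *\<^sub>R u)" using \<open>1 * r \<le> \<sigma> * r\<close> r by linarith
      qed
      have "((\<lambda>\<sigma>. \<sigma> *\<^sub>R u) has_derivative (\<lambda>h. h *\<^sub>R u)) (at \<sigma>)" by (auto intro!: derivative_eq_intros)
      from has_derivative_compose[OF this FF] show ?thesis
        unfolding has_vector_derivative_def using linear_scale[OF has_derivative_linear[OF FF]] by simp
    qed
    have dphi: "(?\<phi> has_vector_derivative (C / r ^ k) / \<sigma>\<^sup>2) (at \<sigma>)" if "\<sigma> \<ge> 1" for \<sigma>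
      using that r by (auto intro!: derivative_eq_intros simp: has_real_derivative_iff_has_vector_derivative[symmetric] power2_eq_square)
    have "norm (F (s *\<^sub>R u) - F (1 *\<^sub>R u)) \<le> ?\<phi> s - ?\<phi> 1"
    proof (rule differentiable_bound_general[where f = "\<lambda>\<sigma>. F (\<sigma> *\<^sub>R u)" and \<phi> = ?\<phi>
        and f' = "\<lambda>\<sigma>. F' (\<sigma> *\<^sub>R u) u" and \<phi>' = "\<lambda>\<sigma>. (C / r ^ k) / \<sigma>\<^sup>2"])
      show "1 < s" using s False by simp
      show "continuous_on {1..s} (\<lambda>\<sigma>. F (\<sigma> *\<^sub>R u))"
        by (intro continuous_at_imp_continuous_on ballI has_vector_derivative_continuous[OF dF]) auto
      show "continuous_on {1..s} ?\<phi>"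
        by (intro continuous_at_imp_continuous_on ballI has_vector_derivative_continuous[OF dphi]) auto
      show "((\<lambda>\<sigma>. F (\<sigma> *\<^sub>R u)) has_vector_derivative F' (\<sigma> *\<^sub>R u) u) (at \<sigma>)" if "1 < \<sigma>" "\<sigma> < s" for \<sigma>
        using dF that by simp
      show "(?\<phi> has_vector_derivative (C / r ^ k) / \<sigma>\<^sup>2) (at \<sigma>)" if "1 < \<sigma>" "\<sigma> < s" for \<sigma>
        using dphi that by simp
      show "norm (F' (\<sigma> *\<^sub>R u) u) \<le> (C / r ^ k) / \<sigma>\<^sup>2" if sg: "1 < \<sigma>" "\<sigma> < s" for \<sigma>
      proof -
        have "1 * r \<le> \<sigma> * r" using sg r by (intro mult_right_mono) auto
        moreover have "norm (\<sigma> *\<^sub>R u) = \<sigma> * r" using sg u(1) by simp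
        ultimately have "R \<le> norm (\<sigma> *\<^sub>R u)" using r by linarith
        then have "\<bar>F' (\<sigma> *\<^sub>R u) u\<bar> \<le> C * norm u / norm (\<sigma> *\<^sub>R u) ^ (k+1)" by (rule bound)
        also have "\<dots> = (C / r ^ k) / \<sigma> ^ (k+1)" using u r sg by (simp add: power_mult_distrib field_simps)
        also have "\<dots> \<le> (C / r ^ k) / \<sigma>\<^sup>2"
          using sg r C0 k by (intro divide_left_mono power_increasing) auto
        finally show ?thesis by simp
      qed
    qed
    also have "\<dots> \<le> C / r ^ k" using C0 r s by simp
    finally show ?thesis by simp
  qed
  define B where "B = C + 2 * (C * 2 ^ (k+2))"
  have main: "\<bar>F u - F u'\<bar> \<le> B / norm u ^ k" if u: "norm u \<ge> 2 * R1" "norm u' \<ge> norm u" for u u'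
  proof -
    define s where "s = norm u' / norm u"
    define z where "z = (1 / s) *\<^sub>R u'"
    have n: "norm u > 0" "s \<ge> 1" "u' = s *\<^sub>R z" "norm z = norm u" using u R1 by (auto simp: s_def z_def le_divide_eq)
    have "\<bar>F u' - F z\<bar> \<le> C / norm u ^ k" using radial[of z "norm u" s] n u by simp
    moreover have "\<bar>F u - F z\<bar> \<le> 2 * (C * 2 ^ (k+2) / norm u ^ k)" using sphere[of u "norm u" z] n u by simp
    ultimately show ?thesis unfolding B_def by (simp add: add_divide_distrib)
  qed
  define a where "a n = F (real n *\<^sub>R e0)" for n :: nat
  have B0: "B \<ge> 0" using C0 by (simp add: B_def)
  have "Cauchy a"
  proof (rule metric_CauchyI)
    fix \<epsilon> :: real assume "\<epsilon> > 0"
    obtain M :: nat where M: "real M > max (2 * R1) (B / \<epsilon>)" using reals_Archimedean2 by blast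
    have ab: "\<bar>a m - a n\<bar> < \<epsilon>" if "m \<ge> M" "n \<ge> m" for m n
    proof -
      have m: "real m > 2 * R1" "real m > B / \<epsilon>" "real m \<ge> 1" using M that R1 by auto
      have "\<bar>a m - a n\<bar> \<le> B / real m ^ k" using main[of "real m *\<^sub>R e0" "real n *\<^sub>R e0"] e0 m that by (simp add: a_def)
      also have "\<dots> \<le> B / real m ^ 1" using m k B0 by (intro divide_left_mono power_increasing) auto
      also have "\<dots> < \<epsilon>" using m \<open>\<epsilon> > 0\<close> by (simp add: field_simps)
      finally show ?thesis .
    qed
    show "\<exists>M. \<forall>m\<ge>M. \<forall>n\<ge>M. dist (a m) (a n) < \<epsilon>"
    proof (intro exI allI impI)
      fix m n assume "M \<le> m" "M \<le> n"
      then show "dist (a m) (a n) < \<epsilon>" using ab[of m n] ab[of n m] by (cases "m \<le> n") (auto simp: dist_real_def)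
    qed
  qed
  then obtain L where L: "a \<longlonglongrightarrow> L" using Cauchy_convergent convergentD by blast
  have "\<bar>F u - L\<bar> \<le> B / norm u ^ k" if u: "norm u \<ge> 2 * R1" for u
  proof (rule LIMSEQ_le_const2)
    show "(\<lambda>n. \<bar>F u - a n\<bar>) \<longlonglongrightarrow> \<bar>F u - L\<bar>" by (intro tendsto_intros L)
    obtain M :: nat where M: "real M > norm u" using reals_Archimedean2 by blast
    show "\<exists>N. \<forall>n\<ge>N. \<bar>F u - a n\<bar> \<le> B / norm u ^ k"
      using main[OF u] M e0 by (intro exI[of _ M]) (auto simp: a_def)
  qed
  then have "(\<lambda>u. F u - L) \<in> decay k"
    using B0 by (intro bigoI[where c = B]) (auto simp: eventually_at_infinity norm_power intro!: exI[of _ "2 * R1"])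
  then show thesis by (rule that)
qed

lemma limit_of_partials_decay:
  fixes F :: "real^'n::finite \<Rightarrow> real"
  assumes dim: "CARD('n) \<ge> 2" and k: "k \<ge> 1"
    and diff: "\<forall>\<^sub>F u in at_infinity. F differentiable (at u)"
    and partials: "\<And>i. partial i F \<in> decay (k + 1)"
  obtains L where "(\<lambda>u. F u - L) \<in> decay k"
proof -
  have "(\<lambda>u. \<Sum>i\<in>UNIV. \<bar>partial i F u\<bar>) \<in> decay (k + 1)"
    by (intro decay_sum) (use partials in simp)
  then obtain C R where C: "\<And>u. norm u \<ge> R \<Longrightarrow> \<bar>\<Sum>i\<in>UNIV. \<bar>partial i F u\<bar>\<bar> \<le> C / norm u ^ (k + 1)"
    unfolding decay_iff by blast
  obtain R' where R': "\<And>u. norm u \<ge> R' \<Longrightarrow> F differentiable (at u)"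
    using diff by (auto simp: eventually_at_infinity)
  show thesis
  proof (rule limit_at_infinity_of_derivative_decay[where R = "max R R'" and F = F and k = k and C = C
        and F' = "\<lambda>u w. \<Sum>i\<in>UNIV. w $ i * partial i F u"])
    show "2 \<le> DIM(real^'n)" using dim by simp
    fix u w :: "real^'n" assume u: "norm u \<ge> max R R'"
    show "(F has_derivative (\<lambda>w. \<Sum>i\<in>UNIV. w $ i * partial i F u)) (at u)"
      using partial_has_derivative R' u by auto
    have "\<bar>\<Sum>i\<in>UNIV. w $ i * partial i F u\<bar> \<le> (\<Sum>i\<in>UNIV. norm w * \<bar>partial i F u\<bar>)"
      by (intro order_trans[OF sum_abs] sum_mono) (simp add: abs_mult mult_right_mono component_le_norm_cart)
    also have "\<dots> = norm w * \<bar>\<Sum>i\<in>UNIV. \<bar>partial i F u\<bar>\<bar>"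
      by (simp add: sum_distrib_left abs_of_nonneg sum_nonneg)
    also have "\<dots> \<le> norm w * (C / norm u ^ (k + 1))" using C u by (intro mult_left_mono) auto
    finally show "\<bar>\<Sum>i\<in>UNIV. w $ i * partial i F u\<bar> \<le> C * norm w / norm u ^ (k + 1)" by (simp add: mult_ac)
  qed (use k that in auto)
qed

text \<open>Partial derivatives of the Jacobian of \<open>\<phi>\<close> are second partial derivatives of \<open>\<phi>\<close> only on the open
domain, so passing from one to the other needs locality.\<close>
lemma partial_cong_open:
  fixes f :: "real^'n::finite \<Rightarrow> real"
  assumes "open S" "u \<in> S" "\<And>v. v \<in> S \<Longrightarrow> f v = g v" "f differentiable (at u)"
  shows "partial i f u = partial i g u" "g differentiable (at u)"
proof -
  have f: "(f has_derivative frechet_derivative f (at u)) (at u)"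
    using assms(4) frechet_derivative_works by blast
  have g: "(g has_derivative frechet_derivative f (at u)) (at u)"
    by (rule has_derivative_transform_within_open[OF f assms(1,2)]) (rule assms(3))
  show "partial i f u = partial i g u" using partial_eqI[OF g] by (simp add: partial_def)
  show "g differentiable (at u)" using g by (rule differentiableI)
qed

section \<open>The X-ray transform along straight lines\<close>

text \<open>One half of the X-ray argument.  Instead of integrating along the line \<open>r p + s v\<close>, the error term is
absorbed by adding to \<open>G\<close> a multiple of \<open>arctan (s/r)\<close>.  If \<open>T(v,p,p,v)\<close> were positive, the sum would be
increasing along the whole line, with an increase of order \<open>r\<^sup>1\<^sup>-\<^sup>m\<close> on the middle part \<open>|s| \<le> r\<close>;
but its total increase is only of order \<open>r\<^sup>-\<^sup>m\<close>, since \<open>G\<close> vanishes at infinity.\<close>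
lemma line_integral_sign:
  fixes T :: "'n::finite \<Rightarrow> 'n \<Rightarrow> 'n \<Rightarrow> 'n \<Rightarrow> real" and G :: "real^'n \<Rightarrow> real"
  assumes T: "curvature_like T"
    and pv: "norm p = 1" "norm v = 1" "p \<bullet> v = 0"
    and G: "\<And>u. norm u \<ge> R \<Longrightarrow> (G has_derivative G' u) (at u)"
    and m: "m \<ge> 1"
    and asym: "(\<lambda>u. G' u v - form4 T v u u v / norm u ^ (m + 2)) \<in> decay (m + 1)"
    and lim: "(G \<longlongrightarrow> 0) at_infinity"
  shows "form4 T v p p v \<le> 0"
proof (rule ccontr)
  define \<kappa> where "\<kappa> = form4 T v p p v"
  assume "\<not> form4 T v p p v \<le> 0"
  then have \<kappa>: "\<kappa> > 0" by (simp add: \<kappa>_def)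
  obtain C where C: "C > 0" and "\<forall>\<^sub>F u in at_infinity.
      norm (G' u v - form4 T v u u v / norm u ^ (m + 2)) \<le> C * norm (1 / norm u ^ (m + 1))"
    using asym by (elim landau_o.bigE)
  then obtain R1 where R1: "\<And>u. norm u \<ge> R1 \<Longrightarrow>
      \<bar>G' u v - form4 T v u u v / norm u ^ (m + 2)\<bar> \<le> C / norm u ^ (m + 1)"
    by (auto simp: eventually_at_infinity norm_power)
  obtain k where k: "m = Suc k" using m by (cases m) auto
  have bound: "\<kappa> * r \<le> C * pi * 2 ^ (m + 1)" if r: "r \<ge> max 1 (max R R1)" for r
  proof -
    have r0: "r > 0" "r \<ge> R" "r \<ge> R1" using r by auto
    define z where "z s = r *\<^sub>R p + s *\<^sub>R v" for s
    have z2: "(norm (z s))\<^sup>2 = r\<^sup>2 + s\<^sup>2" for s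
    proof -
      have "p \<bullet> p = 1" "v \<bullet> v = 1" using pv(1,2) by (simp_all flip: power2_norm_eq_inner)
      then show ?thesis unfolding power2_norm_eq_inner z_def using pv(3)
        by (simp add: inner_add_left inner_add_right inner_commute[of v p] power2_eq_square)
    qed
    have zr: "norm (z s) \<ge> r" for s
      by (rule power2_le_imp_le) (simp_all add: z2)
    \<comment> \<open>the derivative of the second summand is at least the error \<open>C / |z s|\<^sup>m\<^sup>+\<^sup>1\<close>, as \<open>|z s| \<ge> r\<close>\<close>
    define H where "H s = G (z s) + (C / r ^ m) * arctan (s / r)" for s
    define H' where "H' s = G' (z s) v + C * r / (r ^ m * (norm (z s))\<^sup>2)" for s
    have H': "(H has_real_derivative H' s) (at s)" for s
    proof -
      have "(z has_derivative (\<lambda>h. h *\<^sub>R v)) (at s)"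
        unfolding z_def by (auto intro!: derivative_eq_intros)
      from has_derivative_compose[OF this G] have "((\<lambda>s. G (z s)) has_derivative (\<lambda>h. G' (z s) (h *\<^sub>R v))) (at s)"
        using zr[of s] r0 by auto
      moreover have "(\<lambda>h. G' (z s) (h *\<^sub>R v)) = (*) (G' (z s) v)"
        using linear_scale[OF has_derivative_linear[OF G]] zr[of s] r0 by (intro ext) (simp add: mult.commute)
      ultimately have 1: "((\<lambda>s. G (z s)) has_real_derivative G' (z s) v) (at s)"
        by (simp add: has_field_derivative_def)
      have "((\<lambda>s. (C / r ^ m) * arctan (s / r)) has_real_derivative (C / r ^ m) * (inverse (1 + (s / r)\<^sup>2) * (1 / r))) (at s)"
        using r0 by (auto intro!: derivative_eq_intros simp: mult_ac)
      moreover have e: "inverse (1 + (s / r)\<^sup>2) * (1 / r) = r / (norm (z s))\<^sup>2"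
        unfolding z2 using r0 by (simp add: field_simps power2_eq_square add_nonneg_eq_0_iff)
      ultimately have 2: "((\<lambda>s. (C / r ^ m) * arctan (s / r)) has_real_derivative C * r / (r ^ m * (norm (z s))\<^sup>2)) (at s)"
        unfolding e by simp
      show ?thesis unfolding H_def H'_def by (rule DERIV_add[OF 1 2])
    qed
    have lower: "H' s \<ge> \<kappa> * r\<^sup>2 / norm (z s) ^ (m + 2)" for s
    proof -
      have n: "norm (z s) > 0" using zr[of s] r0 by linarith
      have f: "form4 T v (z s) (z s) v = \<kappa> * r\<^sup>2"
        unfolding z_def \<kappa>_def form4_sectional_shear[OF T] by simp
      have "C / norm (z s) ^ (m + 1) = C / (norm (z s) ^ k * (norm (z s))\<^sup>2)"
        by (simp add: k power_add[symmetric] power2_eq_square)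
      also have "\<dots> \<le> C / (r ^ k * (norm (z s))\<^sup>2)"
        using n r0 zr[of s] C by (intro divide_left_mono mult_right_mono power_mono mult_pos_pos) auto
      also have "\<dots> = C * r / (r ^ m * (norm (z s))\<^sup>2)" using r0 by (simp add: k)
      finally show ?thesis using R1[of "z s"] zr[of s] r0 unfolding f H'_def by (smt (verit))
    qed
    have nonneg: "H' s \<ge> 0" for s
      using order_trans[OF _ lower[of s], of 0] \<kappa> by simp
    \<comment> \<open>lower bound of \<open>H'\<close> on the middle part of the line, where \<open>|z s| \<le> 2 r\<close>\<close>
    define c where "c = \<kappa> * r\<^sup>2 / (2 * r) ^ (m + 2)"
    have inner: "H r - H (- r) \<ge> 2 * r * c"
    proof -
      have "(\<lambda>s. H s - c * s) (- r) \<le> (\<lambda>s. H s - c * s) r"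
      proof (rule DERIV_nonneg_imp_nondecreasing[where f = "\<lambda>s. H s - c * s"])
        fix s assume s: "- r \<le> s" "s \<le> r"
        have "norm (z s) \<le> norm (r *\<^sub>R p) + norm (s *\<^sub>R v)" unfolding z_def by (rule norm_triangle_ineq)
        then have "norm (z s) \<le> 2 * r" using s pv r0 by simp
        then have "c \<le> \<kappa> * r\<^sup>2 / norm (z s) ^ (m + 2)"
          unfolding c_def using zr[of s] r0 \<kappa> by (intro divide_left_mono power_mono mult_pos_pos zero_less_power) auto
        then have "H' s - c \<ge> 0" using lower[of s] by linarith
        moreover have "((\<lambda>s. H s - c * s) has_real_derivative H' s - c) (at s)"
          by (auto intro!: derivative_eq_intros H')
        ultimately show "\<exists>y. ((\<lambda>s. H s - c * s) has_real_derivative y) (at s) \<and> y \<ge> 0" by blast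
      qed (use r0 in simp)
      then show ?thesis by (simp add: algebra_simps)
    qed
    have outer: "2 * r * c \<le> G (z S) - G (z (- S)) + C * pi / r ^ m" if S: "S \<ge> r" for S
    proof -
      have "H r \<le> H S" "H (- S) \<le> H (- r)"
        using S by (auto intro!: DERIV_nonneg_imp_nondecreasing[of _ _ H] H' nonneg exI)
      then have "2 * r * c \<le> H S - H (- S)" using inner by linarith
      also have "\<dots> = G (z S) - G (z (- S)) + (C / r ^ m) * (2 * arctan (S / r))"
        by (simp add: H_def arctan_minus algebra_simps)
      also have "(C / r ^ m) * (2 * arctan (S / r)) \<le> (C / r ^ m) * pi"
        using arctan_ubound[of "S / r"] C r0 by (intro mult_left_mono) auto
      finally show ?thesis by simp
    qed
    have zinf: "filterlim (\<lambda>S. z (t * S)) at_infinity at_top" if "\<bar>t\<bar> = 1" for t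
    proof -
      have "S \<le> norm (z (t * S))" for S
      proof (rule power2_le_imp_le)
        have "(t * S)\<^sup>2 = S\<^sup>2" using that by (metis power2_abs abs_mult mult_1)
        then show "S\<^sup>2 \<le> (norm (z (t * S)))\<^sup>2" by (simp add: z2)
      qed simp
      then show ?thesis
        by (intro filterlim_norm_at_top_imp_at_infinity filterlim_at_top_mono[OF filterlim_ident]) simp
    qed
    have "((\<lambda>S. G (z S) - G (z (- S)) + C * pi / r ^ m) \<longlongrightarrow> 0 - 0 + C * pi / r ^ m) at_top"
      using filterlim_compose[OF lim zinf[of 1]] filterlim_compose[OF lim zinf[of "-1"]]
      by (intro tendsto_intros) auto
    then have "2 * r * c \<le> 0 - 0 + C * pi / r ^ m"
      by (rule tendsto_lowerbound)
        (use outer in \<open>auto simp: eventually_at_top_linorder\<close>)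
    then show ?thesis using r0 by (simp add: c_def field_simps power_mult_distrib power2_eq_square)
  qed
  define r where "r = max (max 1 (max R R1)) ((C * pi * 2 ^ (m + 1)) / \<kappa> + 1)"
  have "(C * pi * 2 ^ (m + 1)) / \<kappa> + 1 \<le> r" "r \<ge> max 1 (max R R1)" by (simp_all add: r_def)
  then show False using bound[of r] \<kappa> by (simp add: field_simps)
qed

text \<open>Both signs are covered by passing to the negatives of \<open>G\<close> and \<open>T\<close>.\<close>
lemma line_integral_zero:
  fixes T :: "'n::finite \<Rightarrow> 'n \<Rightarrow> 'n \<Rightarrow> 'n \<Rightarrow> real" and G :: "real^'n \<Rightarrow> real"
  assumes T: "curvature_like T"
    and pv: "norm p = 1" "norm v = 1" "p \<bullet> v = 0"
    and G: "\<And>u. norm u \<ge> R \<Longrightarrow> (G has_derivative G' u) (at u)"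
    and m: "m \<ge> 1"
    and asym: "(\<lambda>u. G' u v - form4 T v u u v / norm u ^ (m + 2)) \<in> decay (m + 1)"
    and lim: "(G \<longlongrightarrow> 0) at_infinity"
  shows "form4 T v p p v = 0"
proof -
  have neg: "form4 (\<lambda>i j k l. 0 - T i j k l) a b c d = - form4 T a b c d" for a b c d
    by (simp add: form4_def sum_negf)
  have "form4 (\<lambda>i j k l. 0 - T i j k l) v p p v \<le> 0"
  proof (rule line_integral_sign[OF _ pv _ m])
    show "curvature_like (\<lambda>i j k l. 0 - T i j k l)"
      by (rule curvature_like_diff[OF _ T]) (simp add: curvature_like_def)
    show "((\<lambda>u. - G u) has_derivative (\<lambda>w. - G' u w)) (at u)" if "norm u \<ge> R" for u
      by (intro has_derivative_minus G that)
    show "((\<lambda>u. - G u) \<longlongrightarrow> 0) at_infinity" using tendsto_minus[OF lim] by simp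
    have "(\<lambda>u. - G' u v - form4 (\<lambda>i j k l. 0 - T i j k l) v u u v / norm u ^ (m + 2)) =
       (\<lambda>u. - (G' u v - form4 T v u u v / norm u ^ (m + 2)))"
      unfolding neg by (simp add: fun_eq_iff)
    then show "(\<lambda>u. - G' u v - form4 (\<lambda>i j k l. 0 - T i j k l) v u u v / norm u ^ (m + 2)) \<in> decay (m + 1)"
      using asym by (simp only: landau_o.big.uminus_in_iff)
  qed
  then have "- form4 T v p p v \<le> 0" unfolding neg .
  moreover have "form4 T v p p v \<le> 0"
    by (rule line_integral_sign[OF T pv G m asym lim])
  ultimately show ?thesis by linarith
qed

section \<open>The leading term of the metric\<close>

text \<open>The homogeneous leading term, of degree minus the dimension, of the metric coefficients.\<close>
definition weyl_field :: "('n::finite \<Rightarrow> 'n \<Rightarrow> 'n \<Rightarrow> 'n \<Rightarrow> real) \<Rightarrow> 'n \<Rightarrow> 'n \<Rightarrow> real^'n \<Rightarrow> real" where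
  "weyl_field W i j u = (\<Sum>a\<in>UNIV. \<Sum>b\<in>UNIV. W i a b j * (u $ a * u $ b) / norm u ^ (CARD('n) + 2))"

lemma weyl_field_form4:
  fixes W :: "'n::finite \<Rightarrow> 'n \<Rightarrow> 'n \<Rightarrow> 'n \<Rightarrow> real"
  shows "(\<Sum>i\<in>UNIV. \<Sum>j\<in>UNIV. v$i * v$j * weyl_field W i j u) = form4 W v u u v / norm u ^ (CARD('n) + 2)"
proof -
  have "(\<Sum>j\<in>UNIV. v$i * v$j * weyl_field W i j u) =
      (\<Sum>a\<in>UNIV. \<Sum>b\<in>UNIV. \<Sum>j\<in>UNIV. W i a b j * v$i * u$a * u$b * v$j / norm u ^ (CARD('n) + 2))" for i
    unfolding weyl_field_def sum_distrib_left
    by (subst sum.swap, rule sum.cong[OF refl], subst sum.swap) (simp add: mult_ac)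
  then show ?thesis by (simp add: form4_def sum_divide_distrib)
qed

lemma abs_quotient_le: "\<bar>x\<bar> \<le> y \<Longrightarrow> 0 < N \<Longrightarrow> \<bar>x / N\<bar> \<le> y / N" for x y N :: real
  by (simp add: abs_divide divide_right_mono)

lemma quadratic_fraction_derivative:
  fixes u :: "real^'n::finite"
  assumes "u \<noteq> 0"
  obtains D where "((\<lambda>u. u $ a * u $ b / norm u ^ (k + 2)) has_derivative D) (at u)"
    "\<And>w. \<bar>D w\<bar> \<le> (real k + 4) * norm w / norm u ^ (k + 1)"
proof -
  define n where "n = norm u"
  have n: "n > 0" using assms by (simp add: n_def)
  let ?D = "\<lambda>w. ((u $ a * w $ b + w $ a * u $ b) * n ^ (k + 2) - u $ a * u $ b * (real (k + 2) * n ^ (k + 1) * (w \<bullet> sgn u))) / (n ^ (k + 2) * n ^ (k + 2))"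
  have c: "((\<lambda>u. u $ i) has_derivative (\<lambda>w. w $ i)) (at u)" for i
    by (rule bounded_linear.has_derivative[OF bounded_linear_vec_nth has_derivative_ident])
  have "((\<lambda>u. norm u ^ (k + 2)) has_derivative (\<lambda>w. real (k + 2) * n ^ (k + 1) * (w \<bullet> sgn u))) (at u)"
    using has_derivative_power[OF has_derivative_norm[OF assms], of "k + 2"] by (simp add: n_def mult_ac)
  from has_derivative_divide'[OF has_derivative_mult[OF c[of a] c[of b]] this]
  have D: "((\<lambda>u. u $ a * u $ b / norm u ^ (k + 2)) has_derivative ?D) (at u)"
    using n unfolding n_def[symmetric] by simp
  have "\<bar>?D w\<bar> \<le> (real k + 4) * norm w / norm u ^ (k + 1)" for w
  proof -
    have comp: "\<bar>u $ i\<bar> \<le> n" "\<bar>w $ i\<bar> \<le> norm w" for i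
      by (simp_all add: n_def component_le_norm_cart)
    have "\<bar>u $ a * w $ b + w $ a * u $ b\<bar> \<le> \<bar>u $ a * w $ b\<bar> + \<bar>w $ a * u $ b\<bar>" by (rule abs_triangle_ineq)
    also have "\<dots> \<le> n * norm w + norm w * n"
      unfolding abs_mult by (intro add_mono mult_mono comp) (use n in auto)
    finally have "\<bar>(u $ a * w $ b + w $ a * u $ b) / n ^ (k + 2)\<bar> \<le> (2 * n * norm w) / n ^ (k + 2)"
      using n by (intro abs_quotient_le) (simp_all add: mult_ac)
    also have "\<dots> = 2 * norm w / n ^ (k + 1)" using n by (simp add: field_simps)
    finally have 1: "\<bar>(u $ a * w $ b + w $ a * u $ b) / n ^ (k + 2)\<bar> \<le> 2 * norm w / n ^ (k + 1)" .
    have "\<bar>w \<bullet> sgn u\<bar> \<le> norm w * norm (sgn u)" by (rule Cauchy_Schwarz_ineq2)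
    then have s: "\<bar>w \<bullet> sgn u\<bar> \<le> norm w" using assms by (simp add: norm_sgn)
    have "\<bar>u $ a * u $ b * (real (k + 2) * n ^ (k + 1) * (w \<bullet> sgn u))\<bar> \<le> n * n * (real (k + 2) * n ^ (k + 1) * norm w)"
      unfolding abs_mult by (intro mult_mono comp s) (use n in auto)
    then have "\<bar>u $ a * u $ b * (real (k + 2) * n ^ (k + 1) * (w \<bullet> sgn u)) / (n ^ (k + 2) * n ^ (k + 2))\<bar>
       \<le> n * n * (real (k + 2) * n ^ (k + 1) * norm w) / (n ^ (k + 2) * n ^ (k + 2))"
      by (rule abs_quotient_le) (use n in simp)
    also have "\<dots> = real (k + 2) * norm w / n ^ (k + 1)" using n by (simp add: divide_simps)
    finally have 2: "\<bar>u $ a * u $ b * (real (k + 2) * n ^ (k + 1) * (w \<bullet> sgn u)) / (n ^ (k + 2) * n ^ (k + 2))\<bar>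
       \<le> real (k + 2) * norm w / n ^ (k + 1)" .
    have "\<bar>?D w\<bar> \<le> 2 * norm w / n ^ (k + 1) + real (k + 2) * norm w / n ^ (k + 1)"
    proof -
      have "?D w = (u $ a * w $ b + w $ a * u $ b) / n ^ (k + 2)
          - u $ a * u $ b * (real (k + 2) * n ^ (k + 1) * (w \<bullet> sgn u)) / (n ^ (k + 2) * n ^ (k + 2))"
        using n by (simp only: diff_divide_distrib) simp
      then show ?thesis by (simp only:) (rule order_trans[OF abs_triangle_ineq4 add_mono[OF 1 2]])
    qed
    also have "\<dots> = (real k + 4) * norm w / norm u ^ (k + 1)"
      by (simp add: n_def add_divide_distrib[symmetric] algebra_simps)
    finally show ?thesis .
  qed
  then show thesis using that D by blast
qed

lemma weyl_field_derivative:
  fixes W :: "'n::finite \<Rightarrow> 'n \<Rightarrow> 'n \<Rightarrow> 'n \<Rightarrow> real"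
  obtains C where "C \<ge> 0"
    "\<And>i j u. u \<noteq> 0 \<Longrightarrow> \<exists>D. (weyl_field W i j has_derivative D) (at u) \<and> (\<forall>w. \<bar>D w\<bar> \<le> C * norm w / norm u ^ (CARD('n) + 1))"
proof -
  let ?m = "CARD('n)"
  define c where "c i j = (\<Sum>a\<in>UNIV. \<Sum>b\<in>UNIV. \<bar>W i a b j\<bar> * (real ?m + 4))" for i j
  define C where "C = (\<Sum>i\<in>UNIV. \<Sum>j\<in>UNIV. c i j)"
  have c0: "c i j \<ge> 0" for i j by (simp add: c_def sum_nonneg)
  have cC: "c i j \<le> C" for i j
  proof -
    have "c i j \<le> (\<Sum>j\<in>UNIV. c i j)" by (rule member_le_sum) (auto simp: c0)
    also have "\<dots> \<le> C" unfolding C_def by (rule member_le_sum) (auto simp: c0 sum_nonneg)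
    finally show ?thesis .
  qed
  have "\<exists>D. (weyl_field W i j has_derivative D) (at u) \<and> (\<forall>w. \<bar>D w\<bar> \<le> C * norm w / norm u ^ (?m + 1))"
    if u: "u \<noteq> 0" for i j and u :: "real^'n"
  proof -
    let ?P = "\<lambda>a b D. ((\<lambda>u. u $ a * u $ b / norm u ^ (?m + 2)) has_derivative D) (at u) \<and>
      (\<forall>w. \<bar>D w\<bar> \<le> (real ?m + 4) * norm w / norm u ^ (?m + 1))"
    have ex: "\<exists>D. ?P a b D" for a b
      by (rule quadratic_fraction_derivative[OF u, of a b ?m]) blast
    define D where "D a b = (SOME D. ?P a b D)" for a b
    have "?P a b (D a b)" for a b unfolding D_def by (rule someI_ex[OF ex])
    then have D: "((\<lambda>u. u $ a * u $ b / norm u ^ (?m + 2)) has_derivative D a b) (at u)"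
      "\<bar>D a b w\<bar> \<le> (real ?m + 4) * norm w / norm u ^ (?m + 1)" for a b w by blast+
    let ?E = "\<lambda>w. \<Sum>a\<in>UNIV. \<Sum>b\<in>UNIV. W i a b j * D a b w"
    have "((\<lambda>u. \<Sum>a\<in>UNIV. \<Sum>b\<in>UNIV. W i a b j * (u $ a * u $ b / norm u ^ (?m + 2))) has_derivative ?E) (at u)"
      by (intro has_derivative_sum has_derivative_mult_right D)
    then have "(weyl_field W i j has_derivative ?E) (at u)"
      by (simp add: weyl_field_def[abs_def])
    moreover have "\<bar>?E w\<bar> \<le> C * norm w / norm u ^ (?m + 1)" for w
    proof -
      define q where "q = norm w / norm u ^ (?m + 1)"
      have "\<bar>?E w\<bar> \<le> (\<Sum>a\<in>UNIV. \<Sum>b\<in>UNIV. \<bar>W i a b j * D a b w\<bar>)"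
        by (intro order_trans[OF sum_abs] sum_mono sum_abs)
      also have "\<dots> \<le> (\<Sum>a\<in>UNIV. \<Sum>b\<in>UNIV. \<bar>W i a b j\<bar> * ((real ?m + 4) * q))"
        using D(2)[of _ _ w] unfolding abs_mult q_def by (intro sum_mono mult_left_mono) auto
      also have "\<dots> = c i j * q"
        by (simp only: c_def sum_distrib_right mult.assoc)
      also have "\<dots> \<le> C * q" by (intro mult_right_mono cC) (simp add: q_def)
      finally show ?thesis by (simp add: q_def)
    qed
    ultimately show ?thesis by blast
  qed
  moreover have "C \<ge> 0" unfolding C_def by (simp add: c0 sum_nonneg)
  ultimately show thesis using that by blast
qed

lemma weyl_field_bounded:
  fixes W :: "'n::finite \<Rightarrow> 'n \<Rightarrow> 'n \<Rightarrow> 'n \<Rightarrow> real"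
  obtains C where "C \<ge> 0" "\<And>i j u. \<bar>weyl_field W i j u\<bar> \<le> C / norm u ^ CARD('n)"
proof -
  let ?m = "CARD('n)"
  define c where "c i j = (\<Sum>a\<in>UNIV. \<Sum>b\<in>UNIV. \<bar>W i a b j\<bar>)" for i j
  define C where "C = (\<Sum>i\<in>UNIV. \<Sum>j\<in>UNIV. c i j)"
  have c0: "c i j \<ge> 0" for i j by (simp add: c_def sum_nonneg)
  have cC: "c i j \<le> C" for i j
  proof -
    have "c i j \<le> (\<Sum>j\<in>UNIV. c i j)" by (rule member_le_sum) (auto simp: c0)
    also have "\<dots> \<le> C" unfolding C_def by (rule member_le_sum) (auto simp: c0 sum_nonneg)
    finally show ?thesis .
  qed
  have "\<bar>weyl_field W i j u\<bar> \<le> C / norm u ^ ?m" for i j u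
  proof -
    have f: "\<bar>u $ a * u $ b / norm u ^ (?m + 2)\<bar> \<le> 1 / norm u ^ ?m" for a b
    proof (cases "u = 0")
      case False
      have "\<bar>u $ a * u $ b\<bar> \<le> norm u * norm u"
        unfolding abs_mult by (intro mult_mono component_le_norm_cart) auto
      then show ?thesis using False by (simp add: abs_divide field_simps)
    qed simp
    have "\<bar>weyl_field W i j u\<bar> \<le> (\<Sum>a\<in>UNIV. \<Sum>b\<in>UNIV. \<bar>W i a b j * (u $ a * u $ b / norm u ^ (?m + 2))\<bar>)"
      unfolding weyl_field_def times_divide_eq_right by (intro order_trans[OF sum_abs] sum_mono sum_abs)
    also have "\<dots> \<le> (\<Sum>a\<in>UNIV. \<Sum>b\<in>UNIV. \<bar>W i a b j\<bar> * (1 / norm u ^ ?m))"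
      unfolding abs_mult[of "W _ _ _ _"] by (intro sum_mono mult_left_mono f) auto
    also have "\<dots> = c i j * (1 / norm u ^ ?m)" by (simp add: c_def sum_distrib_right sum_divide_distrib)
    also have "\<dots> \<le> C * (1 / norm u ^ ?m)" by (intro mult_right_mono cC) auto
    finally show ?thesis by simp
  qed
  moreover have "C \<ge> 0" unfolding C_def by (simp add: c0 sum_nonneg)
  ultimately show thesis using that by blast
qed

lemma iter_partial_le_deriv_norm:
  fixes f :: "real^'n::finite \<Rightarrow> real"
  shows "\<bar>iter_partial is f u\<bar> \<le> deriv_norm (length is) f u"
proof -
  have fin: "finite {js :: 'n list. length js = length is}"
    using finite_lists_length_eq[of "UNIV :: 'n set"] by simp
  have "(iter_partial is f u)\<^sup>2 \<le> (\<Sum>js | length js = length is. (iter_partial js f u)\<^sup>2)"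
    by (rule member_le_sum) (use fin in auto)
  then show ?thesis unfolding deriv_norm_def by (simp add: real_le_rsqrt abs_le_square_iff real_sqrt_le_mono flip: real_sqrt_abs)
qed

text \<open>What is used of the expansion: at most one derivative, with one constant for all components and
uniformly on the whole domain, also near its inner boundary.\<close>
lemma weyl_expansion_estimates:
  fixes U :: "(real^'n::finite) set"
  assumes U: "exterior_domain U" and h: "has_weyl_expansion U h W"
  obtains B where "B > 0"
    "\<And>u i j. u \<in> U \<Longrightarrow> (\<lambda>v. h v $ i $ j) differentiable (at u)"
    "\<And>u i j k. u \<in> U \<Longrightarrow> \<bar>partial k (\<lambda>v. h v $ i $ j) u\<bar> \<le> B / norm u ^ (CARD('n) + 1)"
    "\<And>u i j. u \<in> U \<Longrightarrow> \<bar>h u $ i $ j - (if i = j then 1 else 0)\<bar> \<le> B / norm u ^ CARD('n)"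
    "\<And>u i j. u \<in> U \<Longrightarrow> \<bar>h u $ i $ j - (if i = j then 1 else 0) - weyl_field W i j u\<bar> \<le> B / norm u ^ (CARD('n) + 1)"
proof -
  let ?m = "CARD('n)"
  obtain R where R: "R > 0" "\<And>u. u \<in> U \<Longrightarrow> norm u > R" using U by (auto simp: exterior_domain_def)
  define e where "e i j u = h u $ i $ j - (if i = j then 1 else 0) - weyl_field W i j u" for i j u
  have e: "e i j \<in> bigo_all_derivs U (real (?m + 1))" for i j
    using h unfolding has_weyl_expansion_def e_def[abs_def] weyl_field_def by blast
  then have "\<exists>C. \<forall>k. \<forall>x\<in>U. deriv_norm k (e i j) x \<le> C k * norm x powr (- real (?m + 1) - real k)" for i j
    unfolding bigo_all_derivs_def by blast
  then obtain C where C: "\<And>i j k x. x \<in> U \<Longrightarrow> deriv_norm k (e i j) x \<le> C i j k * norm x powr (- real (?m + 1) - real k)"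
    by metis
  have pw: "norm x powr (- real (?m + 1) - real k) = 1 / norm x ^ (?m + 1 + k)" if "x \<in> U" for x :: "real^'n" and k
  proof -
    have "norm x > 0" using R(1) R(2)[OF that] by linarith
    moreover have "- real (?m + 1) - real k = - real (?m + 1 + k)" by simp
    ultimately show ?thesis by (simp only: powr_minus_divide powr_realpow)
  qed
  obtain Cw where Cw: "Cw \<ge> 0" "\<And>i j u. u \<noteq> 0 \<Longrightarrow> \<exists>D. (weyl_field W i j has_derivative D) (at u) \<and> (\<forall>w. \<bar>D w\<bar> \<le> Cw * norm w / norm u ^ (?m + 1))"
    using weyl_field_derivative[of W] by metis
  obtain Cb where Cb: "Cb \<ge> 0" "\<And>i j u. \<bar>weyl_field W i j u\<bar> \<le> Cb / norm u ^ ?m"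
    using weyl_field_bounded[of W] by metis
  define M where "M = (\<Sum>i\<in>UNIV. \<Sum>j\<in>UNIV. \<bar>C i j 0\<bar> + \<bar>C i j 1\<bar>)"
  have M: "\<bar>C i j 0\<bar> \<le> M" "\<bar>C i j 1\<bar> \<le> M" for i j
  proof -
    have "\<bar>C i j 0\<bar> + \<bar>C i j 1\<bar> \<le> (\<Sum>j\<in>UNIV. \<bar>C i j 0\<bar> + \<bar>C i j 1\<bar>)" by (rule member_le_sum) auto
    also have "\<dots> \<le> M" unfolding M_def by (rule member_le_sum) (auto intro: sum_nonneg)
    finally show "\<bar>C i j 0\<bar> \<le> M" "\<bar>C i j 1\<bar> \<le> M" by auto
  qed
  have M0: "M \<ge> 0" using M(1) abs_ge_zero order_trans by blast
  define B where "B = M + M / R + Cw + Cb + 1"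
  have Bge: "M \<le> B" "M / R + Cw \<le> B" "M / R + Cb \<le> B" and B0: "B > 0"
    using M0 R Cw(1) Cb(1) by (auto simp: B_def add_nonneg_pos)
  have e0: "\<bar>e i j u\<bar> \<le> M / norm u ^ (?m + 1)" if u: "u \<in> U" for i j u
  proof -
    have "\<bar>e i j u\<bar> \<le> C i j 0 / norm u ^ (?m + 1)"
      using iter_partial_le_deriv_norm[of "[]" "e i j" u] C[OF u, of 0 i j] pw[OF u, of 0] by simp
    also have "\<dots> \<le> M / norm u ^ (?m + 1)" using M(1)[of i j] by (intro divide_right_mono) auto
    finally show ?thesis .
  qed
  have e1: "\<bar>partial k (e i j) u\<bar> \<le> (M / R) / norm u ^ (?m + 1)" if u: "u \<in> U" for i j k u
  proof -
    have n: "norm u > R" "norm u > 0" using R(1) R(2)[OF u] by auto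
    have "\<bar>partial k (e i j) u\<bar> \<le> C i j 1 / norm u ^ (?m + 2)"
      using iter_partial_le_deriv_norm[of "[k]" "e i j" u] C[OF u, of 1 i j] pw[OF u, of 1] by simp
    also have "\<dots> \<le> M / norm u ^ (?m + 2)" using M(2)[of i j] by (intro divide_right_mono) auto
    also have "\<dots> = (M / norm u) / norm u ^ (?m + 1)" by (simp add: mult_ac)
    also have "\<dots> \<le> (M / R) / norm u ^ (?m + 1)"
      using M0 R n by (intro divide_right_mono divide_left_mono mult_pos_pos) auto
    finally show ?thesis .
  qed
  have hd: "(\<lambda>v. h v $ i $ j) differentiable (at u) \<and> \<bar>partial k (\<lambda>v. h v $ i $ j) u\<bar> \<le> B / norm u ^ (?m + 1)" if u: "u \<in> U" for i j k u
  proof -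
    have u0: "u \<noteq> 0" using R(1) R(2)[OF u] by auto
    obtain D where D: "(weyl_field W i j has_derivative D) (at u)" "\<And>w. \<bar>D w\<bar> \<le> Cw * norm w / norm u ^ (?m + 1)"
      using Cw(2)[OF u0] by blast
    have "e i j differentiable (at u)"
      using e[of i j] u unfolding bigo_all_derivs_def smooth_real_on_def by (metis (mono_tags, lifting) iter_partial.simps(1) mem_Collect_eq)
    then have ed: "(e i j has_derivative frechet_derivative (e i j) (at u)) (at u)" using frechet_derivative_works by blast
    have "((\<lambda>v. (if i = j then 1 else 0) + (weyl_field W i j v + e i j v)) has_derivative (\<lambda>w. 0 + (D w + frechet_derivative (e i j) (at u) w))) (at u)"
      by (intro has_derivative_add has_derivative_const D ed)
    then have hd: "((\<lambda>v. h v $ i $ j) has_derivative (\<lambda>w. D w + frechet_derivative (e i j) (at u) w)) (at u)"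
      by (simp add: e_def[abs_def])
    have "\<bar>partial k (\<lambda>v. h v $ i $ j) u\<bar> = \<bar>D (axis k 1) + partial k (e i j) u\<bar>"
      using partial_eqI[OF hd, of k] by (simp add: partial_def[of k "e i j"])
    also have "\<dots> \<le> Cw / norm u ^ (?m + 1) + (M / R) / norm u ^ (?m + 1)"
      using D(2)[of "axis k 1"] e1[OF u, of k i j] by simp
    also have "\<dots> = (M / R + Cw) / norm u ^ (?m + 1)" by (simp add: add_divide_distrib)
    also have "\<dots> \<le> B / norm u ^ (?m + 1)" by (intro divide_right_mono Bge) auto
    finally show ?thesis using hd differentiableI by blast
  qed
  show thesis
  proof (rule that[OF B0])
    fix u i j k assume u: "u \<in> U"
    have n: "norm u > R" "norm u > 0" using R(1) R(2)[OF u] by auto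
    show "(\<lambda>v. h v $ i $ j) differentiable (at u)" "\<bar>partial k (\<lambda>v. h v $ i $ j) u\<bar> \<le> B / norm u ^ (?m + 1)"
      using hd[OF u] by blast+
    have "\<bar>e i j u\<bar> \<le> B / norm u ^ (?m + 1)"
      using e0[OF u, of i j] Bge(1) by (meson divide_right_mono norm_ge_zero order_trans zero_le_power)
    then show "\<bar>h u $ i $ j - (if i = j then 1 else 0) - weyl_field W i j u\<bar> \<le> B / norm u ^ (?m + 1)"
      by (simp add: e_def)
    have "\<bar>h u $ i $ j - (if i = j then 1 else 0)\<bar> \<le> \<bar>e i j u\<bar> + \<bar>weyl_field W i j u\<bar>" by (simp add: e_def)
    also have "\<dots> \<le> (M / norm u) / norm u ^ ?m + Cb / norm u ^ ?m"
      using e0[OF u, of i j] Cb(2)[of i j u] by simp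
    also have "\<dots> \<le> (M / R) / norm u ^ ?m + Cb / norm u ^ ?m"
      using M0 R n by (intro add_right_mono divide_right_mono divide_left_mono mult_pos_pos) auto
    also have "\<dots> = (M / R + Cb) / norm u ^ ?m" by (simp add: add_divide_distrib)
    also have "\<dots> \<le> B / norm u ^ ?m" by (intro divide_right_mono Bge) auto
    finally show "\<bar>h u $ i $ j - (if i = j then 1 else 0)\<bar> \<le> B / norm u ^ ?m" .
  qed
qed

text \<open>Since the gradient of the leading term is of one order better than the term itself, a bounded
displacement of its argument is absorbed by the error.\<close>
lemma weyl_field_shift:
  fixes W :: "'n::finite \<Rightarrow> 'n \<Rightarrow> 'n \<Rightarrow> 'n \<Rightarrow> real" and f g :: "real^'n \<Rightarrow> real^'n"
  assumes g: "\<And>u. norm (g u) = norm u"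
    and fg: "\<And>a. (\<lambda>u. f u $ a - g u $ a) \<in> decay 0"
  shows "(\<lambda>u. weyl_field W i j (f u) - weyl_field W i j (g u)) \<in> decay (CARD('n) + 1)"
proof -
  obtain C where C: "C \<ge> 0" "\<And>i j u. u \<noteq> 0 \<Longrightarrow> \<exists>D. (weyl_field W i j has_derivative D) (at u) \<and>
      (\<forall>w. \<bar>D w\<bar> \<le> C * norm w / norm u ^ (CARD('n) + 1))"
    using weyl_field_derivative[of W] by blast
  have "(\<lambda>u. \<Sum>a\<in>UNIV. \<bar>f u $ a - g u $ a\<bar>) \<in> decay 0"
    by (intro decay_sum) (use fg in simp)
  then obtain B R where "\<forall>u. norm u \<ge> R \<longrightarrow> \<bar>\<Sum>a\<in>UNIV. \<bar>f u $ a - g u $ a\<bar>\<bar> \<le> B / norm u ^ 0"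
    unfolding decay_iff by blast
  then have sB: "(\<Sum>a\<in>UNIV. \<bar>f u $ a - g u $ a\<bar>) \<le> B" if "norm u \<ge> R" for u
    using that abs_ge_self order_trans by fastforce
  have B: "norm (f u - g u) \<le> B" if "norm u \<ge> R" for u
    using norm_le_l1_cart[of "f u - g u"] sB[OF that] by simp
  show ?thesis unfolding decay_iff
  proof (intro exI allI impI)
    fix u :: "real^'n" assume u: "norm u \<ge> max R (2 * \<bar>B\<bar> + 1)"
    define \<rho> where "\<rho> = norm u / 2"
    have "norm u \<ge> 2 * \<bar>B\<bar> + 1" using u by simp
    then have \<rho>: "\<rho> > 0" unfolding \<rho>_def using abs_ge_zero[of B] by linarith
    have d: "norm (f u - g u) \<le> \<bar>B\<bar>" using B[of u] u by auto
    have far: "norm y \<ge> \<rho>" if y: "y \<in> closed_segment (g u) (f u)" for y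
    proof -
      have "norm (y - g u) \<le> norm (f u - g u)" using segment_bound(1)[OF y] by (simp add: norm_minus_commute)
      then have "norm u - norm y \<le> \<bar>B\<bar>" using norm_triangle_sub[of "g u" y] d g[of u] by (simp add: norm_minus_commute)
      then show ?thesis using u by (simp add: \<rho>_def)
    qed
    define D where "D y = frechet_derivative (weyl_field W i j) (at y)" for y
    have D: "(weyl_field W i j has_derivative D y) (at y) \<and> (\<forall>w. \<bar>D y w\<bar> \<le> C * norm w / norm y ^ (CARD('n) + 1))"
      if "y \<noteq> 0" for y
      using C(2)[OF that, of i j] frechet_derivative_at unfolding D_def by metis
    have "norm (weyl_field W i j (f u) - weyl_field W i j (g u)) \<le> C / \<rho> ^ (CARD('n) + 1) * norm (f u - g u)"
    proof (rule differentiable_bound[where S = "closed_segment (g u) (f u)"])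
      fix y assume y: "y \<in> closed_segment (g u) (f u)"
      have y0: "y \<noteq> 0" using far[OF y] \<rho> by auto
      show "(weyl_field W i j has_derivative D y) (at y within closed_segment (g u) (f u))"
        using D[OF y0] has_derivative_at_withinI by blast
      show "onorm (D y) \<le> C / \<rho> ^ (CARD('n) + 1)"
      proof (rule onorm_le)
        fix w
        have "\<bar>D y w\<bar> \<le> C * norm w / norm y ^ (CARD('n) + 1)" using D[OF y0] by blast
        also have "\<dots> \<le> C * norm w / \<rho> ^ (CARD('n) + 1)"
          using far[OF y] \<rho> C(1) y0 by (intro divide_left_mono power_mono mult_pos_pos zero_less_power) auto
        finally show "norm (D y w) \<le> C / \<rho> ^ (CARD('n) + 1) * norm w" by simp
      qed
    qed auto
    also have "\<dots> \<le> C / \<rho> ^ (CARD('n) + 1) * \<bar>B\<bar>" using d C(1) \<rho> by (intro mult_left_mono) auto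
    also have "\<dots> = (C * \<bar>B\<bar> * 2 ^ (CARD('n) + 1)) / norm u ^ (CARD('n) + 1)"
      by (simp add: \<rho>_def power_divide)
    finally show "\<bar>weyl_field W i j (f u) - weyl_field W i j (g u)\<bar> \<le>
        (C * \<bar>B\<bar> * 2 ^ (CARD('n) + 1)) / norm u ^ (CARD('n) + 1)" by simp
  qed
qed

section \<open>Asymptotically Euclidean coordinates\<close>

lemma inner_matrix_vector:
  fixes H :: "real^'n^'n"
  shows "v \<bullet> (H *v w) = (\<Sum>i\<in>UNIV. \<Sum>j\<in>UNIV. v$i * H$i$j * w$j)"
  by (simp add: inner_vec_def matrix_vector_mult_def sum_distrib_left mult_ac)

lemma inner_matrix_vector_bound:
  fixes H :: "real^'n^'n"
  assumes "\<And>i j. \<bar>H$i$j\<bar> \<le> \<epsilon>"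
  shows "\<bar>v \<bullet> (H *v w)\<bar> \<le> (real CARD('n))\<^sup>2 * \<epsilon> * (norm v * norm w)"
proof -
  have "\<epsilon> \<ge> 0" using assms abs_ge_zero order_trans by blast
  have "\<bar>v \<bullet> (H *v w)\<bar> \<le> (\<Sum>i\<in>UNIV. \<Sum>j\<in>UNIV. \<bar>v$i * H$i$j * w$j\<bar>)"
    unfolding inner_matrix_vector by (intro order_trans[OF sum_abs] sum_mono sum_abs)
  also have "\<dots> \<le> (\<Sum>i\<in>(UNIV::'n set). \<Sum>j\<in>(UNIV::'n set). norm v * \<epsilon> * norm w)"
    unfolding abs_mult using \<open>\<epsilon> \<ge> 0\<close> by (intro sum_mono mult_mono component_le_norm_cart assms) auto
  finally show ?thesis by (simp add: power2_eq_square mult_ac)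
qed

locale weyl_end =
  fixes U :: "(real^'n::finite) set" and h :: "real^'n \<Rightarrow> real^'n^'n"
    and W :: "'n \<Rightarrow> 'n \<Rightarrow> 'n \<Rightarrow> 'n \<Rightarrow> real"
  assumes dim: "CARD('n) \<ge> 2"
    and ext: "exterior_domain U"
    and symmetric: "u \<in> U \<Longrightarrow> transpose (h u) = h u"
    and expansion: "has_weyl_expansion U h W"
begin

lemma open_U: "open U"
  using ext by (simp add: exterior_domain_def)

lemma exterior_subset: obtains R where "R > 0" "\<And>u. norm u \<ge> R \<Longrightarrow> u \<in> U"
proof -
  obtain R where "{u. norm u > R} \<subseteq> U" using ext by (auto simp: exterior_domain_def)
  then show thesis using that[of "\<bar>R\<bar> + 1"] by force
qed

text \<open>This bound holds up to the inner boundary of the domain.  Before the change of coordinates is known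
to be proper, the image of a point near infinity could be anywhere.\<close>
lemma metric_upper_bound:
  obtains B where "B > 0" "\<And>u w. u \<in> U \<Longrightarrow> w \<bullet> (h u *v w) \<le> B * (norm w)\<^sup>2"
proof -
  obtain R where R: "R > 0" "\<And>u. u \<in> U \<Longrightarrow> norm u > R" using ext by (auto simp: exterior_domain_def)
  obtain B where B: "B > 0" "\<And>u i j. u \<in> U \<Longrightarrow> \<bar>h u $ i $ j - (if i = j then 1 else 0)\<bar> \<le> B / norm u ^ CARD('n)"
    using weyl_expansion_estimates[OF ext expansion] by metis
  define c where "c = 1 + B / R ^ CARD('n)"
  have "\<bar>h u $ i $ j\<bar> \<le> c" if u: "u \<in> U" for u i j
  proof -
    have "norm u > R" by (rule R(2)[OF u])
    then have "B / norm u ^ CARD('n) \<le> B / R ^ CARD('n)"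
      using R(1) B(1) by (intro divide_left_mono power_mono mult_pos_pos zero_less_power) auto
    moreover have "\<bar>h u $ i $ j\<bar> \<le> 1 + \<bar>h u $ i $ j - (if i = j then 1 else 0)\<bar>" by auto
    ultimately show ?thesis using B(2)[OF u, of i j] by (simp add: c_def)
  qed
  then have "w \<bullet> (h u *v w) \<le> ((real CARD('n))\<^sup>2 * c) * (norm w)\<^sup>2" if "u \<in> U" for u w
    using inner_matrix_vector_bound[of "h u" c w w] that by (simp add: power2_eq_square abs_le_iff)
  moreover have "(real CARD('n))\<^sup>2 * c > 0" using B(1) R(1) by (simp add: c_def add_pos_pos)
  ultimately show thesis using that by blast
qed

lemma metric_near_euclidean:
  obtains R where "R > 0" "\<And>u. norm u \<ge> R \<Longrightarrow> u \<in> U"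
    "\<And>u w. norm u \<ge> R \<Longrightarrow> (norm w)\<^sup>2 / 2 \<le> w \<bullet> (h u *v w) \<and> w \<bullet> (h u *v w) \<le> 2 * (norm w)\<^sup>2"
proof -
  obtain B where B: "B > 0" "\<And>u i j. u \<in> U \<Longrightarrow> \<bar>h u $ i $ j - (if i = j then 1 else 0)\<bar> \<le> B / norm u ^ CARD('n)"
    using weyl_expansion_estimates[OF ext expansion] by metis
  obtain R0 where R0: "R0 > 0" "\<And>u. norm u \<ge> R0 \<Longrightarrow> u \<in> U" using exterior_subset by blast
  define N where "N = (real CARD('n))\<^sup>2"
  have N: "N > 0" by (simp add: N_def)
  define R where "R = max R0 (max 1 (2 * N * B))"
  have est: "(norm w)\<^sup>2 / 2 \<le> w \<bullet> (h u *v w) \<and> w \<bullet> (h u *v w) \<le> 2 * (norm w)\<^sup>2" if u: "norm u \<ge> R" for u w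
  proof -
    have uu: "norm u \<ge> 1" "norm u \<ge> 2 * N * B" "u \<in> U" using u R0 by (auto simp: R_def)
    have "\<bar>(h u - mat 1) $ i $ j\<bar> \<le> 1 / (2 * N)" for i j
    proof -
      have "\<bar>(h u - mat 1) $ i $ j\<bar> \<le> B / norm u ^ CARD('n)"
        using B(2)[OF uu(3), of i j] by (simp add: mat_def)
      also have "\<dots> \<le> B / norm u ^ 1"
        using uu B dim
        by (intro divide_left_mono power_increasing mult_pos_pos zero_less_power) (auto intro: less_le_trans[OF zero_less_one])
      also have "\<dots> \<le> 1 / (2 * N)"
      proof -
        have "B \<le> 1 / (2 * N) * norm u" using uu(2) N by (simp add: field_simps)
        then show ?thesis using uu(1) by (simp only: power_one_right) (intro mult_imp_div_pos_le, auto)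
      qed
      finally show ?thesis .
    qed
    from inner_matrix_vector_bound[of "h u - mat 1" "1 / (2 * N)" w w, OF this]
    have "\<bar>w \<bullet> ((h u - mat 1) *v w)\<bar> \<le> (norm w)\<^sup>2 / 2" using N by (simp add: N_def power2_eq_square)
    moreover have "w \<bullet> ((h u - mat 1) *v w) = w \<bullet> (h u *v w) - (norm w)\<^sup>2"
      by (simp add: matrix_vector_mult_diff_rdistrib inner_diff_right power2_norm_eq_inner)
    ultimately show ?thesis by (intro conjI) linarith+
  qed
  show thesis by (rule that[of R]) (use R0 est in \<open>auto simp: R_def\<close>)
qed

lemma eventually_in_domain: "\<forall>\<^sub>F u in at_infinity. u \<in> U"
  using exterior_subset by (metis eventually_at_infinity)

lemma metric_decay:
  shows "(\<lambda>u. h u $ i $ j - (if i = j then 1 else 0)) \<in> decay CARD('n)"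
    and "(\<lambda>u. partial l (\<lambda>v. h v $ i $ j) u) \<in> decay (CARD('n) + 1)"
    and "(\<lambda>u. h u $ i $ j - (if i = j then 1 else 0) - weyl_field W i j u) \<in> decay (CARD('n) + 1)"
    and "u \<in> U \<Longrightarrow> (\<lambda>v. h v $ i $ j) differentiable (at u)"
proof -
  obtain B where B: "B > 0"
    "\<And>u i j. u \<in> U \<Longrightarrow> (\<lambda>v. h v $ i $ j) differentiable (at u)"
    "\<And>u i j k. u \<in> U \<Longrightarrow> \<bar>partial k (\<lambda>v. h v $ i $ j) u\<bar> \<le> B / norm u ^ (CARD('n) + 1)"
    "\<And>u i j. u \<in> U \<Longrightarrow> \<bar>h u $ i $ j - (if i = j then 1 else 0)\<bar> \<le> B / norm u ^ CARD('n)"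
    "\<And>u i j. u \<in> U \<Longrightarrow> \<bar>h u $ i $ j - (if i = j then 1 else 0) - weyl_field W i j u\<bar> \<le> B / norm u ^ (CARD('n) + 1)"
    by (rule weyl_expansion_estimates[OF ext expansion]) blast
  obtain R where R: "\<And>u. norm u \<ge> R \<Longrightarrow> u \<in> U" using exterior_subset by blast
  show "(\<lambda>u. h u $ i $ j - (if i = j then 1 else 0)) \<in> decay CARD('n)"
    "(\<lambda>u. partial l (\<lambda>v. h v $ i $ j) u) \<in> decay (CARD('n) + 1)"
    "(\<lambda>u. h u $ i $ j - (if i = j then 1 else 0) - weyl_field W i j u) \<in> decay (CARD('n) + 1)"
    unfolding decay_iff using B R by blast+
  show "u \<in> U \<Longrightarrow> (\<lambda>v. h v $ i $ j) differentiable (at u)" by (rule B(2))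
qed

end

section \<open>The change of coordinates is proper\<close>

text \<open>An isometry \<open>\<phi>\<close> between two asymptotically Euclidean metrics, with inverse \<open>\<psi>\<close> and Jacobians \<open>J\<close> and
\<open>L\<close>.  All assumptions are symmetric in the two sides up to the isometry identity, which
the lemma \<open>swapped\<close> recovers for the inverse.\<close>
locale coordinate_change =
  src: weyl_end U h W + tgt: weyl_end V k W'
  for U :: "(real^'n::finite) set" and h W and V :: "(real^'n) set" and k W' +
  fixes \<phi> \<psi> :: "real^'n \<Rightarrow> real^'n" and J L :: "real^'n \<Rightarrow> real^'n^'n"
  assumes maps: "u \<in> U \<Longrightarrow> \<phi> u \<in> V" "v \<in> V \<Longrightarrow> \<psi> v \<in> U"
    and inverse: "u \<in> U \<Longrightarrow> \<psi> (\<phi> u) = u" "v \<in> V \<Longrightarrow> \<phi> (\<psi> v) = v"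
    and derivative: "u \<in> U \<Longrightarrow> (\<phi> has_derivative (\<lambda>w. J u *v w)) (at u)"
      "v \<in> V \<Longrightarrow> (\<psi> has_derivative (\<lambda>w. L v *v w)) (at v)"
    and jacobian_differentiable: "u \<in> U \<Longrightarrow> (\<lambda>u. J u $ a $ i) differentiable (at u)"
      "v \<in> V \<Longrightarrow> (\<lambda>v. L v $ a $ i) differentiable (at v)"
    and isometry: "u \<in> U \<Longrightarrow> h u = transpose (J u) ** k (\<phi> u) ** J u"
begin

lemma metric_pullback:
  assumes "u \<in> U"
  shows "w \<bullet> (h u *v z) = (J u *v w) \<bullet> (k (\<phi> u) *v (J u *v z))"
proof -
  have "w \<bullet> (x v* J u) = (J u *v w) \<bullet> x" for x by (metis inner_commute dot_lmul_matrix)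
  then show ?thesis unfolding isometry[OF assms]
    by (simp add: matrix_vector_mul_assoc[symmetric] transpose_matrix_vector)
qed

lemma jacobian_right_inverse:
  assumes v: "v \<in> V"
  shows "J (\<psi> v) *v (L v *v w) = w"
proof -
  have "((\<lambda>u. \<phi> (\<psi> u)) has_derivative (\<lambda>w. J (\<psi> v) *v (L v *v w))) (at v)"
    using has_derivative_compose[OF derivative(2)[OF v] derivative(1)[OF maps(2)[OF v]]] .
  then have "((\<lambda>u. u) has_derivative (\<lambda>w. J (\<psi> v) *v (L v *v w))) (at v)"
    by (rule has_derivative_transform_within_open[OF _ tgt.open_U v]) (simp add: inverse)
  then show ?thesis using has_derivative_unique[OF _ has_derivative_ident] by metis
qed

text \<open>Every result in this locale also holds for the inverse change of coordinates.\<close>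
lemma swapped: "coordinate_change V k W' U h W \<psi> \<phi> L J"
proof unfold_locales
  show "k v = transpose (L v) ** h (\<psi> v) ** L v" if v: "v \<in> V" for v
  proof -
    have JL: "J (\<psi> v) ** L v = mat 1"
      by (rule matrix_eq[THEN iffD2]) (simp add: jacobian_right_inverse[OF v] flip: matrix_vector_mul_assoc)
    have "transpose (L v) ** h (\<psi> v) ** L v = transpose (J (\<psi> v) ** L v) ** k v ** (J (\<psi> v) ** L v)"
      unfolding isometry[OF maps(2)[OF v]] by (simp add: inverse v matrix_transpose_mul matrix_mul_assoc)
    then show ?thesis by (simp add: JL)
  qed
qed (auto simp: maps inverse derivative jacobian_differentiable)

lemma continuous_maps: "continuous_on U \<phi>" "continuous_on V \<psi>"
  using derivative has_derivative_continuous by (meson continuous_at_imp_continuous_on)+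

text \<open>A quantitative inverse function theorem, from a Lipschitz bound on \<open>\<psi>\<close>.  If the open image of the ball
did not contain the smaller ball, let \<open>b\<close> be the point of its complement closest to \<open>\<phi> u\<close>.  Up to \<open>b\<close>
the inverse moves by less than one, so \<open>b\<close> would be the image of an interior point.\<close>
lemma ball_in_image_of_ball:
  assumes R: "\<And>u. norm u \<ge> R \<Longrightarrow> u \<in> U"
    and C: "C > 0" "\<And>v w. v \<in> V \<Longrightarrow> norm (\<psi> v) \<ge> R \<Longrightarrow> norm (L v *v w) \<le> C * norm w"
    and u: "norm u \<ge> R + 1"
  shows "ball (\<phi> u) (1 / C) \<subseteq> \<phi> ` ball u 1"
proof -
  have far: "norm z \<ge> R" if "z \<in> cball u 1" for z
  proof -
    have "norm u \<le> norm z + dist u z" using norm_triangle_sub[of u z] by (simp add: dist_norm)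
    then show ?thesis using that u by simp
  qed
  have cU: "cball u 1 \<subseteq> U" using far R by blast
  then have bU: "ball u 1 \<subseteq> U" "u \<in> U" by auto
  define I where "I = \<phi> ` ball u 1"
  have I: "I = V \<inter> \<psi> -` ball u 1"
    using bU maps inverse unfolding I_def by (auto intro!: image_eqI[of _ \<phi> "\<psi> _"] simp: subset_iff)
  have "open I" unfolding I
    by (rule continuous_open_preimage[OF continuous_maps(2) tgt.open_U open_ball])
  have vO: "\<phi> u \<in> I" unfolding I_def by simp
  have "ball (\<phi> u) (1 / C) \<subseteq> I"
  proof (cases "I = UNIV")
    case False
    then have "closed (- I)" "- I \<noteq> {}" using \<open>open I\<close> by auto
    then obtain b where b: "b \<in> - I" "\<And>y. y \<in> - I \<Longrightarrow> dist (\<phi> u) b \<le> dist (\<phi> u) y"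
      using distance_attains_inf by metis
    define d where "d = dist (\<phi> u) b"
    have d: "d > 0" using b(1) vO by (auto simp: d_def)
    have dO: "ball (\<phi> u) d \<subseteq> I" using b(2) by (force simp: d_def)
    have "d \<ge> 1 / C"
    proof (rule ccontr)
      assume "\<not> d \<ge> 1 / C"
      then have Cd: "C * d < 1" using C(1) by (simp add: field_simps)
      have lip: "norm (\<psi> w - u) \<le> C * d" if w: "w \<in> ball (\<phi> u) d" for w
      proof -
        have "norm (\<psi> w - \<psi> (\<phi> u)) \<le> C * norm (w - \<phi> u)"
        proof (rule differentiable_bound[OF convex_ball])
          fix x assume x: "x \<in> ball (\<phi> u) d"
          then have xV: "x \<in> V" "\<psi> x \<in> ball u 1" using dO I by auto
          show "(\<psi> has_derivative (\<lambda>w. L x *v w)) (at x within ball (\<phi> u) d)"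
            using derivative(2)[OF xV(1)] by (rule has_derivative_at_withinI)
          have "norm (\<psi> x) \<ge> R" using far xV(2) by auto
          then show "onorm (\<lambda>w. L x *v w) \<le> C" using C(2)[OF xV(1)] by (intro onorm_le) auto
        qed (use w d in auto)
        also have "\<dots> \<le> C * d" using w C(1) by (intro mult_left_mono) (auto simp: dist_norm norm_minus_commute)
        finally show ?thesis using inverse(1) bU by simp
      qed
      have "b \<in> closure (ball (\<phi> u) d)" using d by (simp add: d_def)
      also have "\<dots> \<subseteq> closure I" using dO by (rule closure_mono)
      also have "\<dots> \<subseteq> closure (\<phi> ` cball u 1)" unfolding I_def by (intro closure_mono) auto
      also have "\<dots> = \<phi> ` cball u 1"
        by (intro closure_closed compact_imp_closed compact_continuous_image continuous_on_subset[OF continuous_maps(1) cU]) auto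
      finally have bV: "b \<in> V" using cU maps by auto
      have "isCont \<psi> b" using derivative(2)[OF bV] has_derivative_continuous by blast
      then have "continuous (at b within ball (\<phi> u) d) \<psi>" by (rule continuous_at_imp_continuous_at_within)
      have "norm (\<psi> b - u) \<le> C * d"
      proof -
        have nt: "at b within ball (\<phi> u) d \<noteq> bot"
          using \<open>b \<in> closure (ball (\<phi> u) d)\<close> b(1) dO by (auto simp: trivial_limit_within closure_def)
        have "((\<lambda>w. norm (\<psi> w - u)) \<longlongrightarrow> norm (\<psi> b - u)) (at b within ball (\<phi> u) d)"
          using \<open>continuous (at b within ball (\<phi> u) d) \<psi>\<close> unfolding continuous_within by (intro tendsto_intros)
        then show ?thesis
          by (rule tendsto_upperbound) (use lip nt in \<open>auto simp: eventually_at_filter\<close>)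
      qed
      then have "\<psi> b \<in> ball u 1" using Cd by (simp add: dist_norm norm_minus_commute)
      then have "b \<in> I" using bV I by auto
      then show False using b(1) by simp
    qed
    then show ?thesis using dO by auto
  qed simp
  then show ?thesis by (simp add: I_def)
qed

text \<open>Packing: the images of far out points at mutual distance at least two stay apart from each other by a fixed
amount, so infinitely many of them do not fit into a bounded set.\<close>
lemma image_of_exterior_unbounded:
  obtains u where "norm u > r" "u \<in> U" "norm (\<phi> u) > \<rho>"
proof -
  obtain R where R: "R > 0" "\<And>u. norm u \<ge> R \<Longrightarrow> u \<in> U"
    "\<And>u w. norm u \<ge> R \<Longrightarrow> (norm w)\<^sup>2 / 2 \<le> w \<bullet> (h u *v w) \<and> w \<bullet> (h u *v w) \<le> 2 * (norm w)\<^sup>2"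
    using src.metric_near_euclidean by metis
  obtain B where B: "B > 0" "\<And>v w. v \<in> V \<Longrightarrow> w \<bullet> (k v *v w) \<le> B * (norm w)\<^sup>2"
    using tgt.metric_upper_bound by metis
  define C where "C = sqrt (2 * B)"
  have C: "C > 0" using B by (simp add: C_def)
  have Lbound: "norm (L v *v w) \<le> C * norm w" if v: "v \<in> V" "norm (\<psi> v) \<ge> R" for v w
  proof -
    have "(norm (L v *v w))\<^sup>2 / 2 \<le> (L v *v w) \<bullet> (h (\<psi> v) *v (L v *v w))" using R(3)[OF v(2)] by blast
    also have "\<dots> = w \<bullet> (k v *v w)"
      using metric_pullback[OF maps(2)[OF v(1)]] by (simp add: jacobian_right_inverse[OF v(1)] inverse v(1))
    also have "\<dots> \<le> B * (norm w)\<^sup>2" by (rule B(2)[OF v(1)])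
    finally have "(norm (L v *v w))\<^sup>2 \<le> (C * norm w)\<^sup>2" using B(1) by (simp add: C_def power_mult_distrib)
    then show ?thesis by (rule power2_le_imp_le) (use C in simp)
  qed
  have spread: "ball (\<phi> x) (1 / C) \<subseteq> \<phi> ` ball x 1" if "norm x \<ge> R + 1" for x
    by (rule ball_in_image_of_ball[where R = R]) (use R(2) C Lbound that in auto)
  define s where "s = max r (R + 1)"
  obtain e :: "real^'n" where e: "norm e = 1" using norm_Basis SOME_Basis by blast
  \<comment> \<open>points on a ray with consecutive distance two, so that the unit balls around them are disjoint\<close>
  define u where "u n = (s + 1 + 2 * real n) *\<^sub>R e" for n :: nat
  have un: "norm (u n) = s + 1 + 2 * real n" for n using R(1) e by (simp add: u_def s_def)
  have us: "norm (u n) > r" "norm (u n) \<ge> R + 1" "u n \<in> U" for n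
    using R un[of n] by (auto simp: s_def)
  have apart: "m = n" if "dist (\<phi> (u m)) (\<phi> (u n)) < 1 / C" for m n
  proof (rule ccontr)
    assume "m \<noteq> n"
    from that have "\<phi> (u n) \<in> \<phi> ` ball (u m) 1" using spread[OF us(2)[of m]] by auto
    then obtain z where z: "z \<in> ball (u m) 1" "\<phi> (u n) = \<phi> z" by blast
    have "norm z \<ge> R"
      using z(1) us(2)[of m] norm_triangle_sub[of "u m" z] by (simp add: dist_norm)
    then have "z = u n" using inverse(1)[OF R(2), of z] inverse(1)[OF us(3), of n] z(2) by metis
    then have "dist (u m) (u n) < 1" using z(1) by simp
    then have "\<bar>norm (u m) - norm (u n)\<bar> < 1" using norm_triangle_ineq3[of "u m" "u n"] by (simp add: dist_norm)
    then show False using \<open>m \<noteq> n\<close> by (auto simp: un)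
  qed
  have "\<exists>n. norm (\<phi> (u n)) > \<rho>"
  proof (rule ccontr)
    assume "\<not> ?thesis"
    then have "\<forall>n. \<phi> (u n) \<in> cball 0 \<rho>" by (auto simp: not_less)
    moreover have "seq_compact (cball (0::real^'n) \<rho>)" by (rule compact_imp_seq_compact[OF compact_cball])
    ultimately obtain l f where f: "strict_mono f" "((\<lambda>n. \<phi> (u n)) \<circ> f) \<longlonglongrightarrow> l"
      using seq_compactE[of "cball 0 \<rho>" "\<lambda>n. \<phi> (u n)"] by blast
    from f(2) have "Cauchy ((\<lambda>n. \<phi> (u n)) \<circ> f)" using convergentI convergent_Cauchy by blast
    then obtain M where "\<And>m n. m \<ge> M \<Longrightarrow> n \<ge> M \<Longrightarrow> dist (\<phi> (u (f m))) (\<phi> (u (f n))) < 1 / C"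
      using C by (auto simp: Cauchy_def o_def dest!: spec[of _ "1 / C"])
    then have "f M = f (Suc M)" using apart by simp
    then show False using f(1) by (metis n_not_Suc_n strict_mono_eq)
  qed
  then show thesis using that us by blast
qed

text \<open>The exterior of a large ball is connected and its image avoids a given sphere, so the image lies on one
side of this sphere; being unbounded, it lies outside.  Topology alone does not suffice here, as a
homeomorphism between two annuli can interchange their ends.\<close>
lemma tends_to_infinity: "filterlim \<phi> at_infinity at_infinity"
proof -
  have "\<exists>r. \<forall>u. norm u > r \<longrightarrow> norm (\<phi> u) \<ge> \<rho>" for \<rho>
  proof -
    obtain R where R: "R > 0" "\<And>u. norm u \<ge> R \<Longrightarrow> u \<in> U" using src.exterior_subset by metis
    obtain Q where Q: "Q > 0" "\<And>v. norm v \<ge> Q \<Longrightarrow> v \<in> V" using tgt.exterior_subset by metis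
    define q where "q = max \<rho> Q"
    have sub: "sphere 0 q \<subseteq> V" using Q by (auto simp: q_def)
    have "compact (\<psi> ` sphere 0 q)"
      by (intro compact_continuous_image continuous_on_subset[OF continuous_maps(2) sub]) auto
    then obtain b where b: "\<And>u. u \<in> \<psi> ` sphere 0 q \<Longrightarrow> norm u \<le> b"
      using compact_imp_bounded bounded_iff by metis
    define r where "r = max R b"
    define E where "E = {u::real^'n. norm u > r}"
    have EU: "E \<subseteq> U" using R by (auto simp: E_def r_def)
    have "connected (- cball (0::real^'n) r)"
      by (rule connected_complement_bounded_convex) (use src.dim in auto)
    moreover have "- cball (0::real^'n) r = E" by (auto simp: E_def)
    ultimately have "connected E" by simp
    then have conn: "connected ((\<lambda>u. norm (\<phi> u)) ` E)"
      by (intro connected_continuous_image continuous_on_norm continuous_on_subset[OF continuous_maps(1) EU])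
    have miss: "q \<notin> (\<lambda>u. norm (\<phi> u)) ` E"
    proof
      assume "q \<in> (\<lambda>u. norm (\<phi> u)) ` E"
      then obtain u where u: "u \<in> E" "norm (\<phi> u) = q" by auto
      then have "u \<in> \<psi> ` sphere 0 q" using inverse(1)[of u] EU by (intro image_eqI[of _ \<psi> "\<phi> u"]) auto
      then have "norm u \<le> b" by (rule b)
      then show False using u(1) by (simp add: E_def r_def)
    qed
    obtain u0 where u0: "u0 \<in> E" "norm (\<phi> u0) > q"
      using image_of_exterior_unbounded[of r q] by (auto simp: E_def)
    have "norm (\<phi> u) \<ge> q" if u: "u \<in> E" for u
    proof (rule ccontr)
      assume "\<not> norm (\<phi> u) \<ge> q"
      then have "q \<in> (\<lambda>u. norm (\<phi> u)) ` E"
        using connectedD_interval[OF conn, of "norm (\<phi> u)" "norm (\<phi> u0)" q] u u0 by auto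
      then show False using miss by simp
    qed
    then show ?thesis by (auto simp: E_def q_def intro!: exI[of _ r])
  qed
  then show ?thesis
    unfolding filterlim_at_infinity[of 0, OF order_refl] eventually_at_infinity
    by (metis gt_ex less_le_trans)
qed

section \<open>The change of coordinates is asymptotically affine\<close>

text \<open>Both metrics lie between one half and twice the Euclidean one far out, and \<open>J\<close> maps one to the other.\<close>
lemma jacobian_almost_isometric:
  obtains R where "R > 0" "\<And>u. norm u \<ge> R \<Longrightarrow> u \<in> U"
    "\<And>u w. norm u \<ge> R \<Longrightarrow> norm (J u *v w) \<le> 2 * norm w \<and> norm w \<le> 2 * norm (J u *v w)"
    "\<And>u w. norm u \<ge> R \<Longrightarrow> (norm w)\<^sup>2 / 2 \<le> w \<bullet> (k (\<phi> u) *v w)"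
proof -
  obtain R1 where R1: "R1 > 0" "\<And>u. norm u \<ge> R1 \<Longrightarrow> u \<in> U"
    "\<And>u w. norm u \<ge> R1 \<Longrightarrow> (norm w)\<^sup>2 / 2 \<le> w \<bullet> (h u *v w) \<and> w \<bullet> (h u *v w) \<le> 2 * (norm w)\<^sup>2"
    using src.metric_near_euclidean by metis
  obtain R2 where R2: "R2 > 0" "\<And>u. norm u \<ge> R2 \<Longrightarrow> u \<in> V"
    "\<And>u w. norm u \<ge> R2 \<Longrightarrow> (norm w)\<^sup>2 / 2 \<le> w \<bullet> (k u *v w) \<and> w \<bullet> (k u *v w) \<le> 2 * (norm w)\<^sup>2"
    using tgt.metric_near_euclidean by metis
  obtain R3 where R3: "\<And>u. norm u \<ge> R3 \<Longrightarrow> norm (\<phi> u) \<ge> R2"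
    using tends_to_infinity R2(1) unfolding filterlim_at_infinity[of 0, OF order_refl] eventually_at_infinity by metis
  show thesis
  proof (rule that[of "max R1 R3"])
    fix u w :: "real^'n" assume "norm u \<ge> max R1 R3"
    then have u: "norm u \<ge> R1" "norm (\<phi> u) \<ge> R2" "u \<in> U" using R1 R3 by auto
    have eq: "w \<bullet> (h u *v w) = (J u *v w) \<bullet> (k (\<phi> u) *v (J u *v w))" by (rule metric_pullback[OF u(3)])
    have "(norm (J u *v w))\<^sup>2 \<le> (2 * norm w)\<^sup>2" "(norm w)\<^sup>2 \<le> (2 * norm (J u *v w))\<^sup>2"
      using R1(3)[OF u(1), of w] R2(3)[OF u(2), of "J u *v w"] unfolding power_mult_distrib eq by simp_all
    then show "norm (J u *v w) \<le> 2 * norm w \<and> norm w \<le> 2 * norm (J u *v w)"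
      by (auto intro: power2_le_imp_le)
    show "(norm w)\<^sup>2 / 2 \<le> w \<bullet> (k (\<phi> u) *v w)" using R2(3)[OF u(2)] by blast
  qed (use R1 in auto)
qed

lemma jacobian_bounded: "(\<lambda>u. J u $ a $ i) \<in> decay 0"
proof -
  obtain R where R: "\<And>u w. norm u \<ge> R \<Longrightarrow> norm (J u *v w) \<le> 2 * norm w"
    using jacobian_almost_isometric by metis
  have "\<bar>J u $ a $ i\<bar> \<le> 2" if "norm u \<ge> R" for u
  proof -
    have "J u $ a $ i = (J u *v axis i 1) $ a" by (simp add: matrix_vector_mul_component inner_axis)
    also have "\<bar>\<dots>\<bar> \<le> norm (J u *v axis i 1)" by (rule component_le_norm_cart)
    also have "\<dots> \<le> 2" using R[OF that, of "axis i 1"] by simp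
    finally show ?thesis .
  qed
  then show ?thesis unfolding decay_iff by auto
qed

text \<open>Integrates the bound on \<open>J\<close> along the radial segment from a fixed sphere.\<close>
lemma linear_growth:
  obtains C R where "C > 0" "\<And>u. norm u \<ge> R \<Longrightarrow> norm (\<phi> u) \<le> C * norm u"
proof -
  obtain R where R: "R > 0" "\<And>u. norm u \<ge> R \<Longrightarrow> u \<in> U"
    "\<And>u w. norm u \<ge> R \<Longrightarrow> norm (J u *v w) \<le> 2 * norm w"
    using jacobian_almost_isometric by metis
  have sub: "sphere 0 R \<subseteq> U" using R by auto
  have "compact (\<phi> ` sphere 0 R)"
    by (intro compact_continuous_image continuous_on_subset[OF continuous_maps(1) sub]) auto
  then obtain b where b: "b > 0" "\<And>v. v \<in> \<phi> ` sphere 0 R \<Longrightarrow> norm v \<le> b"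
    using compact_imp_bounded bounded_pos by metis
  have "norm (\<phi> u) \<le> (b / R + 2) * norm u" if u: "norm u \<ge> R" for u
  proof -
    define z where "z = (R / norm u) *\<^sub>R u"
    have un: "norm u > 0" using u R(1) by linarith
    have z: "norm z = R" using R(1) un by (simp add: z_def)
    have far: "norm y \<ge> R" if y: "y \<in> closed_segment z u" for y
    proof -
      obtain t where t: "0 \<le> t" "t \<le> 1" "y = (1 - t) *\<^sub>R z + t *\<^sub>R u" using y by (auto simp: in_segment)
      have "y = ((1 - t) * (R / norm u) + t) *\<^sub>R u" by (simp add: t z_def algebra_simps)
      then have "norm y = ((1 - t) * (R / norm u) + t) * norm u" using t R(1) by simp
      also have "\<dots> = (1 - t) * R + t * norm u" using un by (simp add: field_simps)
      also have "\<dots> \<ge> (1 - t) * R + t * R" using u t by (intro add_left_mono mult_left_mono) auto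
      finally show ?thesis by (simp add: algebra_simps)
    qed
    have "norm (\<phi> u - \<phi> z) \<le> 2 * norm (u - z)"
    proof (rule differentiable_bound[where S = "closed_segment z u"])
      fix y assume y: "y \<in> closed_segment z u"
      show "(\<phi> has_derivative (\<lambda>w. J y *v w)) (at y within closed_segment z u)"
        using derivative(1)[OF R(2)[OF far[OF y]]] by (rule has_derivative_at_withinI)
      show "onorm (\<lambda>w. J y *v w) \<le> 2" using R(3)[OF far[OF y]] by (rule onorm_le)
    qed auto
    also have "norm (u - z) \<le> norm u"
    proof -
      have "u - z = (1 - R / norm u) *\<^sub>R u" by (simp add: z_def algebra_simps)
      moreover have "\<bar>1 - R / norm u\<bar> \<le> 1" using u R(1) un by (simp add: abs_le_iff field_simps)
      ultimately show ?thesis using un by (simp add: mult_left_le_one_le)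
    qed
    finally have "norm (\<phi> u) \<le> norm (\<phi> z) + 2 * norm u" using norm_triangle_sub[of "\<phi> u" "\<phi> z"] by simp
    moreover have "norm (\<phi> z) \<le> b" using z by (intro b) simp
    moreover have "b \<le> b / R * norm u" using u R(1) b(1) by (simp add: field_simps)
    ultimately show ?thesis by (simp add: algebra_simps)
  qed
  moreover have "b / R + 2 > 0" using b R by (simp add: add_pos_pos)
  ultimately show thesis using that by blast
qed

lemma inverse_norm_comparison:
  obtains C R where "C > 0" "\<And>u. norm u \<ge> R \<Longrightarrow> norm u \<le> C * norm (\<phi> u)"
proof -
  interpret swap: coordinate_change V k W' U h W \<psi> \<phi> L J by (rule swapped)
  obtain C R where C: "C > 0" "\<And>v. norm v \<ge> R \<Longrightarrow> norm (\<psi> v) \<le> C * norm v"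
    using swap.linear_growth by metis
  obtain R1 where R1: "\<And>u. norm u \<ge> R1 \<Longrightarrow> u \<in> U" using src.exterior_subset by blast
  have "\<forall>\<^sub>F u in at_infinity. norm (\<phi> u) \<ge> max R 1"
    using tends_to_infinity unfolding filterlim_at_infinity[of 0, OF order_refl] by (metis less_max_iff_disj zero_less_one)
  then obtain R2 where "\<And>u. norm u \<ge> R2 \<Longrightarrow> norm (\<phi> u) \<ge> R"
    by (auto simp: eventually_at_infinity)
  then have "norm u \<le> C * norm (\<phi> u)" if "norm u \<ge> max R1 R2" for u
    using C(2)[of "\<phi> u"] inverse(1)[OF R1, of u] that by auto
  then show thesis using that C(1) by blast
qed

text \<open>By \<open>linear_growth\<close> for the inverse, \<open>|u|\<close> is at most a constant multiple of \<open>|\<phi> u|\<close>, so substituting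
\<open>\<phi>\<close> preserves orders.\<close>
lemma decay_compose:
  assumes "f \<in> decay i"
  shows "(\<lambda>u. f (\<phi> u)) \<in> decay i"
proof -
  obtain C R where C: "C > 0" "\<And>u. norm u \<ge> R \<Longrightarrow> norm u \<le> C * norm (\<phi> u)"
    using inverse_norm_comparison by metis
  have "(\<lambda>u. 1 / norm (\<phi> u) ^ i) \<in> decay i"
    unfolding decay_iff
  proof (intro exI allI impI)
    fix u :: "real^'n" assume u: "norm u \<ge> max R 1"
    then have uu: "norm u > 0" "norm u \<le> C * norm (\<phi> u)" using C(2)[of u] by auto
    then have p: "norm (\<phi> u) > 0" using C(1) by (smt (verit) mult_nonneg_nonneg mult_zero_right zero_less_mult_pos)
    have "norm u ^ i \<le> C ^ i * norm (\<phi> u) ^ i"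
      using uu power_mono[of "norm u" "C * norm (\<phi> u)" i] by (simp add: power_mult_distrib)
    then show "\<bar>1 / norm (\<phi> u) ^ i\<bar> \<le> C ^ i / norm u ^ i"
      using p uu by (simp add: field_simps)
  qed
  moreover have "(\<lambda>u. f (\<phi> u)) \<in> O[at_infinity](\<lambda>u. 1 / norm (\<phi> u) ^ i)"
    by (rule landau_o.big.compose[OF assms tends_to_infinity])
  ultimately show ?thesis using landau_o.big_trans by blast
qed

lemma component_derivative:
  assumes "u \<in> U"
  shows "((\<lambda>u. \<phi> u $ a) has_derivative (\<lambda>w. (J u *v w) $ a)) (at u)"
  using bounded_linear.has_derivative[OF bounded_linear_vec_nth derivative(1)[OF assms]] .

lemma partial_component:
  assumes "u \<in> U"
  shows "partial i (\<lambda>u. \<phi> u $ a) u = J u $ a $ i"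
  using partial_eqI[OF component_derivative[OF assms]] by (simp add: matrix_vector_mul_component inner_axis)

lemma hessian_symmetric:
  assumes u: "u \<in> U"
  shows "partial l (\<lambda>u. J u $ a $ i) u = partial i (\<lambda>u. J u $ a $ l) u"
proof -
  let ?f = "\<lambda>u. \<phi> u $ a"
  have J: "partial l (\<lambda>u. J u $ a $ i) u = partial l (partial i ?f) u" "partial i ?f differentiable (at u)" for l i
    by (rule partial_cong_open[OF src.open_U u _ jacobian_differentiable(1)[OF u]], simp add: partial_component)+
  have "partial l (partial i ?f) u = partial i (partial l ?f) u"
    by (rule mixed_partials_commute[OF src.open_U u _ J(2)])
      (use component_derivative differentiableI in blast)
  then show ?thesis by (simp add: J(1))
qed

lemma isometry_components:
  assumes "u \<in> U"
  shows "h u $ i $ j = (\<Sum>a\<in>UNIV. \<Sum>b\<in>UNIV. J u $ a $ i * k (\<phi> u) $ a $ b * J u $ b $ j)"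
proof -
  have "h u $ i $ j = (\<Sum>b\<in>UNIV. \<Sum>a\<in>UNIV. J u $ a $ i * k (\<phi> u) $ a $ b * J u $ b $ j)"
    unfolding isometry[OF assms] by (simp add: matrix_matrix_mult_def transpose_def sum_distrib_right)
  then show ?thesis by (subst sum.swap)
qed

text \<open>Second derivatives of \<open>\<phi>\<close>, paired with the tangent vector \<open>J e\<^sub>j\<close> in the target metric.\<close>
definition hessian_term :: "'n \<Rightarrow> 'n \<Rightarrow> 'n \<Rightarrow> real^'n \<Rightarrow> real" where
  "hessian_term l i j u =
     (\<Sum>a\<in>UNIV. \<Sum>b\<in>UNIV. partial l (\<lambda>u. J u $ a $ i) u * k (\<phi> u) $ a $ b * J u $ b $ j)"

text \<open>The contribution of the derivatives of the target metric to \<open>\<partial>\<^sub>l h\<^sub>i\<^sub>j\<close>.\<close>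
definition metric_term :: "'n \<Rightarrow> 'n \<Rightarrow> 'n \<Rightarrow> real^'n \<Rightarrow> real" where
  "metric_term l i j u =
     (\<Sum>a\<in>UNIV. \<Sum>b\<in>UNIV. J u $ a $ i * (\<Sum>c\<in>UNIV. J u $ c $ l * partial c (\<lambda>v. k v $ a $ b) (\<phi> u)) * J u $ b $ j)"

lemma differentiated_isometry:
  assumes u: "u \<in> U"
  shows "partial l (\<lambda>u. h u $ i $ j) u = hessian_term l i j u + hessian_term l j i u + metric_term l i j u"
proof -
  let ?J = "\<lambda>a i u. J u $ a $ i" and ?K = "\<lambda>a b u. k (\<phi> u) $ a $ b"
  define dJ where "dJ a i = frechet_derivative (?J a i) (at u)" for a i
  define dK where "dK a b w = (\<Sum>c\<in>UNIV. (J u *v w) $ c * partial c (\<lambda>v. k v $ a $ b) (\<phi> u))" for a b w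
  have J: "(?J a i has_derivative dJ a i) (at u)" for a i
    unfolding dJ_def using jacobian_differentiable(1)[OF u] frechet_derivative_works by blast
  have K: "(?K a b has_derivative dK a b) (at u)" for a b
    using has_derivative_compose[OF derivative(1)[OF u] partial_has_derivative[OF tgt.metric_decay(4)[OF maps(1)[OF u]]]]
    by (simp add: dK_def[abs_def])
  have "((\<lambda>u. \<Sum>a\<in>UNIV. \<Sum>b\<in>UNIV. ?J a i u * ?K a b u * ?J b j u) has_derivative
      (\<lambda>w. \<Sum>a\<in>UNIV. \<Sum>b\<in>UNIV. ?J a i u * ?K a b u * dJ b j w + (?J a i u * dK a b w + dJ a i w * ?K a b u) * ?J b j u)) (at u)"
    by (intro has_derivative_sum has_derivative_mult J K)
  then have "((\<lambda>u. h u $ i $ j) has_derivative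
      (\<lambda>w. \<Sum>a\<in>UNIV. \<Sum>b\<in>UNIV. ?J a i u * ?K a b u * dJ b j w + (?J a i u * dK a b w + dJ a i w * ?K a b u) * ?J b j u)) (at u)"
    by (rule has_derivative_transform_within_open[OF _ src.open_U u]) (simp add: isometry_components)
  from partial_eqI[OF this, of l]
  have "partial l (\<lambda>u. h u $ i $ j) u =
      (\<Sum>a\<in>UNIV. \<Sum>b\<in>UNIV. ?J a i u * ?K a b u * dJ b j (axis l 1))
      + (\<Sum>a\<in>UNIV. \<Sum>b\<in>UNIV. ?J a i u * dK a b (axis l 1) * ?J b j u)
      + (\<Sum>a\<in>UNIV. \<Sum>b\<in>UNIV. dJ a i (axis l 1) * ?K a b u * ?J b j u)"
    by (simp add: sum.distrib distrib_right)
  moreover have "(\<Sum>a\<in>UNIV. \<Sum>b\<in>UNIV. ?J a i u * ?K a b u * dJ b j (axis l 1)) = hessian_term l j i u"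
  proof -
    have sym: "?K a b u = ?K b a u" for a b
      using arg_cong[OF tgt.symmetric[OF maps(1)[OF u]], of "\<lambda>H. H $ b $ a"] by (simp add: transpose_def)
    have "(\<Sum>a\<in>UNIV. \<Sum>b\<in>UNIV. ?J a i u * ?K a b u * dJ b j (axis l 1)) =
        (\<Sum>b\<in>UNIV. \<Sum>a\<in>UNIV. ?J a i u * ?K a b u * dJ b j (axis l 1))" by (rule sum.swap)
    also have "\<dots> = hessian_term l j i u"
      unfolding hessian_term_def
    proof (intro sum.cong refl)
      fix a b
      show "?J b i u * ?K b a u * dJ a j (axis l 1) = partial l (?J a j) u * ?K a b u * ?J b i u"
        using sym[of a b] by (simp add: dJ_def partial_def)
    qed
    finally show ?thesis .
  qed
  moreover have "(\<Sum>a\<in>UNIV. \<Sum>b\<in>UNIV. dJ a i (axis l 1) * ?K a b u * ?J b j u) = hessian_term l i j u"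
    by (simp add: hessian_term_def dJ_def partial_def)
  moreover have "(\<Sum>a\<in>UNIV. \<Sum>b\<in>UNIV. ?J a i u * dK a b (axis l 1) * ?J b j u) = metric_term l i j u"
    by (simp add: metric_term_def dK_def matrix_vector_mul_component inner_axis)
  ultimately show ?thesis by simp
qed

lemma metric_term_decay: "metric_term l i j \<in> decay (CARD('n) + 1)"
  unfolding metric_term_def[abs_def]
  by (intro decay_sum decay_mult_bounded jacobian_bounded decay_compose[OF tgt.metric_decay(2)])

text \<open>The index permutation that produces the Christoffel symbols: \<open>hessian_term l i j\<close> is symmetric in \<open>l\<close>
and \<open>i\<close>, and its symmetrisation in \<open>i\<close> and \<open>j\<close> is known from \<open>differentiated_isometry\<close>.\<close>
lemma hessian_term_decay: "hessian_term l i j \<in> decay (CARD('n) + 1)"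
proof -
  let ?D = "\<lambda>l i j u. partial l (\<lambda>u. h u $ i $ j) u - metric_term l i j u"
  have D: "?D l i j \<in> decay (CARD('n) + 1)" for l i j
    by (rule sum_in_bigo(2)[OF src.metric_decay(2) metric_term_decay])
  have "(\<lambda>u. (1/2) * (?D l i j u + ?D i l j u - ?D j l i u)) \<in> decay (CARD('n) + 1)"
    by (intro decay_cmult sum_in_bigo D)
  moreover have "\<forall>\<^sub>F u in at_infinity. (1/2) * (?D l i j u + ?D i l j u - ?D j l i u) = hessian_term l i j u"
    using src.eventually_in_domain
  proof eventually_elim
    fix u assume u: "u \<in> U"
    have sym: "hessian_term l i j u = hessian_term i l j u" for l i j
      unfolding hessian_term_def by (simp add: hessian_symmetric[OF u, of l _ i])
    show "(1/2) * (?D l i j u + ?D i l j u - ?D j l i u) = hessian_term l i j u"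
      using sym[of l i j] sym[of l j i] sym[of i j l] by (simp add: differentiated_isometry[OF u])
  qed
  ultimately show ?thesis by (rule decay_eventually_cong)
qed

text \<open>The vectors \<open>J e\<^sub>j\<close> form a uniformly nondegenerate basis, so the pairings in \<open>hessian_term\<close> control the
second derivatives themselves.\<close>
lemma hessian_decay: "partial l (\<lambda>u. J u $ a $ i) \<in> decay (CARD('n) + 1)"
proof -
  obtain R where R: "R > 0" "\<And>u. norm u \<ge> R \<Longrightarrow> u \<in> U"
    "\<And>u w. norm u \<ge> R \<Longrightarrow> norm (J u *v w) \<le> 2 * norm w \<and> norm w \<le> 2 * norm (J u *v w)"
    "\<And>u w. norm u \<ge> R \<Longrightarrow> (norm w)\<^sup>2 / 2 \<le> w \<bullet> (k (\<phi> u) *v w)"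
    using jacobian_almost_isometric by metis
  have bound: "\<bar>partial l (\<lambda>u. J u $ a $ i) u\<bar> \<le> 4 * (\<Sum>j\<in>UNIV. \<bar>hessian_term l i j u\<bar>)" if u: "norm u \<ge> R" for u
  proof -
    have uU: "u \<in> U" by (rule R(2)[OF u])
    define q where "q = (\<chi> a. partial l (\<lambda>u. J u $ a $ i) u)"
    define z where "z = L (\<phi> u) *v q"
    define s where "s = (\<Sum>j\<in>UNIV. \<bar>hessian_term l i j u\<bar>)"
    \<comment> \<open>coordinates \<open>z\<close> of \<open>q\<close> in the basis \<open>J e\<^sub>j\<close>; then \<open>q \<bullet> k q\<close> is a combination of the pairings\<close>
    have Jz: "J u *v z = q"
      using jacobian_right_inverse[OF maps(1)[OF uU], of q] by (simp add: z_def inverse uU)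
    have "q \<bullet> (k (\<phi> u) *v q) = (\<Sum>a\<in>UNIV. \<Sum>b\<in>UNIV. q $ a * k (\<phi> u) $ a $ b * (\<Sum>j\<in>UNIV. J u $ b $ j * z $ j))"
      unfolding inner_matrix_vector by (subst (2) Jz[symmetric]) (simp add: matrix_vector_mult_def)
    also have "\<dots> = (\<Sum>a\<in>UNIV. \<Sum>b\<in>UNIV. \<Sum>j\<in>UNIV. z $ j * (q $ a * k (\<phi> u) $ a $ b * J u $ b $ j))"
      by (simp add: sum_distrib_left mult_ac)
    also have "\<dots> = (\<Sum>j\<in>UNIV. \<Sum>a\<in>UNIV. \<Sum>b\<in>UNIV. z $ j * (q $ a * k (\<phi> u) $ a $ b * J u $ b $ j))"
      by (rule trans[OF sum.cong[OF refl sum.swap] sum.swap])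
    also have "\<dots> = (\<Sum>j\<in>UNIV. z $ j * hessian_term l i j u)"
      by (simp add: hessian_term_def q_def sum_distrib_left)
    also have "\<dots> \<le> (\<Sum>j\<in>UNIV. norm z * \<bar>hessian_term l i j u\<bar>)"
    proof (rule sum_mono)
      fix j
      have "z $ j * hessian_term l i j u \<le> \<bar>z $ j\<bar> * \<bar>hessian_term l i j u\<bar>" by (metis abs_ge_self abs_mult)
      also have "\<dots> \<le> norm z * \<bar>hessian_term l i j u\<bar>" by (intro mult_right_mono component_le_norm_cart) auto
      finally show "z $ j * hessian_term l i j u \<le> norm z * \<bar>hessian_term l i j u\<bar>" .
    qed
    also have "\<dots> = norm z * s" by (simp add: s_def sum_distrib_left)
    also have "\<dots> \<le> (2 * norm q) * s"
      using R(3)[OF u, of z] by (intro mult_right_mono) (auto simp: Jz s_def sum_nonneg)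
    finally have "(norm q)\<^sup>2 / 2 \<le> (2 * norm q) * s" using R(4)[OF u, of q] by linarith
    then have "norm q * norm q \<le> norm q * (4 * s)" by (simp add: power2_eq_square mult_ac)
    moreover have "s \<ge> 0" by (simp add: s_def sum_nonneg)
    ultimately have "norm q \<le> 4 * s" by (cases "q = 0") auto
    moreover have "\<bar>q $ a\<bar> \<le> norm q" by (rule component_le_norm_cart)
    ultimately show ?thesis by (simp add: q_def s_def)
  qed
  have "(\<lambda>u. 4 * (\<Sum>j\<in>UNIV. \<bar>hessian_term l i j u\<bar>)) \<in> decay (CARD('n) + 1)"
    by (intro decay_cmult decay_sum) (use hessian_term_decay in simp)
  then obtain C R' where C: "\<And>u. norm u \<ge> R' \<Longrightarrow> \<bar>4 * (\<Sum>j\<in>UNIV. \<bar>hessian_term l i j u\<bar>)\<bar> \<le> C / norm u ^ (CARD('n) + 1)"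
    unfolding decay_iff by blast
  show ?thesis unfolding decay_iff
  proof (intro exI allI impI)
    fix u :: "real^'n" assume "norm u \<ge> max R R'"
    then show "\<bar>partial l (\<lambda>u. J u $ a $ i) u\<bar> \<le> C / norm u ^ (CARD('n) + 1)"
      using bound[of u] C[of u] by auto
  qed
qed

text \<open>Integrates the second derivatives twice from infinity.  The limit \<open>A\<close> of the Jacobians is orthogonal
since both metrics tend to the Euclidean one.\<close>
lemma asymptotically_affine:
  obtains A :: "real^'n^'n" and b :: "real^'n" where "orthogonal_matrix A"
    "\<And>a i. (\<lambda>u. J u $ a $ i - A $ a $ i) \<in> decay CARD('n)"
    "\<And>a. (\<lambda>u. \<phi> u $ a - (A *v u) $ a - b $ a) \<in> decay (CARD('n) - 1)"
proof -
  have "\<exists>c. (\<lambda>u. J u $ a $ i - c) \<in> decay CARD('n)" for a i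
  proof -
    have "\<forall>\<^sub>F u in at_infinity. (\<lambda>u. J u $ a $ i) differentiable (at u)"
      using src.eventually_in_domain by eventually_elim (rule jacobian_differentiable)
    moreover have "1 \<le> CARD('n)" using src.dim by simp
    ultimately show ?thesis
      using limit_of_partials_decay[OF src.dim _ _ hessian_decay] by blast
  qed
  then obtain c where c: "\<And>a i. (\<lambda>u. J u $ a $ i - c a i) \<in> decay CARD('n)" by metis
  define A where "A = (\<chi> a i. c a i)"
  have A: "(\<lambda>u. J u $ a $ i - A $ a $ i) \<in> decay CARD('n)" for a i using c by (simp add: A_def)
  have "\<exists>b. (\<lambda>u. \<phi> u $ a - (A *v u) $ a - b) \<in> decay (CARD('n) - 1)" for a
  proof -
    let ?F = "\<lambda>u. \<phi> u $ a - (A *v u) $ a"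
    have lin: "((\<lambda>u. (A *v u) $ a) has_derivative (\<lambda>w. (A *v w) $ a)) (at u)" for u
      by (intro bounded_linear.has_derivative[OF bounded_linear_vec_nth] linear_imp_has_derivative matrix_vector_mul_linear)
    have F: "(?F has_derivative (\<lambda>w. (J u *v w) $ a - (A *v w) $ a)) (at u)" if "u \<in> U" for u
      by (intro has_derivative_diff component_derivative[OF that] lin)
    have diff: "\<forall>\<^sub>F u in at_infinity. ?F differentiable (at u)"
      using src.eventually_in_domain by eventually_elim (use F differentiableI in blast)
    have part: "partial i ?F \<in> decay ((CARD('n) - 1) + 1)" for i
    proof (rule decay_eventually_cong)
      show "(\<lambda>u. J u $ a $ i - A $ a $ i) \<in> decay ((CARD('n) - 1) + 1)" using A src.dim by simp
      show "\<forall>\<^sub>F u in at_infinity. J u $ a $ i - A $ a $ i = partial i ?F u"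
        using src.eventually_in_domain
        by eventually_elim (use partial_eqI[OF F] in \<open>simp add: matrix_vector_mul_component inner_axis\<close>)
    qed
    have "1 \<le> CARD('n) - 1" using src.dim by simp
    from limit_of_partials_decay[OF src.dim this diff part] show ?thesis by blast
  qed
  then have "\<exists>b. \<forall>a. (\<lambda>u. \<phi> u $ a - (A *v u) $ a - b a) \<in> decay (CARD('n) - 1)"
    by (intro choice allI)
  then obtain b where b: "\<And>a. (\<lambda>u. \<phi> u $ a - (A *v u) $ a - b a) \<in> decay (CARD('n) - 1)" by blast
  have limit: "(f \<longlongrightarrow> c) at_infinity" if "(\<lambda>u. f u - c) \<in> decay CARD('n)" for f :: "real^'n \<Rightarrow> real" and c
    using decay_tendsto_zero[OF that] src.dim by (simp add: LIM_zero_iff)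
  have "(\<Sum>a\<in>UNIV. A $ a $ i * A $ a $ j) = (if i = j then 1 else 0)" for i j
  proof -
    have "((\<lambda>u. \<Sum>a\<in>UNIV. \<Sum>b\<in>UNIV. J u $ a $ i * k (\<phi> u) $ a $ b * J u $ b $ j) \<longlongrightarrow>
        (\<Sum>a\<in>UNIV. \<Sum>b\<in>UNIV. A $ a $ i * (if a = b then 1 else 0) * A $ b $ j)) at_infinity"
      by (intro tendsto_intros limit A decay_compose[OF tgt.metric_decay(1)])
    moreover have "\<forall>\<^sub>F u in at_infinity. (\<Sum>a\<in>UNIV. \<Sum>b\<in>UNIV. J u $ a $ i * k (\<phi> u) $ a $ b * J u $ b $ j) = h u $ i $ j"
      using src.eventually_in_domain by eventually_elim (simp add: isometry_components)
    ultimately have "((\<lambda>u. h u $ i $ j) \<longlongrightarrow>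
        (\<Sum>a\<in>UNIV. \<Sum>b\<in>UNIV. A $ a $ i * (if a = b then 1 else 0) * A $ b $ j)) at_infinity"
      using tendsto_cong by force
    moreover have "((\<lambda>u. h u $ i $ j) \<longlongrightarrow> (if i = j then 1 else 0)) at_infinity"
      by (rule limit[OF src.metric_decay(1)])
    ultimately have "(\<Sum>a\<in>UNIV. \<Sum>b\<in>UNIV. A $ a $ i * (if a = b then 1 else 0) * A $ b $ j) = (if i = j then 1 else 0)"
      using tendsto_unique[OF trivial_limit_at_infinity] by blast
    then show ?thesis by (simp add: mult_delta_left mult_delta_right)
  qed
  then have "orthogonal_matrix A"
    by (simp add: orthogonal_matrix vec_eq_iff matrix_matrix_mult_def transpose_def mat_def)
  then show thesis using that[of A "\<chi> a. b a"] A b by simp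
qed

section \<open>Comparison of the leading terms\<close>

text \<open>Expands \<open>h(v,v) = k(J v, J v)\<close> with \<open>J v = A v + z\<close> and \<open>z = O(|u|\<^sup>-\<^sup>m)\<close>.  The Euclidean
parts \<open>|v|\<^sup>2\<close> and \<open>|A v|\<^sup>2\<close> cancel; apart from the two leading terms only the part linear in \<open>z\<close> is larger
than \<open>O(|u|\<^sup>-\<^sup>m\<^sup>-\<^sup>1)\<close>.\<close>
lemma displacement_equation:
  fixes A :: "real^'n^'n" and v :: "real^'n"
  assumes A: "orthogonal_matrix A"
    and J: "\<And>a i. (\<lambda>u. J u $ a $ i - A $ a $ i) \<in> decay CARD('n)"
    and \<phi>: "\<And>a. (\<lambda>u. \<phi> u $ a - (A *v u) $ a - b $ a) \<in> decay (CARD('n) - 1)"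
  shows "(\<lambda>u. 2 * (\<Sum>a\<in>UNIV. (A *v v) $ a * ((J u - A) *v v) $ a)
      - form4 (\<lambda>i j k l. W i j k l - pullback4 A W' i j k l) v u u v / norm u ^ (CARD('n) + 2))
    \<in> decay (CARD('n) + 1)"
proof -
  let ?m = "CARD('n)"
  define y where "y = A *v v"
  define z where "z u = (J u - A) *v v" for u
  define K where "K a b u = k (\<phi> u) $ a $ b - (if a = b then 1 else 0)" for a b u
  define H where "H i j u = h u $ i $ j - (if i = j then 1 else 0)" for i j u
  have m: "?m \<ge> 2" by (rule src.dim)
  have "orthogonal_transformation ((*v) A)"
    unfolding orthogonal_transformation_matrix using A by (simp add: matrix_vector_mul_linear)
  then have normA: "norm (A *v u) = norm u" for u by (rule orthogonal_transformation_norm)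
  have z: "(\<lambda>u. z u $ a) \<in> decay ?m" for a
    unfolding z_def by (simp add: matrix_vector_mult_def) (intro decay_sum decay_cmult J)
  have K: "K a b \<in> decay ?m" for a b
    unfolding K_def[abs_def] by (rule decay_compose[OF tgt.metric_decay(1)])
  have KW: "(\<lambda>u. K a c u - weyl_field W' a c (A *v u)) \<in> decay (?m + 1)" for a c
  proof -
    have "(\<lambda>u. K a c u - weyl_field W' a c (\<phi> u)) \<in> decay (?m + 1)"
      unfolding K_def by (rule decay_compose[OF tgt.metric_decay(3)])
    moreover have "(\<lambda>u. weyl_field W' a c (\<phi> u) - weyl_field W' a c (A *v u)) \<in> decay (?m + 1)"
    proof (rule weyl_field_shift[OF normA])
      fix a
      have "(\<lambda>u. (\<phi> u $ a - (A *v u) $ a - b $ a) + b $ a) \<in> decay 0"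
        by (rule sum_in_bigo(1)[OF decay_mono[OF \<phi>] decay_const]) simp
      then show "(\<lambda>u. \<phi> u $ a - (A *v u) $ a) \<in> decay 0" by simp
    qed
    ultimately have "(\<lambda>u. (K a c u - weyl_field W' a c (\<phi> u)) + (weyl_field W' a c (\<phi> u) - weyl_field W' a c (A *v u))) \<in> decay (?m + 1)"
      by (rule sum_in_bigo(1))
    then show ?thesis by simp
  qed
  \<comment> \<open>\<open>E1\<close> and \<open>E3\<close> are the errors of the expansions of \<open>h\<close> and \<open>k\<close>, \<open>E2\<close> and \<open>E4\<close> the terms quadratic in \<open>z\<close> and \<open>K\<close>\<close>
  define E1 where "E1 u = (\<Sum>i\<in>UNIV. \<Sum>j\<in>UNIV. v$i * v$j * (H i j u - weyl_field W i j u))" for u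
  define E2 where "E2 u = (\<Sum>a\<in>UNIV. z u $ a * z u $ a)" for u
  define E3 where "E3 u = (\<Sum>a\<in>UNIV. \<Sum>b\<in>UNIV. y$a * y$b * (K a b u - weyl_field W' a b (A *v u)))" for u
  define E4 where "E4 u = (\<Sum>a\<in>UNIV. \<Sum>b\<in>UNIV. (y$a * z u $ b + z u $ a * y $ b + z u $ a * z u $ b) * K a b u)" for u
  have "E1 \<in> decay (?m + 1)"
    unfolding E1_def[abs_def] H_def by (intro decay_sum decay_cmult src.metric_decay(3))
  moreover have "E2 \<in> decay (?m + 1)"
    unfolding E2_def[abs_def] by (intro decay_sum decay_mono[OF decay_mult[OF z z]]) (use m in simp)
  moreover have "E3 \<in> decay (?m + 1)"
    unfolding E3_def[abs_def] by (intro decay_sum decay_cmult KW)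
  moreover have "E4 \<in> decay (?m + 1)"
  proof -
    have z0: "(\<lambda>u. z u $ a) \<in> decay 0" for a by (rule decay_mono[OF z]) simp
    have "(\<lambda>u. y$a * z u $ b + z u $ a * y $ b + z u $ a * z u $ b) \<in> decay ?m" for a b
      by (intro sum_in_bigo decay_cmult z decay_mult_bounded(1)[OF z z0])
    then show ?thesis
      unfolding E4_def[abs_def] by (intro decay_sum decay_mono[OF decay_mult[OF _ K]]) (use m in auto)
  qed
  ultimately have E: "(\<lambda>u. E1 u - E2 u - E3 u - E4 u) \<in> decay (?m + 1)" by (intro sum_in_bigo)
  show ?thesis
  proof (rule decay_eventually_cong[OF E])
    show "\<forall>\<^sub>F u in at_infinity. E1 u - E2 u - E3 u - E4 u =
      2 * (\<Sum>a\<in>UNIV. (A *v v) $ a * ((J u - A) *v v) $ a)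
      - form4 (\<lambda>i j k l. W i j k l - pullback4 A W' i j k l) v u u v / norm u ^ (?m + 2)"
      using src.eventually_in_domain
    proof eventually_elim
      fix u assume u: "u \<in> U"
      have split: "x \<bullet> (G *v x) = x \<bullet> x + (\<Sum>i\<in>UNIV. \<Sum>j\<in>UNIV. x$i * x$j * (G $ i $ j - (if i = j then 1 else 0)))"
        for G :: "real^'n^'n" and x
      proof -
        have "x \<bullet> ((G - mat 1) *v x) = (\<Sum>i\<in>UNIV. \<Sum>j\<in>UNIV. x$i * x$j * (G $ i $ j - (if i = j then 1 else 0)))"
          unfolding inner_matrix_vector by (simp add: mat_def mult_ac)
        then show ?thesis by (simp add: matrix_vector_mult_diff_rdistrib inner_diff_right)
      qed
      have Jv: "J u *v v = y + z u" by (simp add: y_def z_def matrix_vector_mult_diff_rdistrib)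
      have yy: "y \<bullet> y = v \<bullet> v" using normA[of v] by (simp add: y_def flip: power2_norm_eq_inner)
      have "v \<bullet> v + (\<Sum>i\<in>UNIV. \<Sum>j\<in>UNIV. v$i * v$j * H i j u) =
          (y + z u) \<bullet> (y + z u) + (\<Sum>a\<in>UNIV. \<Sum>b\<in>UNIV. (y + z u)$a * (y + z u)$b * K a b u)"
        using metric_pullback[OF u, of v v] unfolding Jv split H_def K_def .
      moreover have "(y + z u) \<bullet> (y + z u) = v \<bullet> v + 2 * (\<Sum>a\<in>UNIV. y$a * z u $ a) + E2 u"
        by (simp add: inner_add_left inner_add_right inner_commute[of "z u" y] yy E2_def)
          (simp add: inner_vec_def)
      moreover have "(\<Sum>a\<in>UNIV. \<Sum>b\<in>UNIV. (y + z u)$a * (y + z u)$b * K a b u) =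
          E3 u + (\<Sum>a\<in>UNIV. \<Sum>b\<in>UNIV. y$a * y$b * weyl_field W' a b (A *v u)) + E4 u"
        unfolding E3_def E4_def by (simp add: sum.distrib[symmetric] algebra_simps)
      moreover have "(\<Sum>i\<in>UNIV. \<Sum>j\<in>UNIV. v$i * v$j * H i j u) =
          E1 u + (\<Sum>i\<in>UNIV. \<Sum>j\<in>UNIV. v$i * v$j * weyl_field W i j u)"
        unfolding E1_def by (simp add: sum.distrib[symmetric] algebra_simps)
      ultimately have "E1 u - E2 u - E3 u - E4 u = 2 * (\<Sum>a\<in>UNIV. y$a * z u $ a)
          - ((\<Sum>i\<in>UNIV. \<Sum>j\<in>UNIV. v$i * v$j * weyl_field W i j u)
             - (\<Sum>a\<in>UNIV. \<Sum>b\<in>UNIV. y$a * y$b * weyl_field W' a b (A *v u)))" by linarith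
      also have "(\<Sum>i\<in>UNIV. \<Sum>j\<in>UNIV. v$i * v$j * weyl_field W i j u)
             - (\<Sum>a\<in>UNIV. \<Sum>b\<in>UNIV. y$a * y$b * weyl_field W' a b (A *v u)) =
          form4 (\<lambda>i j k l. W i j k l - pullback4 A W' i j k l) v u u v / norm u ^ (?m + 2)"
        unfolding weyl_field_form4 form4_diff form4_pullback4 normA y_def by (simp add: diff_divide_distrib)
      finally show "E1 u - E2 u - E3 u - E4 u =
        2 * (\<Sum>a\<in>UNIV. (A *v v) $ a * ((J u - A) *v v) $ a)
        - form4 (\<lambda>i j k l. W i j k l - pullback4 A W' i j k l) v u u v / norm u ^ (?m + 2)"
        by (simp add: y_def z_def)
    qed
  qed
qed

text \<open>For fixed \<open>v\<close>, the function \<open>2 A v \<bullet> \<eta>\<close> satisfies the hypotheses of the X-ray argument.\<close>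
lemma leading_tensors_equivalent:
  assumes W: "curvature_like W" "curvature_like W'"
  obtains A :: "real^'n^'n" where "orthogonal_matrix A" "\<And>i j k l. W i j k l = pullback4 A W' i j k l"
proof -
  obtain A :: "real^'n^'n" and b :: "real^'n" where A: "orthogonal_matrix A"
    and J: "\<And>a i. (\<lambda>u. J u $ a $ i - A $ a $ i) \<in> decay CARD('n)"
    and \<phi>: "\<And>a. (\<lambda>u. \<phi> u $ a - (A *v u) $ a - b $ a) \<in> decay (CARD('n) - 1)"
    using asymptotically_affine by blast
  define T where "T = (\<lambda>i j k l. W i j k l - pullback4 A W' i j k l)"
  have T: "curvature_like T"
    unfolding T_def by (intro curvature_like_diff curvature_like_pullback4 W)
  obtain R where R: "\<And>u. norm u \<ge> R \<Longrightarrow> u \<in> U" using src.exterior_subset by blast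
  have "T i j k l = 0" for i j k l
  proof (rule curvature_like_eq_zero[OF T])
    fix p v :: "real^'n" assume pv: "norm p = 1" "norm v = 1" "p \<bullet> v = 0"
    show "form4 T v p p v = 0"
    proof (rule line_integral_zero[OF T pv])
      show "((\<lambda>u. 2 * (\<Sum>a\<in>UNIV. (A *v v) $ a * (\<phi> u $ a - (A *v u) $ a - b $ a))) has_derivative
          (\<lambda>w. 2 * (\<Sum>a\<in>UNIV. (A *v v) $ a * ((J u - A) *v w) $ a))) (at u)" if "norm u \<ge> R" for u
      proof -
        have lin: "((\<lambda>u. (A *v u) $ a) has_derivative (\<lambda>w. (A *v w) $ a)) (at u)" for a
          by (intro bounded_linear.has_derivative[OF bounded_linear_vec_nth] linear_imp_has_derivative matrix_vector_mul_linear)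
        have "((\<lambda>u. \<phi> u $ a - (A *v u) $ a - b $ a) has_derivative (\<lambda>w. ((J u - A) *v w) $ a)) (at u)" for a
          using has_derivative_diff[OF has_derivative_diff[OF component_derivative[OF R[OF that], of a] lin[of a]] has_derivative_const]
          by (simp add: matrix_vector_mult_diff_rdistrib)
        then show ?thesis by (intro has_derivative_mult_right has_derivative_sum)
      qed
      show "1 \<le> CARD('n)" using src.dim by simp
      show "(\<lambda>u. 2 * (\<Sum>a\<in>UNIV. (A *v v) $ a * ((J u - A) *v v) $ a) - form4 T v u u v / norm u ^ (CARD('n) + 2))
          \<in> decay (CARD('n) + 1)"
        unfolding T_def by (rule displacement_equation[OF A J \<phi>])
      have "(\<lambda>u. 2 * (\<Sum>a\<in>UNIV. (A *v v) $ a * (\<phi> u $ a - (A *v u) $ a - b $ a))) \<in> decay (CARD('n) - 1)"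
        by (intro decay_cmult decay_sum \<phi>)
      then show "((\<lambda>u. 2 * (\<Sum>a\<in>UNIV. (A *v v) $ a * (\<phi> u $ a - (A *v u) $ a - b $ a))) \<longlongrightarrow> 0) at_infinity"
        by (rule decay_tendsto_zero) (use src.dim in simp)
    qed
  qed
  then show thesis using that[OF A] by (simp add: T_def)
qed

end

section \<open>Coordinates on the universal cover\<close>

lemma jacobian_eqI:
  fixes f :: "real^'n::finite \<Rightarrow> real^'m::finite"
  assumes "(f has_derivative (\<lambda>w. M *v w)) (at u)"
  shows "jacobian f (at u) = M"
  unfolding jacobian_def frechet_derivative_at[OF assms, symmetric] by (rule matrix_of_matrix_vector_mul)

lemma smooth_map_on_jacobian:
  fixes F :: "real^'n::finite \<Rightarrow> real^'m::finite"
  assumes F: "smooth_map_on S F" and S: "open S" "u \<in> S"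
  shows "(F has_derivative (\<lambda>w. jacobian F (at u) *v w)) (at u)"
    and "(\<lambda>u. jacobian F (at u) $ a $ i) differentiable (at u)"
proof -
  have comp: "(\<lambda>u. F u $ a) differentiable (at v)" "partial i (\<lambda>u. F u $ a) differentiable (at v)"
    if "v \<in> S" for a i v
    using F that unfolding smooth_map_on_def smooth_real_on_def
    by (metis iter_partial.simps(1), metis iter_partial.simps)
  have D: "(F has_derivative (\<lambda>w. jacobian F (at v) *v w)) (at v)" if v: "v \<in> S" for v
  proof -
    have "F differentiable (at v)"
      unfolding differentiable_componentwise_within[of F v UNIV]
      using comp(1)[OF v] by (auto simp: Basis_vec_def inner_axis)
    then show ?thesis by (simp add: jacobian_works)
  qed
  show "(F has_derivative (\<lambda>w. jacobian F (at u) *v w)) (at u)" by (rule D[OF S(2)])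
  have "partial i (\<lambda>u. F u $ a) v = jacobian F (at v) $ a $ i" if "v \<in> S" for v
    using partial_eqI[OF bounded_linear.has_derivative[OF bounded_linear_vec_nth D[OF that]], of i a]
    by (simp add: matrix_vector_mul_component inner_axis)
  then show "(\<lambda>u. jacobian F (at u) $ a $ i) differentiable (at u)"
    by (rule partial_cong_open(2)[OF S _ comp(2)[OF S(2)]])
qed

lemma jacobian_compose_differentiable:
  fixes \<theta> :: "real^'n::finite \<Rightarrow> real^'n" and \<eta> :: "real^'n \<Rightarrow> real^'n"
  assumes \<theta>: "smooth_map_on S \<theta>" and \<eta>: "smooth_map_on T \<eta>"
    and op: "open S" "open T" and im: "\<theta> ` S \<subseteq> T" and u: "u \<in> S"
    and f: "\<And>v. v \<in> S \<Longrightarrow> f v = \<eta> (\<theta> v)"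
  shows "(f has_derivative (\<lambda>w. jacobian f (at u) *v w)) (at u)"
    and "(\<lambda>u. jacobian f (at u) $ a $ i) differentiable (at u)"
proof -
  let ?A = "\<lambda>u. jacobian \<eta> (at (\<theta> u))" and ?B = "\<lambda>u. jacobian \<theta> (at u)"
  have D: "(f has_derivative (\<lambda>w. (?A v ** ?B v) *v w)) (at v)" if v: "v \<in> S" for v
  proof -
    have "\<theta> v \<in> T" using im v by blast
    then have "((\<lambda>v. \<eta> (\<theta> v)) has_derivative (\<lambda>w. ?A v *v (?B v *v w))) (at v)"
      using has_derivative_compose[OF smooth_map_on_jacobian(1)[OF \<theta> op(1) v] smooth_map_on_jacobian(1)[OF \<eta> op(2)]] by blast
    then have "(f has_derivative (\<lambda>w. ?A v *v (?B v *v w))) (at v)"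
      by (rule has_derivative_transform_within_open[OF _ op(1) v]) (simp add: f)
    then show ?thesis by (simp add: matrix_vector_mul_assoc)
  qed
  note J = jacobian_eqI[OF D]
  show "(f has_derivative (\<lambda>w. jacobian f (at u) *v w)) (at u)" unfolding J[OF u] by (rule D[OF u])
  have "\<theta> u \<in> T" using im u by blast
  have A: "(\<lambda>u. ?A u $ a $ i) differentiable (at u)" for a i
  proof -
    have "((\<lambda>u. jacobian \<eta> (at u) $ a $ i) \<circ> \<theta>) differentiable (at u)"
      by (intro differentiable_chain_at smooth_map_on_jacobian(2)[OF \<eta> op(2) \<open>\<theta> u \<in> T\<close>]
          differentiableI[OF smooth_map_on_jacobian(1)[OF \<theta> op(1) u]])
    then show ?thesis by (simp add: o_def)
  qed
  have "(\<lambda>u. \<Sum>l\<in>UNIV. ?A u $ a $ l * ?B u $ l $ i) differentiable (at u)"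
    by (intro differentiable_sum ballI differentiable_mult A smooth_map_on_jacobian(2)[OF \<theta> op(1) u]) auto
  then show "(\<lambda>u. jacobian f (at u) $ a $ i) differentiable (at u)"
    by (rule partial_cong_open(2)[OF op(1) u, rotated]) (simp add: J matrix_matrix_mult_def)
qed

locale covered_region =
  fixes M :: "'a::topological_space set" and \<A> :: "('a, 'n::finite) chart set"
    and X :: "'b::topological_space set" and p :: "'b \<Rightarrow> 'a" and S :: "'a set"
  assumes atlas: "smooth_atlas M \<A>" and cover: "covering_space X p S" and region: "S \<subseteq> M"
begin

lemma chart_at_point:
  assumes "z \<in> X"
  shows "chart_at \<A> (p z) \<in> \<A>" "p z \<in> fst (chart_at \<A> (p z))"
proof -
  have "p ` X = S" using cover unfolding covering_space_def by blast
  then have "p z \<in> M" using region assms by blast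
  then have "\<exists>c. c \<in> \<A> \<and> p z \<in> fst c" using atlas by (auto simp: smooth_atlas_def)
  then have "chart_at \<A> (p z) \<in> \<A> \<and> p z \<in> fst (chart_at \<A> (p z))" unfolding chart_at_def by (rule someI_ex)
  then show "chart_at \<A> (p z) \<in> \<A>" "p z \<in> fst (chart_at \<A> (p z))" by auto
qed

text \<open>A sheet of the covering, cut down to the preimage of the chart that serves to evaluate the metric at
\<open>p z\<close>.\<close>
lemma lifted_chart_at_point:
  assumes z: "z \<in> X"
  obtains N where "z \<in> N" "openin (top_of_set X) N" "inj_on (snd (chart_at \<A> (p z)) \<circ> p) N"
    "(N, snd (chart_at \<A> (p z)) \<circ> p) \<in> lifted_atlas X p \<A>"
proof -
  let ?c = "chart_at \<A> (p z)"
  note c = chart_at_point[OF z]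
  have cont: "continuous_on X p" and im: "p ` X = S" using cover unfolding covering_space_def by blast+
  have "p z \<in> S" using im z by blast
  then have "\<exists>T. p z \<in> T \<and> openin (top_of_set S) T \<and>
      (\<exists>v. \<Union>v = X \<inter> p -` T \<and> (\<forall>u\<in>v. openin (top_of_set X) u) \<and> pairwise disjnt v \<and>
        (\<forall>u\<in>v. \<exists>q. homeomorphism u T p q))"
    using cover unfolding covering_space_def by blast
  then obtain T where T: "p z \<in> T \<and> openin (top_of_set S) T \<and>
      (\<exists>v. \<Union>v = X \<inter> p -` T \<and> (\<forall>u\<in>v. openin (top_of_set X) u) \<and> pairwise disjnt v \<and>
        (\<forall>u\<in>v. \<exists>q. homeomorphism u T p q))" ..
  then have pT: "p z \<in> T" by (rule conjunct1)
  from T obtain v where sheets: "\<Union>v = X \<inter> p -` T"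
    and v: "\<forall>u\<in>v. openin (top_of_set X) u" "\<forall>u\<in>v. \<exists>q. homeomorphism u T p q" by (elim exE conjE) rule
  have "z \<in> \<Union>v" unfolding sheets using z pT by simp
  then obtain N0 where N0: "N0 \<in> v" "z \<in> N0" by blast
  obtain q where "homeomorphism N0 T p q" using v(2) N0(1) by blast
  then have inj: "inj_on p N0" by (metis homeomorphism_apply1 inj_onI)
  have chart: "topological_chart M ?c" using atlas c(1) by (auto simp: smooth_atlas_def)
  define N where "N = N0 \<inter> (X \<inter> p -` fst ?c)"
  have preimage: "openin (top_of_set X) (X \<inter> p -` fst ?c)"
  proof (rule continuous_openin_preimage[OF cont])
    show "openin (top_of_set M) (fst ?c)" using chart by (simp add: topological_chart_def)
    show "p \<in> X \<rightarrow> M" using im region by auto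
  qed
  have N: "openin (top_of_set X) N"
    unfolding N_def by (rule openin_Int[OF _ preimage]) (use v(1) N0(1) in blast)
  have injN: "inj_on p N" using inj by (auto simp: N_def inj_on_def)
  have pN: "p ` N \<subseteq> fst ?c" by (auto simp: N_def)
  have "homeomorphism (fst ?c) (snd ?c ` fst ?c) (snd ?c) (chart_inv ?c)"
    using chart by (simp add: topological_chart_def)
  then have "inj_on (snd ?c) (fst ?c)"
    by (intro inj_on_inverseI[where g = "chart_inv ?c"]) (rule homeomorphism_apply1)
  then have "inj_on (snd ?c \<circ> p) N" by (intro comp_inj_on injN) (rule inj_on_subset[OF _ pN])
  moreover have "(N, snd ?c \<circ> p) \<in> lifted_atlas X p \<A>"
    unfolding lifted_atlas_def using c(1) N injN pN by blast
  moreover have "z \<in> N" using N0(2) z c(2) by (simp add: N_def)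
  ultimately show thesis using that N by blast
qed

lemma coordinates_inverse:
  assumes x: "lifted_coordinates X p \<A> x"
  shows "z \<in> X \<Longrightarrow> chart_inv (X, x) (x z) = z" "u \<in> x ` X \<Longrightarrow> x (chart_inv (X, x) u) = u"
    "u \<in> x ` X \<Longrightarrow> chart_inv (X, x) u \<in> X"
proof -
  have h: "homeomorphism X (x ` X) x (chart_inv (X, x))"
    using x by (simp add: lifted_coordinates_def topological_chart_def)
  show "z \<in> X \<Longrightarrow> chart_inv (X, x) (x z) = z" "u \<in> x ` X \<Longrightarrow> x (chart_inv (X, x) u) = u"
    using h by (auto simp: homeomorphism_def)
  show "u \<in> x ` X \<Longrightarrow> chart_inv (X, x) u \<in> X" using h by (auto simp: homeomorphism_def)
qed

lemma coordinates_open_image: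
  assumes x: "lifted_coordinates X p \<A> x" and N: "openin (top_of_set X) N"
  shows "open (x ` N)"
proof -
  have h: "homeomorphism X (x ` X) x (chart_inv (X, x))" and o: "open (x ` X)"
    using x by (auto simp: lifted_coordinates_def topological_chart_def)
  have "openin (top_of_set (x ` X)) (x ` N)" using homeomorphism_imp_open_map[OF h N] .
  then show ?thesis using o openin_open_eq by blast
qed

text \<open>The chart image of \<open>N\<close> is open by invariance of domain: it is the image of the open set \<open>x ` N\<close> under a
continuous injection.\<close>
lemma chart_in_coordinates:
  assumes x: "lifted_coordinates X p \<A> x" and N: "openin (top_of_set X) N"
    and d: "inj_on d N" "(N, d) \<in> lifted_atlas X p \<A>"
  shows "smooth_map_on (x ` N) (d \<circ> chart_inv (X, x))" "open (d ` N)"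
    "smooth_map_on (d ` N) (x \<circ> chart_inv (N, d))"
proof -
  have NX: "N \<subseteq> X" using N openin_imp_subset by blast
  then have XN: "X \<inter> N = N" "N \<inter> X = N" by auto
  have "smoothly_compatible (X, x) (N, d)" using x d(2) by (auto simp: lifted_coordinates_def)
  then show s: "smooth_map_on (x ` N) (d \<circ> chart_inv (X, x))" "smooth_map_on (d ` N) (x \<circ> chart_inv (N, d))"
    by (auto simp: smoothly_compatible_def XN)
  have o: "open (x ` N)" by (rule coordinates_open_image[OF x N])
  have inv: "chart_inv (X, x) (x z) = z" if "z \<in> N" for z using coordinates_inverse(1)[OF x] NX that by blast
  have "open ((d \<circ> chart_inv (X, x)) ` (x ` N))"
  proof (rule invariance_of_domain[OF _ o])
    show "continuous_on (x ` N) (d \<circ> chart_inv (X, x))"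
      using smooth_map_on_jacobian(1)[OF s(1) o] has_derivative_continuous
      by (meson continuous_at_imp_continuous_on)
    show "inj_on (d \<circ> chart_inv (X, x)) (x ` N)"
      using d(1) inv by (auto simp: inj_on_def)
  qed
  moreover have "(d \<circ> chart_inv (X, x)) ` (x ` N) = d ` N"
    using inv by (simp add: image_image)
  ultimately show "open (d ` N)" by simp
qed

text \<open>Near a given point the transition map factors through a chart of the manifold, with both factors
smooth by the compatibility of the coordinates with the lifted atlas.\<close>
lemma transition_jacobian:
  assumes x: "lifted_coordinates X p \<A> x" and y: "lifted_coordinates X p \<A> y" and u: "u \<in> x ` X"
  shows "((y \<circ> chart_inv (X, x)) has_derivative (\<lambda>w. jacobian (y \<circ> chart_inv (X, x)) (at u) *v w)) (at u)"
    and "(\<lambda>u. jacobian (y \<circ> chart_inv (X, x)) (at u) $ a $ i) differentiable (at u)"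
proof -
  obtain z where z: "z \<in> X" "u = x z" using u by blast
  let ?d = "snd (chart_at \<A> (p z)) \<circ> p"
  obtain N where N: "z \<in> N" "openin (top_of_set X) N" "inj_on ?d N" "(N, ?d) \<in> lifted_atlas X p \<A>"
    by (rule lifted_chart_at_point[OF z(1)])
  have NX: "N \<subseteq> X" using N openin_imp_subset by blast
  have inv: "chart_inv (X, x) (x z) = z" if "z \<in> N" for z using coordinates_inverse(1)[OF x] NX that by blast
  have inv': "chart_inv (N, ?d) (?d z) = z" if "z \<in> N" for z
    unfolding chart_inv_def fst_conv snd_conv using N(3) that by (rule inv_into_f_f)
  note cx = chart_in_coordinates[OF x N(2,3,4)] and cy = chart_in_coordinates[OF y N(2,3,4)]
  have im: "(?d \<circ> chart_inv (X, x)) ` (x ` N) \<subseteq> ?d ` N" using inv by auto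
  have eq: "(y \<circ> chart_inv (X, x)) v = (y \<circ> chart_inv (N, ?d)) ((?d \<circ> chart_inv (X, x)) v)" if "v \<in> x ` N" for v
    using that inv inv' by (auto simp del: o_apply) (simp add: o_def)
  have uN: "u \<in> x ` N" using z N by blast
  show "((y \<circ> chart_inv (X, x)) has_derivative (\<lambda>w. jacobian (y \<circ> chart_inv (X, x)) (at u) *v w)) (at u)"
    "(\<lambda>u. jacobian (y \<circ> chart_inv (X, x)) (at u) $ a $ i) differentiable (at u)"
    using jacobian_compose_differentiable[OF cx(1) cy(3) coordinates_open_image[OF x N(2)] cy(2) im uN eq]
    by blast+
qed

text \<open>The chart used to evaluate the metric depends only on the point of the manifold, so it is the same for
both coordinate systems and the chain rule suffices.\<close>
lemma lifted_metric_transition: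
  assumes x: "lifted_coordinates X p \<A> x" and y: "lifted_coordinates X p \<A> y" and u: "u \<in> x ` X"
  shows "lifted_metric \<A> g X p x u =
    transpose (jacobian (y \<circ> chart_inv (X, x)) (at u)) ** lifted_metric \<A> g X p y (y (chart_inv (X, x) u))
      ** jacobian (y \<circ> chart_inv (X, x)) (at u)"
proof -
  obtain z where z: "z \<in> X" "u = x z" using u by blast
  define c where "c = chart_at \<A> (p z)"
  obtain N where N: "z \<in> N" "openin (top_of_set X) N" "inj_on (snd c \<circ> p) N" "(N, snd c \<circ> p) \<in> lifted_atlas X p \<A>"
    unfolding c_def by (rule lifted_chart_at_point[OF z(1)])
  let ?J = "jacobian (y \<circ> chart_inv (X, x)) (at u)"
  let ?Jy = "jacobian (snd c \<circ> p \<circ> chart_inv (X, y)) (at (y z))"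
  let ?Jx = "jacobian (snd c \<circ> p \<circ> chart_inv (X, x)) (at u)"
  have ux: "chart_inv (X, x) u = z" using coordinates_inverse(1)[OF x z(1)] z(2) by simp
  have uy: "chart_inv (X, y) (y z) = z" by (rule coordinates_inverse(1)[OF y z(1)])
  have yu: "(y \<circ> chart_inv (X, x)) u = y z" by (simp add: ux)
  have "((snd c \<circ> p \<circ> chart_inv (X, y)) has_derivative (\<lambda>w. ?Jy *v w)) (at ((y \<circ> chart_inv (X, x)) u))"
    unfolding yu by (rule smooth_map_on_jacobian(1)[OF chart_in_coordinates(1)[OF y N(2,3,4)] coordinates_open_image[OF y N(2)]])
      (use N(1) in blast)
  then have "((\<lambda>v. (snd c \<circ> p \<circ> chart_inv (X, y)) ((y \<circ> chart_inv (X, x)) v)) has_derivative (\<lambda>w. ?Jy *v (?J *v w))) (at u)"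
    by (rule has_derivative_compose[OF transition_jacobian(1)[OF x y u]])
  then have "((snd c \<circ> p \<circ> chart_inv (X, x)) has_derivative (\<lambda>w. ?Jy *v (?J *v w))) (at u)"
  proof (rule has_derivative_transform_within_open)
    show "open (x ` X)" using x by (auto simp: lifted_coordinates_def topological_chart_def)
    show "u \<in> x ` X" by (rule u)
    fix v assume "v \<in> x ` X"
    then show "(snd c \<circ> p \<circ> chart_inv (X, y)) ((y \<circ> chart_inv (X, x)) v) = (snd c \<circ> p \<circ> chart_inv (X, x)) v"
      using coordinates_inverse(1)[OF y] coordinates_inverse(3)[OF x] by simp
  qed
  then have "?Jx = ?Jy ** ?J" by (intro jacobian_eqI) (simp add: matrix_vector_mul_assoc)
  then show ?thesis
    by (simp add: lifted_metric_def Let_def ux uy c_def[symmetric] matrix_transpose_mul matrix_mul_assoc)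
qed

lemma lifted_metric_symmetric:
  assumes g: "riemannian_metric \<A> g" and x: "lifted_coordinates X p \<A> x" and u: "u \<in> x ` X"
  shows "transpose (lifted_metric \<A> g X p x u) = lifted_metric \<A> g X p x u"
proof -
  have z: "chart_inv (X, x) u \<in> X" by (rule coordinates_inverse(3)[OF x u])
  have "transpose (g (chart_at \<A> (p (chart_inv (X, x) u))) (p (chart_inv (X, x) u))) =
      g (chart_at \<A> (p (chart_inv (X, x) u))) (p (chart_inv (X, x) u))"
    using g chart_at_point[OF z] by (auto simp: riemannian_metric_def)
  then show ?thesis
    by (simp add: lifted_metric_def Let_def matrix_transpose_mul matrix_mul_assoc)
qed

end

section \<open>Uniqueness of the Weyl tensor at infinity\<close>

theorem theorem1p5:
  fixes M \<Omega> K :: "'a::{t2_space, second_countable_topology} set"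
    and \<A> :: "('a, 'n::finite) chart set"
    and g :: "('a, 'n) metric_comps"
    and vol :: "'a measure"
    and pt :: 'a and C :: real
    and X :: "'b::topological_space set" and p :: "'b \<Rightarrow> 'a"
    and x y :: "'b \<Rightarrow> real^'n"
    and W W' :: "'n \<Rightarrow> 'n \<Rightarrow> 'n \<Rightarrow> 'n \<Rightarrow> real"
  assumes dim: "CARD('n) \<ge> 4"
    and manifold: "smooth_atlas M \<A>"
    and metric: "riemannian_metric \<A> g"
    and volume: "riemannian_volume M \<A> g vol"
    and the_end: "end_of M \<Omega>"
    and ricci_flat: "ricci_flat_on \<A> g \<Omega>"
    and growth: "pt \<in> M" "C > 0"
      "\<forall>\<^sub>F r in at_top. emeasure vol (geodesic_ball M \<A> g pt r \<inter> \<Omega>) \<ge> ennreal (C * r ^ CARD('n))"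
    and energy: "(\<integral>\<^sup>+q\<in>\<Omega>. ennreal (Rm_norm \<A> g q powr (real CARD('n) / 2)) \<partial>vol) < \<infinity>"
    and compact: "compact K" "K \<subseteq> M"
    and cover: "universal_cover X p (\<Omega> - K)"
    and x_coords: "lifted_coordinates X p \<A> x" "exterior_domain (x ` X)"
    and y_coords: "lifted_coordinates X p \<A> y" "exterior_domain (y ` X)"
    and weyl: "weyl_tensor W" "weyl_tensor W'"
    and x_expansion: "has_weyl_expansion (x ` X) (lifted_metric \<A> g X p x) W"
    and y_expansion: "has_weyl_expansion (y ` X) (lifted_metric \<A> g X p y) W'"
  shows "\<exists>A :: real^'n^'n. orthogonal_matrix A \<and>
    (\<forall>i j k l. W i j k l =
       (\<Sum>a\<in>UNIV. \<Sum>b\<in>UNIV. \<Sum>c\<in>UNIV. \<Sum>d\<in>UNIV.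
          W' a b c d * A $ a $ i * A $ b $ j * A $ c $ k * A $ d $ l))"
proof -
  have "\<Omega> \<subseteq> M" using the_end in_components_subset unfolding end_of_def by blast
  then interpret covered_region M \<A> X p "\<Omega> - K"
    using manifold cover by unfold_locales (auto simp: universal_cover_def)
  note inv_x = coordinates_inverse[OF x_coords(1)] and inv_y = coordinates_inverse[OF y_coords(1)]
  interpret coordinate_change "x ` X" "lifted_metric \<A> g X p x" W "y ` X" "lifted_metric \<A> g X p y" W'
    "y \<circ> chart_inv (X, x)" "x \<circ> chart_inv (X, y)"
    "\<lambda>u. jacobian (y \<circ> chart_inv (X, x)) (at u)" "\<lambda>v. jacobian (x \<circ> chart_inv (X, y)) (at v)"
  proof unfold_locales
    show "2 \<le> CARD('n)" using dim by simp
    show "exterior_domain (x ` X)" "exterior_domain (y ` X)" by (fact x_coords y_coords)+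
    show "has_weyl_expansion (x ` X) (lifted_metric \<A> g X p x) W"
      "has_weyl_expansion (y ` X) (lifted_metric \<A> g X p y) W'" by (fact x_expansion y_expansion)+
    show "u \<in> x ` X \<Longrightarrow> transpose (lifted_metric \<A> g X p x u) = lifted_metric \<A> g X p x u" for u
      by (rule lifted_metric_symmetric[OF metric x_coords(1)])
    show "v \<in> y ` X \<Longrightarrow> transpose (lifted_metric \<A> g X p y v) = lifted_metric \<A> g X p y v" for v
      by (rule lifted_metric_symmetric[OF metric y_coords(1)])
    fix a i
    show "u \<in> x ` X \<Longrightarrow> (y \<circ> chart_inv (X, x)) u \<in> y ` X" for u using inv_x by simp
    show "v \<in> y ` X \<Longrightarrow> (x \<circ> chart_inv (X, y)) v \<in> x ` X" for v using inv_y by simp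
    show "u \<in> x ` X \<Longrightarrow> (x \<circ> chart_inv (X, y)) ((y \<circ> chart_inv (X, x)) u) = u" for u
      using inv_x inv_y by simp
    show "v \<in> y ` X \<Longrightarrow> (y \<circ> chart_inv (X, x)) ((x \<circ> chart_inv (X, y)) v) = v" for v
      using inv_x inv_y by simp
    show "u \<in> x ` X \<Longrightarrow> ((y \<circ> chart_inv (X, x)) has_derivative (\<lambda>w. jacobian (y \<circ> chart_inv (X, x)) (at u) *v w)) (at u)"
      "u \<in> x ` X \<Longrightarrow> (\<lambda>u. jacobian (y \<circ> chart_inv (X, x)) (at u) $ a $ i) differentiable (at u)" for u
      by (fact transition_jacobian[OF x_coords(1) y_coords(1)])+
    show "v \<in> y ` X \<Longrightarrow> ((x \<circ> chart_inv (X, y)) has_derivative (\<lambda>w. jacobian (x \<circ> chart_inv (X, y)) (at v) *v w)) (at v)"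
      "v \<in> y ` X \<Longrightarrow> (\<lambda>u. jacobian (x \<circ> chart_inv (X, y)) (at u) $ a $ i) differentiable (at v)" for v
      by (fact transition_jacobian[OF y_coords(1) x_coords(1)])+
    show "u \<in> x ` X \<Longrightarrow> lifted_metric \<A> g X p x u =
        transpose (jacobian (y \<circ> chart_inv (X, x)) (at u)) ** lifted_metric \<A> g X p y ((y \<circ> chart_inv (X, x)) u)
          ** jacobian (y \<circ> chart_inv (X, x)) (at u)" for u
      using lifted_metric_transition[OF x_coords(1) y_coords(1)] by simp
  qed
  obtain A :: "real^'n^'n" where "orthogonal_matrix A" "\<And>i j k l. W i j k l = pullback4 A W' i j k l"
    using leading_tensors_equivalent[OF weyl[THEN curvature_like_weyl_tensor]] by blast
  then show ?thesis by (auto simp: pullback4_def form4_def column_def)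
qed

end
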